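(* Let $T$ be a (possibly unbounded) self-adjoint operator on a Hilbert space $\mathcal{H}$, with bounded transform $S=T(I+T^2)^{-1/2}$. Then $W^*(T)=W^*(S)$, and the map $f\mapsto f(T)$ is a norm-decreasing $*$-homomorphism (i.e. $\|f(T)\|\le\|f\|_\infty$) from $\mathcal{B}_b(\sigma(T))$ to $W^*(T)=W^*(S)$. More generally, if $f\in\mathcal{B}(\sigma(T))$, then $f(T)$ is affiliated with $W^*(T)$.
   Context: $\mathcal{H}$ is a complex Hilbert space and $T$ is a densely defined operator with $T^*=T$, not assumed bounded. Its bounded transform $S=T\sqrt{I+T^2}^{\,-1}$ is a bounded self-adjoint operator with $\|Sx\|<\|x\|$ for all $x\neq0$, and $T=S\sqrt{I-S^2}^{\,-1}$. In particular $\pm1$ are not eigenvalues of $S$. A bounded operator $R\in B(\mathcal{H})$ commutes with a closed operator $X$ if for every $\psi\in\mathcal{D}(X)$ one has $R\psi\in\mathcal{D}(X)$ and $RX\psi=XR\psi$. $\{T\}'$ denotes the set of all bounded operators commuting with $T$ (a von Neumann algebra), and $W^*(T)=\{T\}''$ is its commutant in $B(\mathcal{H})$. For the bounded operator $S$, $W^*(S)=C^*(S)''$, where $C^*(S)$ is the $C^*$-algebra generated by $S$ and $I$ in $B(\mathcal{H})$. A closed operator $X$ is affiliated to (with) a von Neumann algebra $A\subset B(\mathcal{H})$ if every $R\in A'$ commutes with $X$. $\mathcal{B}(\sigma(T))$ is the space of complex-valued Borel functions on $\sigma(T)$ and $\mathcal{B}_b(\sigma(T))$ is the subspace of bounded ones,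 equipped with the supremum norm $\|\cdot\|_\infty$, pointwise operations and involution $f^*(x)=\overline{f(x)}$. With $u:(-1,1)\to\mathbb{R}$, $u(x)=x/\sqrt{1-x^2}$, and $\tilde\sigma(S)=\sigma(S)\cap(-1,1)$ (so $u(\tilde\sigma(S))=\sigma(T)$), define $f(T)=(f\circ u)(S)$ by the usual Borel functional calculus of the bounded self-adjoint operator $S$. Here $f\circ u$ is a Borel function on $\tilde\sigma(S)$, extended, say, by $0$ to $\sigma(S)\cap\{\pm1\}$ (the choice is irrelevant since $\pm1$ are not eigenvalues of $S$). For unbounded $f$, $(f\circ u)(S)$ is the usual closed, densely defined operator $\int f\circ u\,dE_S$, with $E_S$ the spectral measure of $S$ and domain $\{\psi\in\mathcal{H}:\int|f\circ u|^2\,d\langle\psi,E_S\psi\rangle<\infty\}$. *)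

theory Defs
  imports "HOL-Analysis.Analysis"
begin

section \<open>Complex Hilbert spaces\<close>

text \<open>The norm, the real scalar multiplication and completeness come from the class \<open>banach\<close>;
  the inner product is linear in its second argument.\<close>

class chilbert_space = banach +
  fixes scaleC :: "complex \<Rightarrow> 'a \<Rightarrow> 'a" (infixr "*\<^sub>C" 75)
    and cinner :: "'a \<Rightarrow> 'a \<Rightarrow> complex"
  assumes scaleC_add_right: "a *\<^sub>C (x + y) = a *\<^sub>C x + a *\<^sub>C y"
    and scaleC_add_left: "(a + b) *\<^sub>C x = a *\<^sub>C x + b *\<^sub>C x"
    and scaleC_scaleC: "a *\<^sub>C (b *\<^sub>C x) = (a * b) *\<^sub>C x"
    and scaleR_scaleC: "r *\<^sub>R x = complex_of_real r *\<^sub>C x"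
    and cinner_commute: "cinner x y = cnj (cinner y x)"
    and cinner_add_right: "cinner x (y + z) = cinner x y + cinner x z"
    and cinner_scaleC_right: "cinner x (a *\<^sub>C y) = a * cinner x y"
    and cinner_self: "cinner x x = complex_of_real ((norm x)\<^sup>2)"

section \<open>Unbounded operators\<close>

text \<open>An operator is identified with its graph, so that its domain is \<^const>\<open>Domain\<close>,
  \<open>X \<circ> Y\<close> is the relation \<open>Y O X\<close>, the inverse is \<^const>\<open>converse\<close>, the identity is
  \<^const>\<open>Id\<close>, and equality of operators includes equality of domains.\<close>

type_synonym 'h op = "('h \<times> 'h) set"

definition linear_op :: "'h::chilbert_space op \<Rightarrow> bool" where
  "linear_op X \<longleftrightarrow> single_valued X \<and> (0, 0) \<in> X
     \<and> (\<forall>(x, y) \<in> X. \<forall>(x', y') \<in> X. (x + x', y + y') \<in> X)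
     \<and> (\<forall>(x, y) \<in> X. \<forall>c. (c *\<^sub>C x, c *\<^sub>C y) \<in> X)"

definition densely_defined :: "'h::chilbert_space op \<Rightarrow> bool" where
  "densely_defined X \<longleftrightarrow> closure (Domain X) = UNIV"

definition closed_op :: "'h::chilbert_space op \<Rightarrow> bool" where
  "closed_op X \<longleftrightarrow> linear_op X \<and> closed X"

definition adjoint_op :: "'h::chilbert_space op \<Rightarrow> 'h op" where
  "adjoint_op X = {(x, y). \<forall>(v, w) \<in> X. cinner x w = cinner y v}"

definition self_adjoint_op :: "'h::chilbert_space op \<Rightarrow> bool" where
  "self_adjoint_op X \<longleftrightarrow> linear_op X \<and> densely_defined X \<and> adjoint_op X = X"

definition op_add :: "'h::chilbert_space op \<Rightarrow> 'h op \<Rightarrow> 'h op" where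
  "op_add X Y = {(x, y + z) | x y z. (x, y) \<in> X \<and> (x, z) \<in> Y}"

text \<open>The square root of a positive self-adjoint operator: its unique positive self-adjoint
  square root. For self-adjoint \<open>B\<close> the numbers \<open>\<langle>x, Bx\<rangle>\<close> are automatically real.\<close>

definition positive_op :: "'h::chilbert_space op \<Rightarrow> bool" where
  "positive_op B \<longleftrightarrow> self_adjoint_op B \<and> (\<forall>(x, y) \<in> B. Re (cinner x y) \<ge> 0)"

definition op_sqrt :: "'h::chilbert_space op \<Rightarrow> 'h op" where
  "op_sqrt A = (THE B. positive_op B \<and> B O B = A)"

section \<open>Bounded operators\<close>

text \<open>The elements of \<open>'h \<Rightarrow>\<^sub>L 'h\<close> are real linear; \<open>B(H)\<close> consists of the complex
  linear ones.\<close>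

definition BH :: "('h::chilbert_space \<Rightarrow>\<^sub>L 'h) set" where
  "BH = {R. \<forall>c x. blinfun_apply R (c *\<^sub>C x) = c *\<^sub>C blinfun_apply R x}"

definition op_of :: "('h::chilbert_space \<Rightarrow>\<^sub>L 'h) \<Rightarrow> 'h op" where
  "op_of R = {(x, blinfun_apply R x) | x. True}"

text \<open>Inverse of the injection \<open>op_of\<close>, meaningful for everywhere defined bounded operators.\<close>

definition as_bounded :: "'h::chilbert_space op \<Rightarrow> ('h \<Rightarrow>\<^sub>L 'h)" where
  "as_bounded X = (THE R. op_of R = X)"

definition scale_bop :: "complex \<Rightarrow> ('h::chilbert_space \<Rightarrow>\<^sub>L 'h) \<Rightarrow> ('h \<Rightarrow>\<^sub>L 'h)" where
  "scale_bop c R = Blinfun (\<lambda>x. c *\<^sub>C blinfun_apply R x)"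

definition adj :: "('h::chilbert_space \<Rightarrow>\<^sub>L 'h) \<Rightarrow> ('h \<Rightarrow>\<^sub>L 'h)" where
  "adj R = as_bounded (adjoint_op (op_of R))"

text \<open>For \<open>X\<close> single-valued this says: \<open>R\<psi> \<in> D(X)\<close> and \<open>RX\<psi> = XR\<psi>\<close> for all \<open>\<psi> \<in> D(X)\<close>.\<close>

definition commutes_with :: "('h::chilbert_space \<Rightarrow>\<^sub>L 'h) \<Rightarrow> 'h op \<Rightarrow> bool" where
  "commutes_with R X \<longleftrightarrow> (\<forall>(x, y) \<in> X. (blinfun_apply R x, blinfun_apply R y) \<in> X)"

definition op_commutant :: "'h::chilbert_space op \<Rightarrow> ('h \<Rightarrow>\<^sub>L 'h) set" where
  "op_commutant X = {R \<in> BH. commutes_with R X}"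

definition commutant :: "('h::chilbert_space \<Rightarrow>\<^sub>L 'h) set \<Rightarrow> ('h \<Rightarrow>\<^sub>L 'h) set" where
  "commutant A = {R \<in> BH. \<forall>X \<in> A. R o\<^sub>L X = X o\<^sub>L R}"

definition cstar_subalgebra :: "('h::chilbert_space \<Rightarrow>\<^sub>L 'h) set \<Rightarrow> bool" where
  "cstar_subalgebra A \<longleftrightarrow> A \<subseteq> BH \<and> 0 \<in> A
     \<and> (\<forall>X \<in> A. \<forall>Y \<in> A. X + Y \<in> A \<and> X o\<^sub>L Y \<in> A)
     \<and> (\<forall>X \<in> A. adj X \<in> A \<and> (\<forall>c. scale_bop c X \<in> A))
     \<and> closed A"

definition cstar_generated :: "('h::chilbert_space \<Rightarrow>\<^sub>L 'h) \<Rightarrow> ('h \<Rightarrow>\<^sub>L 'h) set" where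
  "cstar_generated S = \<Inter> {A. cstar_subalgebra A \<and> S \<in> A \<and> id_blinfun \<in> A}"

definition wstar_bounded :: "('h::chilbert_space \<Rightarrow>\<^sub>L 'h) \<Rightarrow> ('h \<Rightarrow>\<^sub>L 'h) set" where
  "wstar_bounded S = commutant (commutant (cstar_generated S))"

definition wstar :: "'h::chilbert_space op \<Rightarrow> ('h \<Rightarrow>\<^sub>L 'h) set" where
  "wstar T = commutant (op_commutant T)"

definition affiliated :: "'h::chilbert_space op \<Rightarrow> ('h \<Rightarrow>\<^sub>L 'h) set \<Rightarrow> bool" where
  "affiliated X A \<longleftrightarrow> closed_op X \<and> (\<forall>R \<in> commutant A. commutes_with R X)"

section \<open>Spectrum\<close>

definition spectrum :: "'h::chilbert_space op \<Rightarrow> complex set" where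
  "spectrum X = {z. \<not> (\<exists>R \<in> BH. op_of R = {(x, y - z *\<^sub>C x) | x y. (x, y) \<in> X}\<inverse>)}"

text \<open>Self-adjoint operators have real spectrum, which is used as a set of reals.\<close>

definition real_spectrum :: "'h::chilbert_space op \<Rightarrow> real set" where
  "real_spectrum X = {t. complex_of_real t \<in> spectrum X}"

section \<open>Spectral measures and the Borel functional calculus\<close>

definition projection_valued_measure ::
    "(real set \<Rightarrow> ('h::chilbert_space \<Rightarrow>\<^sub>L 'h)) \<Rightarrow> bool" where
  "projection_valued_measure E \<longleftrightarrow>
     (\<forall>A \<in> sets borel. E A \<in> BH \<and> E A o\<^sub>L E A = E A \<and> adj (E A) = E A)
     \<and> E UNIV = id_blinfun
     \<and> (\<forall>A :: nat \<Rightarrow> real set. range A \<subseteq> sets borel \<longrightarrow> disjoint_family A \<longrightarrow>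
          (\<forall>x. (\<lambda>n. blinfun_apply (E (A n)) x) sums blinfun_apply (E (\<Union>n. A n)) x))"

text \<open>The measure \<open>A \<mapsto> \<langle>x, E(A)x\<rangle>\<close>.\<close>

definition vector_measure ::
    "(real set \<Rightarrow> ('h::chilbert_space \<Rightarrow>\<^sub>L 'h)) \<Rightarrow> 'h \<Rightarrow> real measure" where
  "vector_measure E x =
     measure_of UNIV (sets borel) (\<lambda>A. ennreal (Re (cinner x (blinfun_apply (E A) x))))"

definition simple_spectral_integral ::
    "(real set \<Rightarrow> ('h::chilbert_space \<Rightarrow>\<^sub>L 'h)) \<Rightarrow> (real \<Rightarrow> complex) \<Rightarrow> 'h \<Rightarrow> 'h" where
  "simple_spectral_integral E s x = (\<Sum>c \<in> range s. c *\<^sub>C blinfun_apply (E (s -` {c})) x)"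

text \<open>The operator \<open>\<integral> g dE\<close> for Borel \<open>g\<close>: its domain is \<open>{x. \<integral> |g|\<^sup>2 d\<langle>x, Ex\<rangle> < \<infinity>}\<close>, and its value
  at \<open>x\<close> is the limit of \<open>\<integral> s\<^sub>n dE x\<close> for simple functions \<open>s\<^sub>n\<close> converging to \<open>g\<close> in
  \<open>L\<^sup>2(\<langle>x, Ex\<rangle>)\<close>. Because \<open>\<parallel>\<integral> s dE x\<parallel>\<^sup>2 = \<integral> |s|\<^sup>2 d\<langle>x, Ex\<rangle>\<close> for simple \<open>s\<close>, the limit
  exists and does not depend on the sequence.\<close>

definition spectral_integral ::
    "(real set \<Rightarrow> ('h::chilbert_space \<Rightarrow>\<^sub>L 'h)) \<Rightarrow> (real \<Rightarrow> complex) \<Rightarrow> 'h op" where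
  "spectral_integral E g = {(x, y).
     (\<integral>\<^sup>+ t. ennreal ((cmod (g t))\<^sup>2) \<partial>vector_measure E x) < \<infinity>
     \<and> (\<exists>s :: nat \<Rightarrow> real \<Rightarrow> complex. (\<forall>n. simple_function borel (s n))
          \<and> (\<lambda>n. \<integral>\<^sup>+ t. ennreal ((cmod (g t - s n t))\<^sup>2) \<partial>vector_measure E x) \<longlonglongrightarrow> 0
          \<and> (\<lambda>n. simple_spectral_integral E (s n) x) \<longlonglongrightarrow> y)}"

text \<open>The spectral measure of a self-adjoint \<open>S\<close> is unique on Borel sets; the choice operator
  only fixes the irrelevant values on other sets.\<close>

definition spectral_measure ::
    "('h::chilbert_space \<Rightarrow>\<^sub>L 'h) \<Rightarrow> real set \<Rightarrow> ('h \<Rightarrow>\<^sub>L 'h)" where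
  "spectral_measure S =
     (SOME E. projection_valued_measure E \<and> spectral_integral E complex_of_real = op_of S)"

text \<open>Only the values of \<open>g\<close> on \<open>\<sigma>(S)\<close> matter.\<close>

definition borel_calculus ::
    "('h::chilbert_space \<Rightarrow>\<^sub>L 'h) \<Rightarrow> (real \<Rightarrow> complex) \<Rightarrow> 'h op" where
  "borel_calculus S g = spectral_integral (spectral_measure S)
     (\<lambda>t. if t \<in> real_spectrum (op_of S) then g t else 0)"

section \<open>The bounded transform and functions of an unbounded operator\<close>

text \<open>\<open>S = T \<circ> \<surd>(I + T\<^sup>2)\<^sup>-\<^sup>1\<close>.\<close>

definition bounded_transform :: "'h::chilbert_space op \<Rightarrow> ('h \<Rightarrow>\<^sub>L 'h)" where
  "bounded_transform T = as_bounded ((op_sqrt (op_add Id (T O T)))\<inverse> O T)"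

definition fun_calculus :: "'h::chilbert_space op \<Rightarrow> (real \<Rightarrow> complex) \<Rightarrow> 'h op" where
  "fun_calculus T f = borel_calculus (bounded_transform T)
     (\<lambda>x. if x \<in> {-1<..<1} then f (x / sqrt (1 - x\<^sup>2)) else 0)"

text \<open>Functions on \<open>K\<close> are represented by functions on the reals whose values outside \<open>K\<close> are
  ignored.\<close>

definition borel_funs :: "real set \<Rightarrow> (real \<Rightarrow> complex) set" where
  "borel_funs K = borel_measurable (restrict_space borel K)"

definition bounded_borel_funs :: "real set \<Rightarrow> (real \<Rightarrow> complex) set" where
  "bounded_borel_funs K = {f \<in> borel_funs K. bounded (f ` K)}"

text \<open>Inserting \<open>0\<close> makes the norm \<open>0\<close> when \<open>K\<close> is empty (the spectrum for the zero space).\<close>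

definition sup_norm :: "real set \<Rightarrow> (real \<Rightarrow> complex) \<Rightarrow> real" where
  "sup_norm K f = Sup (insert 0 ((\<lambda>t. cmod (f t)) ` K))"

definition star_homomorphism ::
    "(real \<Rightarrow> complex) set \<Rightarrow> ('h::chilbert_space \<Rightarrow>\<^sub>L 'h) set
       \<Rightarrow> ((real \<Rightarrow> complex) \<Rightarrow> ('h \<Rightarrow>\<^sub>L 'h)) \<Rightarrow> bool" where
  "star_homomorphism F W \<Phi> \<longleftrightarrow>
     (\<forall>f \<in> F. \<Phi> f \<in> W \<and> \<Phi> (\<lambda>t. cnj (f t)) = adj (\<Phi> f)
        \<and> (\<forall>c. \<Phi> (\<lambda>t. c * f t) = scale_bop c (\<Phi> f)))
     \<and> (\<forall>f \<in> F. \<forall>g \<in> F. \<Phi> (\<lambda>t. f t + g t) = \<Phi> f + \<Phi> g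
        \<and> \<Phi> (\<lambda>t. f t * g t) = \<Phi> f o\<^sub>L \<Phi> g)"

end

theory Submission
  imports Defs
begin

text \<open>Put \<open>R = (I + T\<^sup>2)\<^sup>-\<^sup>1\<close>, a bounded positive operator obtained from the resolvents at \<open>\<plusminus>\<i>\<close>, and \<open>C = \<surd>R\<close>.
  Then \<open>\<surd>(I + T\<^sup>2) = C\<^sup>-\<^sup>1\<close>, \<open>S = T C\<close>, \<open>S\<^sup>2 + C\<^sup>2 = I\<close>, and the graph of \<open>T\<close> is
  \<open>{(Cx, Sx)}\<close>; since \<open>C\<close> is a norm limit of polynomials in \<open>R\<close>, a bounded operator commutes with \<open>T\<close>
  iff it commutes with \<open>S\<close>. Any such operator commutes with the spectral measure of \<open>S\<close>, hence with
  all integrals against it, and the bound by the supremum over \<open>\<sigma>(T)\<close> holds because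
  \<open>s \<mapsto> s / \<surd>(1 - s\<^sup>2)\<close> maps \<open>\<sigma>(S) \<inter> (-1, 1)\<close> into \<open>\<sigma>(T)\<close>. The spectral theorem for \<open>S\<close> is obtained from the
  projections onto the kernels of \<open>(S - \<lambda>)\<^sup>+\<close>, whose Stieltjes measures define the projections of
  all Borel sets.\<close>

section \<open>Complex inner products\<close>

text \<open>Three features of the setting shape the argument. The spectral measure is picked by
  \<open>SOME\<close>, so it is known only as some projection-valued measure whose integral of the
  identity function is \<open>S\<close>. Commutation of the spectral projections with the commutant
  of \<open>S\<close> must therefore follow for every such measure and cannot be read off from the
  construction of one. This is the purpose of the growth estimate that compares powers of
  \<open>S - c\<close> on near and far spectral subspaces. Next, operators are graphs, so each
  identity between unbounded operators includes equality of domains, and the square root of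
  \<open>I + T^2\<close> is a \<open>THE\<close> whose uniqueness is required among unbounded
  positive operators. Inverting such a root reduces this to uniqueness of bounded positive square
  roots. Finally, the only functions of operators formed before the spectral theorem are square
  roots, produced by an iteration that stays in every norm-closed unital algebra containing the
  operator. Taking the commutant of \<open>T\<close> as this algebra shows that \<open>C\<close>
  commutes with \<open>T\<close>.\<close>

lemma cinner_add_left: "cinner (x + y) z = cinner x z + cinner y z"
  by (metis cinner_add_right cinner_commute complex_cnj_add)

lemma cinner_scaleC_left: "cinner (a *\<^sub>C x) y = cnj a * cinner x y"
  by (metis cinner_scaleC_right cinner_commute complex_cnj_mult)

lemma cinner_scaleR_right: "cinner x (r *\<^sub>R y) = of_real r * cinner x y"
  by (simp add: scaleR_scaleC cinner_scaleC_right)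

lemma cinner_scaleR_left: "cinner (r *\<^sub>R x) y = of_real r * cinner x y"
  by (simp add: scaleR_scaleC cinner_scaleC_left)

lemma cinner_zero_right [simp]: "cinner x 0 = 0"
  using cinner_scaleR_right[of x 0 0] by simp

lemma cinner_zero_left [simp]: "cinner 0 x = 0"
  using cinner_scaleR_left[of 0 0 x] by simp

lemma cinner_minus_right [simp]: "cinner x (- y) = - cinner x y"
  using cinner_scaleR_right[of x "-1" y] by simp

lemma cinner_minus_left [simp]: "cinner (- x) y = - cinner x y"
  using cinner_scaleR_left[of "-1" x y] by simp

lemma cinner_diff_right: "cinner x (y - z) = cinner x y - cinner x z"
  using cinner_add_right[of x y "-z"] by simp

lemma cinner_diff_left: "cinner (x - y) z = cinner x z - cinner y z"
  using cinner_add_left[of x "-y" z] by simp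

lemmas cinner_simps = cinner_add_left cinner_add_right cinner_diff_left cinner_diff_right
  cinner_scaleC_left cinner_scaleC_right cinner_scaleR_left cinner_scaleR_right

lemma scaleC_zero_right [simp]: "a *\<^sub>C (0::'h::chilbert_space) = 0"
  using scaleC_add_right[of a 0 "0::'h"] by simp

lemma scaleC_zero_left [simp]: "0 *\<^sub>C (x::'h::chilbert_space) = 0"
  using scaleC_add_left[of 0 0 x] by simp

lemma scaleC_one [simp]: "1 *\<^sub>C (x::'h::chilbert_space) = x"
  using scaleR_scaleC[of 1 x] by simp

lemma scaleC_minus_right [simp]: "a *\<^sub>C (- x) = - (a *\<^sub>C (x::'h::chilbert_space))"
  using scaleC_add_right[of a x "-x"] by (simp add: eq_neg_iff_add_eq_0 add.commute)

lemma scaleC_minus_left [simp]: "(- a) *\<^sub>C x = - (a *\<^sub>C (x::'h::chilbert_space))"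
  using scaleC_add_left[of a "-a" x] by (simp add: eq_neg_iff_add_eq_0 add.commute)

lemma scaleC_diff_right: "a *\<^sub>C (x - y) = a *\<^sub>C x - a *\<^sub>C (y::'h::chilbert_space)"
  using scaleC_add_right[of a x "-y"] by simp

lemma scaleC_diff_left: "(a - b) *\<^sub>C x = a *\<^sub>C x - b *\<^sub>C (x::'h::chilbert_space)"
  using scaleC_add_left[of a "-b" x] by simp

lemma scaleR_scaleC_commute: "r *\<^sub>R (a *\<^sub>C x) = a *\<^sub>C (r *\<^sub>R (x::'h::chilbert_space))"
  by (simp add: scaleR_scaleC scaleC_scaleC mult.commute)

lemma scaleC_sum_right: "a *\<^sub>C (\<Sum>i\<in>I. f i) = (\<Sum>i\<in>I. a *\<^sub>C (f i :: 'h::chilbert_space))"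
  by (induction I rule: infinite_finite_induct) (auto simp: scaleC_add_right)

lemma cinner_sum_right: "cinner x (\<Sum>i\<in>I. f i) = (\<Sum>i\<in>I. cinner x (f i))"
  by (induction I rule: infinite_finite_induct) (auto simp: cinner_add_right)

lemma cinner_sum_left: "cinner (\<Sum>i\<in>I. f i) x = (\<Sum>i\<in>I. cinner (f i) x)"
  by (induction I rule: infinite_finite_induct) (auto simp: cinner_add_left)

lemma norm_sq_cinner: "(norm x)\<^sup>2 = Re (cinner x x)"
  by (simp add: cinner_self)

lemma Re_cinner_commute: "Re (cinner x y) = Re (cinner y x)"
  by (subst cinner_commute) simp

lemma norm_scaleC: "norm (a *\<^sub>C x) = cmod a * norm (x::'h::chilbert_space)"
proof -
  have "complex_of_real ((norm (a *\<^sub>C x))\<^sup>2) = cinner (a *\<^sub>C x) (a *\<^sub>C x)"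
    by (simp only: cinner_self)
  also have "\<dots> = a * cnj a * complex_of_real ((norm x)\<^sup>2)"
    by (simp add: cinner_scaleC_left cinner_scaleC_right cinner_self[of x] del: of_real_power)
  also have "\<dots> = complex_of_real ((cmod a * norm x)\<^sup>2)"
    using complex_norm_square[of a] by (simp add: power_mult_distrib)
  finally have "(norm (a *\<^sub>C x))\<^sup>2 = (cmod a * norm x)\<^sup>2"
    by (simp only: of_real_eq_iff)
  then show ?thesis by (simp add: power2_eq_iff_nonneg)
qed

lemma norm_sq_add: "(norm (x + y))\<^sup>2 = (norm x)\<^sup>2 + 2 * Re (cinner x y) + (norm y)\<^sup>2"
  using Re_cinner_commute[of y x] by (simp add: norm_sq_cinner cinner_simps)

lemma norm_sq_diff: "(norm (x - y))\<^sup>2 = (norm x)\<^sup>2 - 2 * Re (cinner x y) + (norm y)\<^sup>2"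
  using norm_sq_add[of x "-y"] by simp

text \<open>With a = ||x|| and b = ||y||, expanding ||b x - a y||^2 >= 0 gives 2ab (ab - Re <x, y>)
  >= 0.\<close>

lemma Re_cinner_le: "\<bar>Re (cinner x y)\<bar> \<le> norm x * norm y"
proof -
  have *: "Re (cinner x y) \<le> norm x * norm y" for x y :: 'a
  proof (cases "x = 0 \<or> y = 0")
    case False
    define a b where "a = norm x" and "b = norm y"
    have ab: "a > 0" "b > 0" using False by (auto simp: a_def b_def)
    have "0 \<le> (norm (b *\<^sub>R x - a *\<^sub>R y))\<^sup>2" by simp
    also have "\<dots> = 2 * a * b * (a * b - Re (cinner x y))"
      unfolding norm_sq_diff using ab
      by (simp add: cinner_simps a_def b_def power2_eq_square algebra_simps)
    finally have "0 \<le> 2 * a * b * (a * b - Re (cinner x y))" .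
    moreover have "0 < 2 * a * b" using ab by simp
    ultimately have "0 \<le> a * b - Re (cinner x y)" by (simp only: zero_le_mult_iff) linarith
    then show ?thesis by (simp add: a_def b_def)
  qed auto
  show ?thesis using *[of x y] *[of "-x" y] by simp
qed

text \<open>A unimodular factor on \<open>y\<close> makes the inner product real and nonnegative,
  which reduces the claim to the bound for real parts.\<close>

lemma norm_cinner_le: "cmod (cinner x y) \<le> norm x * norm y"
proof (cases "cinner x y = 0")
  case False
  define w where "w = cinner x y"
  define u where "u = cnj w / of_real (cmod w)"
  have w: "cmod w > 0" using False by (simp add: w_def)
  have u: "cmod u = 1" using w by (simp add: u_def norm_divide)
  have "u * w = of_real (cmod w)"
    using w complex_norm_square[of w] by (simp add: u_def field_simps power2_eq_square)
  then have "cmod w = Re (cinner x (u *\<^sub>C y))"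
    by (simp add: cinner_scaleC_right w_def)
  also have "\<dots> \<le> norm x * norm (u *\<^sub>C y)" using Re_cinner_le[of x "u *\<^sub>C y"] by linarith
  finally show ?thesis by (simp add: u norm_scaleC w_def)
qed auto

lemma bounded_bilinear_cinner: "bounded_bilinear cinner"
proof
  show "\<exists>K. \<forall>a b. norm (cinner a b) \<le> norm a * norm b * K"
    by (rule exI[of _ 1]) (simp add: norm_cinner_le)
qed (auto simp: cinner_simps scaleR_conv_of_real)

lemma bounded_bilinear_scaleC: "bounded_bilinear ((*\<^sub>C) :: complex \<Rightarrow> 'h \<Rightarrow> 'h::chilbert_space)"
proof
  show "\<exists>K. \<forall>a b. norm (a *\<^sub>C (b::'h)) \<le> norm a * norm b * K"
    by (rule exI[of _ 1]) (simp add: norm_scaleC)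
qed (auto simp: scaleC_add_left scaleC_add_right scaleR_scaleC scaleC_scaleC scaleR_conv_of_real mult.commute)

lemmas tendsto_cinner [tendsto_intros] = bounded_bilinear.tendsto[OF bounded_bilinear_cinner]
lemmas tendsto_scaleC [tendsto_intros] = bounded_bilinear.tendsto[OF bounded_bilinear_scaleC]
lemmas continuous_on_cinner [continuous_intros] =
  bounded_bilinear.continuous_on[OF bounded_bilinear_cinner]
lemmas continuous_on_scaleC [continuous_intros] =
  bounded_bilinear.continuous_on[OF bounded_bilinear_scaleC]

lemma cinner_ext: "(\<And>v. cinner v x = cinner v y) \<Longrightarrow> x = (y::'h::chilbert_space)"
  using cinner_self[of "x - y"] by (simp add: cinner_diff_right)

section \<open>Orthogonal projection and the adjoint\<close>

definition complex_subspace :: "'h::chilbert_space set \<Rightarrow> bool" where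
  "complex_subspace M \<longleftrightarrow> 0 \<in> M \<and> (\<forall>x\<in>M. \<forall>y\<in>M. x + y \<in> M) \<and> (\<forall>c. \<forall>x\<in>M. c *\<^sub>C x \<in> M)"

lemma complex_subspaceD:
  assumes "complex_subspace M"
  shows "0 \<in> M" "x \<in> M \<Longrightarrow> y \<in> M \<Longrightarrow> x + y \<in> M" "x \<in> M \<Longrightarrow> c *\<^sub>C x \<in> M"
    "x \<in> M \<Longrightarrow> r *\<^sub>R x \<in> M" "x \<in> M \<Longrightarrow> - x \<in> M" "x \<in> M \<Longrightarrow> y \<in> M \<Longrightarrow> x - y \<in> M"
proof -
  show 1: "0 \<in> M" "x \<in> M \<Longrightarrow> y \<in> M \<Longrightarrow> x + y \<in> M" "x \<in> M \<Longrightarrow> c *\<^sub>C x \<in> M" for x y c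
    using assms by (auto simp: complex_subspace_def)
  show "x \<in> M \<Longrightarrow> r *\<^sub>R x \<in> M" using 1(3) by (simp add: scaleR_scaleC)
  show 2: "x \<in> M \<Longrightarrow> - x \<in> M" for x using 1(3)[of x "-1"] by simp
  show "x \<in> M \<Longrightarrow> y \<in> M \<Longrightarrow> x - y \<in> M" using 1(2)[of x "-y"] 2[of y] by simp
qed

lemma Cauchy_dominated:
  fixes X :: "nat \<Rightarrow> 'a::real_normed_vector"
  assumes "Cauchy Y" "\<And>m n. norm (X m - X n) \<le> K * dist (Y m) (Y n)"
  shows "Cauchy X"
proof (rule metric_CauchyI)
  fix e :: real assume "e > 0"
  then have "0 < e / (\<bar>K\<bar> + 1)" by (simp add: add_nonneg_pos)
  then obtain N where N: "\<And>m n. m \<ge> N \<Longrightarrow> n \<ge> N \<Longrightarrow> dist (Y m) (Y n) < e / (\<bar>K\<bar> + 1)"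
    using assms(1) unfolding Cauchy_def by metis
  have "dist (X m) (X n) < e" if "m \<ge> N" "n \<ge> N" for m n
  proof -
    have "dist (X m) (X n) \<le> (\<bar>K\<bar> + 1) * dist (Y m) (Y n)"
      unfolding dist_norm[of "X m"] by (rule order_trans[OF assms(2)]) (simp add: mult_right_mono)
    also have "\<dots> < e" using N[OF that] by (simp add: less_divide_eq mult.commute add_nonneg_pos)
    finally show ?thesis .
  qed
  then show "\<exists>N. \<forall>m\<ge>N. \<forall>n\<ge>N. dist (X m) (X n) < e" by blast
qed

text \<open>A minimising sequence for the distance is Cauchy by the parallelogram law, and
  completeness supplies its limit.\<close>

lemma nearest_point_exists:
  fixes M :: "'h::chilbert_space set"
  assumes M: "complex_subspace M" and cl: "closed M"
  obtains p where "p \<in> M" "\<And>q. q \<in> M \<Longrightarrow> norm (x - p) \<le> norm (x - q)"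
proof -
  define d where "d = Inf ((\<lambda>q. norm (x - q)) ` M)"
  have bdd: "bdd_below ((\<lambda>q. norm (x - q)) ` M)" by (rule bdd_belowI2[of _ 0]) simp
  have ne: "M \<noteq> {}" using complex_subspaceD(1)[OF M] by auto
  have d_le: "d \<le> norm (x - q)" if "q \<in> M" for q
    unfolding d_def using that bdd by (rule cINF_lower2[OF _ _ order_refl, rotated])
  have d0: "0 \<le> d" unfolding d_def using ne by (intro cINF_greatest) auto
  have "\<exists>q\<in>M. norm (x - q) < d + 1 / Suc n" for n :: nat
    using cINF_less_iff[OF ne bdd, of "d + 1 / Suc n"] by (simp flip: d_def)
  then obtain q where q: "\<And>n. q n \<in> M" "\<And>n. norm (x - q n) < d + 1 / Suc n"
    by metis
  have lim: "(\<lambda>n. norm (x - q n)) \<longlonglongrightarrow> d"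
  proof (rule tendsto_sandwich[of "\<lambda>_. d" _ _ "\<lambda>n. d + 1 / Suc n"])
    show "(\<lambda>n. d + 1 / Suc n) \<longlonglongrightarrow> d"
      using tendsto_add[OF tendsto_const LIMSEQ_inverse_real_of_nat, of d]
      by (simp add: inverse_eq_divide)
  qed (use d_le q in \<open>auto intro!: always_eventually less_imp_le\<close>)
  \<comment> \<open>Parallelogram law for \<open>x - q m\<close> and \<open>x - q n\<close>: the
    midpoint of \<open>q m\<close> and \<open>q n\<close> is again in \<open>M\<close>, so its
    distance to \<open>x\<close> is at least \<open>d\<close>.\<close>
  have par: "(norm (q m - q n))\<^sup>2 \<le> 2 * ((norm (x - q m))\<^sup>2 - d\<^sup>2) + 2 * ((norm (x - q n))\<^sup>2 - d\<^sup>2)" for m n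
  proof -
    have "(1/2) *\<^sub>R (q m + q n) \<in> M"
      using M q by (intro complex_subspaceD)
    then have "d \<le> norm (x - (1/2) *\<^sub>R (q m + q n))" by (rule d_le)
    then have "d\<^sup>2 \<le> (norm (x - (1/2) *\<^sub>R (q m + q n)))\<^sup>2" using d0 by (simp add: power_mono)
    also have "x - (1/2) *\<^sub>R (q m + q n) = (1/2) *\<^sub>R ((x - q m) + (x - q n))"
      by (simp add: algebra_simps flip: scaleR_add_left)
    also have "(norm ((1/2) *\<^sub>R ((x - q m) + (x - q n))))\<^sup>2 = (norm ((x - q m) + (x - q n)))\<^sup>2 / 4"
      by (simp add: power_divide)
    finally have 1: "4 * d\<^sup>2 \<le> (norm ((x - q m) + (x - q n)))\<^sup>2" by simp
    have "(norm (q m - q n))\<^sup>2 = (norm ((x - q n) - (x - q m)))\<^sup>2" by simp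
    also have "\<dots> = 2 * (norm (x - q m))\<^sup>2 + 2 * (norm (x - q n))\<^sup>2 - (norm ((x - q m) + (x - q n)))\<^sup>2"
      using Re_cinner_commute[of "x - q m" "x - q n"]
      unfolding norm_sq_diff[of "x - q n" "x - q m"] norm_sq_add[of "x - q m" "x - q n"] by simp
    finally show ?thesis using 1 by simp
  qed
  have "Cauchy q"
  proof (rule metric_CauchyI)
    fix e :: real assume "e > 0"
    have "(\<lambda>n. (norm (x - q n))\<^sup>2 - d\<^sup>2) \<longlonglongrightarrow> 0"
      using tendsto_diff[OF tendsto_power[OF lim, of 2] tendsto_const, of "d\<^sup>2"] by simp
    then have "\<forall>\<^sub>F n in sequentially. (norm (x - q n))\<^sup>2 - d\<^sup>2 < e\<^sup>2 / 4"
      using \<open>e > 0\<close> by (intro order_tendstoD) auto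
    then obtain N where N: "\<And>n. n \<ge> N \<Longrightarrow> (norm (x - q n))\<^sup>2 - d\<^sup>2 < e\<^sup>2 / 4"
      by (auto simp: eventually_sequentially)
    have "dist (q m) (q n) < e" if "m \<ge> N" "n \<ge> N" for m n
    proof -
      have "(norm (q m - q n))\<^sup>2 < e\<^sup>2"
        using par[of m n] N[OF that(1)] N[OF that(2)] by simp
      then show ?thesis using \<open>e > 0\<close> by (simp add: dist_norm power_less_imp_less_base)
    qed
    then show "\<exists>N. \<forall>m\<ge>N. \<forall>n\<ge>N. dist (q m) (q n) < e" by auto
  qed
  then obtain p where p: "q \<longlonglongrightarrow> p" by (auto simp: Cauchy_convergent_iff convergent_def)
  have "p \<in> M" using closed_sequentially[OF cl] q p by blast
  moreover have "norm (x - p) = d"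
    by (rule LIMSEQ_unique[OF _ lim]) (intro tendsto_intros p)
  ultimately show ?thesis using d_le that by simp
qed

lemma projection_theorem:
  fixes M :: "'h::chilbert_space set"
  assumes M: "complex_subspace M" and cl: "closed M"
  obtains p where "p \<in> M" "\<And>q. q \<in> M \<Longrightarrow> cinner q (x - p) = 0"
proof -
  obtain p where p: "p \<in> M" and min: "\<And>q. q \<in> M \<Longrightarrow> norm (x - p) \<le> norm (x - q)"
    using nearest_point_exists[OF assms, of x] by blast
  have "cinner q (x - p) = 0" if q: "q \<in> M" for q
  proof (cases "q = 0")
    case False
    define c where "c = cinner q (x - p)"
    \<comment> \<open>The coefficient for which \<open>t *\<^sub>C q\<close> is closest to
      \<open>x - p\<close>; minimality of \<open>p\<close> leaves no gain, and the gain is |c|^2 /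
      ||q||^2.\<close>
    define t where "t = c / of_real ((norm q)\<^sup>2)"
    have "norm (x - p) \<le> norm (x - (p + t *\<^sub>C q))"
      by (intro min complex_subspaceD[OF M] p q)
    then have "(norm (x - p))\<^sup>2 \<le> (norm ((x - p) - t *\<^sub>C q))\<^sup>2"
      by (simp add: power_mono diff_diff_eq)
    also have "\<dots> = (norm (x - p))\<^sup>2 - 2 * Re (t * cnj c) + (cmod t)\<^sup>2 * (norm q)\<^sup>2"
      by (subst norm_sq_diff) (simp add: cinner_scaleC_right norm_scaleC c_def power_mult_distrib
        flip: cinner_commute[of "x - p" q])
    finally have "2 * Re (t * cnj c) \<le> (cmod t)\<^sup>2 * (norm q)\<^sup>2" by simp
    moreover have "t * cnj c = of_real ((cmod c)\<^sup>2 / (norm q)\<^sup>2)"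
      using complex_norm_square[of c] by (simp add: t_def)
    moreover have "(cmod t)\<^sup>2 * (norm q)\<^sup>2 = (cmod c)\<^sup>2 / (norm q)\<^sup>2"
      using False by (simp add: t_def norm_divide norm_mult power2_eq_square)
    ultimately have "(cmod c)\<^sup>2 / (norm q)\<^sup>2 \<le> 0" by simp
    then show ?thesis using False
      by (simp add: divide_le_0_iff c_def)
  qed simp
  then show ?thesis using p that by blast
qed

text \<open>For any \<open>x\<close> the residual \<open>x - p\<close> of the projection is
  orthogonal to \<open>M\<close>, hence zero. This is how surjectivity of \<open>T - z\<close> and
  density of ranges are obtained.\<close>

lemma closed_subspace_eq_UNIV:
  fixes M :: "'h::chilbert_space set"
  assumes "complex_subspace M" "closed M" "\<And>x. (\<And>q. q \<in> M \<Longrightarrow> cinner q x = 0) \<Longrightarrow> x = 0"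
  shows "M = UNIV"
proof -
  have "x \<in> M" for x
  proof -
    obtain p where "p \<in> M" "\<And>q. q \<in> M \<Longrightarrow> cinner q (x - p) = 0"
      using projection_theorem[OF assms(1,2), of x] by blast
    then show ?thesis using assms(3)[of "x - p"] by simp
  qed
  then show ?thesis by auto
qed

lemma complex_subspace_closure:
  assumes "complex_subspace M"
  shows "complex_subspace (closure M)"
  unfolding complex_subspace_def
proof (intro conjI ballI allI)
  note M = complex_subspaceD[OF assms]
  show "0 \<in> closure M" using M(1) closure_subset by blast
  fix x assume "x \<in> closure M"
  then obtain a where a: "\<And>n. a n \<in> M" "a \<longlonglongrightarrow> x" by (auto simp: closure_sequential)
  show "c *\<^sub>C x \<in> closure M" for c
    unfolding closure_sequential
    by (rule exI[of _ "\<lambda>n. c *\<^sub>C a n"]) (auto intro!: M a tendsto_intros)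
  fix y assume "y \<in> closure M"
  then obtain b where b: "\<And>n. b n \<in> M" "b \<longlonglongrightarrow> y" by (auto simp: closure_sequential)
  show "x + y \<in> closure M"
    unfolding closure_sequential
    by (rule exI[of _ "\<lambda>n. a n + b n"]) (auto intro!: M a b tendsto_intros)
qed

lemma dense_subspaceI:
  fixes M :: "'h::chilbert_space set"
  assumes "complex_subspace M" "\<And>x. (\<And>q. q \<in> M \<Longrightarrow> cinner q x = 0) \<Longrightarrow> x = 0"
  shows "closure M = UNIV"
  using assms closure_subset[of M]
  by (intro closed_subspace_eq_UNIV complex_subspace_closure) auto

text \<open>Pick \<open>w\<close> orthogonal to the kernel with nonzero value. Since \<phi>(w) x -
  \<phi>(x) w lies in the kernel, pairing it with \<open>w\<close> shows that the functional is a
  multiple of the pairing with \<open>w\<close>.\<close>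

lemma riesz_representation:
  fixes \<phi> :: "'h::chilbert_space \<Rightarrow> complex"
  assumes lin: "bounded_linear \<phi>" and hom: "\<And>c x. \<phi> (c *\<^sub>C x) = c * \<phi> x"
  obtains z where "\<And>x. \<phi> x = cinner z x"
proof (cases "\<forall>x. \<phi> x = 0")
  case True
  then show ?thesis using that[of 0] by simp
next
  case False
  interpret bounded_linear \<phi> by fact
  define M where "M = {x. \<phi> x = 0}"
  have "complex_subspace M" by (auto simp: complex_subspace_def M_def zero add hom)
  moreover have "closed M"
    unfolding M_def by (intro closed_Collect_eq continuous_intros linear_continuous_on lin)
  ultimately obtain M: "complex_subspace M" "closed M" by blast
  obtain x0 where x0: "\<phi> x0 \<noteq> 0" using False by blast
  obtain p where p: "p \<in> M" "\<And>q. q \<in> M \<Longrightarrow> cinner q (x0 - p) = 0"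
    using projection_theorem[OF M, of x0] by blast
  define w where "w = x0 - p"
  have w: "\<phi> w = \<phi> x0" using p(1) by (simp add: w_def diff M_def)
  then have "w \<noteq> 0" using x0 zero by auto
  have key: "\<phi> x * cinner w w = \<phi> w * cinner w x" for x
  proof -
    have "\<phi> w *\<^sub>C x - \<phi> x *\<^sub>C w \<in> M" by (simp add: M_def diff hom)
    from p(2)[OF this] have "cinner w (\<phi> w *\<^sub>C x - \<phi> x *\<^sub>C w) = 0"
      by (metis cinner_commute complex_cnj_zero w_def)
    then show ?thesis by (simp add: cinner_simps)
  qed
  show ?thesis
  proof (rule that[of "cnj (\<phi> w / cinner w w) *\<^sub>C w"])
    fix x
    show "\<phi> x = cinner (cnj (\<phi> w / cinner w w) *\<^sub>C w) x"
      using key[of x] \<open>w \<noteq> 0\<close> cinner_self[of w] by (simp add: cinner_scaleC_left field_simps)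
  qed
qed

section \<open>Everywhere defined bounded operators and their adjoints\<close>

lemma op_of_inj: "op_of R = op_of R' \<longleftrightarrow> R = R'"
proof
  assume *: "op_of R = op_of R'"
  have "R x = R' x" for x
  proof -
    have "(x, R x) \<in> op_of R'" using * by (auto simp: op_of_def)
    then show ?thesis by (auto simp: op_of_def)
  qed
  then show "R = R'" by (rule blinfun_eqI)
qed simp

lemma as_bounded_op_of [simp]: "as_bounded (op_of R) = R"
  unfolding as_bounded_def by (rule the_equality) (auto simp: op_of_inj)

lemma mem_op_of [simp]: "(x, y) \<in> op_of R \<longleftrightarrow> y = R x"
  by (auto simp: op_of_def)

lemma BH_scaleC: "R \<in> BH \<Longrightarrow> R (c *\<^sub>C x) = c *\<^sub>C R x"
  by (simp add: BH_def)

lemma BH_zero [simp]: "0 \<in> BH" and BH_id [simp]: "id_blinfun \<in> BH"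
  by (auto simp: BH_def)

lemma BH_add: "R \<in> BH \<Longrightarrow> R' \<in> BH \<Longrightarrow> R + R' \<in> BH"
  and BH_diff: "R \<in> BH \<Longrightarrow> R' \<in> BH \<Longrightarrow> R - R' \<in> BH"
  and BH_compose: "R \<in> BH \<Longrightarrow> R' \<in> BH \<Longrightarrow> R o\<^sub>L R' \<in> BH"
  and BH_scaleR: "R \<in> BH \<Longrightarrow> r *\<^sub>R R \<in> BH"
  by (auto simp: BH_def blinfun.bilinear_simps scaleC_add_right scaleC_diff_right scaleR_scaleC_commute)

lemma blinfun_scale_bop: "blinfun_apply (scale_bop c R) x = c *\<^sub>C R x"
proof -
  have "bounded_linear (\<lambda>x. c *\<^sub>C R x)"
    by (intro bounded_linear_compose[OF bounded_bilinear.bounded_linear_right[OF bounded_bilinear_scaleC]]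
      bounded_linear_blinfun_apply bounded_linear_ident)
  then show ?thesis by (simp add: scale_bop_def bounded_linear_Blinfun_apply)
qed

lemma BH_scale_bop: "R \<in> BH \<Longrightarrow> scale_bop c R \<in> BH"
  by (auto simp: BH_def blinfun_scale_bop scaleC_scaleC mult.commute)

lemma tendsto_blinfun_apply: "F \<longlonglongrightarrow> R \<Longrightarrow> (\<lambda>n. blinfun_apply (F n) x) \<longlonglongrightarrow> R x"
  by (intro blinfun.tendsto tendsto_const)

lemma closed_BH: "closed (BH :: ('h::chilbert_space \<Rightarrow>\<^sub>L 'h) set)"
  unfolding closed_sequential_limits
proof (intro allI impI; elim conjE)
  fix F and R :: "'h \<Rightarrow>\<^sub>L 'h" assume F: "\<forall>n. F n \<in> BH" "F \<longlonglongrightarrow> R"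
  have "R (c *\<^sub>C x) = c *\<^sub>C R x" for c x
  proof (rule LIMSEQ_unique)
    show "(\<lambda>n. F n (c *\<^sub>C x)) \<longlonglongrightarrow> R (c *\<^sub>C x)" by (rule tendsto_blinfun_apply[OF F(2)])
    show "(\<lambda>n. F n (c *\<^sub>C x)) \<longlonglongrightarrow> c *\<^sub>C R x"
      using F(1) by (simp add: BH_scaleC) (intro tendsto_intros tendsto_blinfun_apply F(2))
  qed
  then show "R \<in> BH" by (simp add: BH_def)
qed

lemma BH_of_linear:
  fixes f :: "'h::chilbert_space \<Rightarrow> 'h"
  assumes add: "\<And>x y. f (x + y) = f x + f y" and hom: "\<And>c x. f (c *\<^sub>C x) = c *\<^sub>C f x"
    and le: "\<And>x. norm (f x) \<le> K * norm x"
  obtains G where "G \<in> BH" "blinfun_apply G = f"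
proof -
  have "bounded_linear f"
    by (rule bounded_linear_intro[where K=K]) (simp_all add: add hom scaleR_scaleC le mult.commute[of _ K])
  then have ap: "blinfun_apply (Blinfun f) = f" by (rule bounded_linear_Blinfun_apply)
  then have "Blinfun f \<in> BH" by (simp add: BH_def hom)
  then show ?thesis using ap that by blast
qed

text \<open>The Riesz vector of y |-> <x, R y> is taken for each \<open>x\<close>. Uniqueness of
  representing vectors makes it linear in \<open>x\<close>, and ||f x||^2 = <x, R (f x)> bounds its
  norm.\<close>

lemma adjoint_exists:
  fixes R :: "'h::chilbert_space \<Rightarrow>\<^sub>L 'h"
  assumes "R \<in> BH"
  obtains R' where "R' \<in> BH" "\<And>x y. cinner (R' x) y = cinner x (R y)"
proof -
  have "\<exists>z. \<forall>y. cinner x (R y) = cinner z y" for x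
  proof -
    have "bounded_linear (\<lambda>y. cinner x (R y))"
      by (intro bounded_linear_compose[OF bounded_bilinear.bounded_linear_right[OF bounded_bilinear_cinner]]
        bounded_linear_blinfun_apply bounded_linear_ident)
    moreover have "cinner x (R (c *\<^sub>C y)) = c * cinner x (R y)" for c y
      using assms by (simp add: BH_scaleC cinner_scaleC_right)
    ultimately show ?thesis using riesz_representation[of "\<lambda>y. cinner x (R y)"] by metis
  qed
  then obtain f where f: "\<And>x y. cinner x (R y) = cinner (f x) y" by metis
  have f': "cinner y (f x) = cinner (R y) x" for x y
    by (metis f cinner_commute)
  show ?thesis
  proof (rule BH_of_linear)
    show "f (x + y) = f x + f y" for x y
      by (rule cinner_ext) (simp add: f' cinner_add_right)
    show "f (c *\<^sub>C x) = c *\<^sub>C f x" for c x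
      by (rule cinner_ext) (simp add: f' cinner_scaleC_right)
    show "norm (f x) \<le> norm R * norm x" for x
    proof (cases "f x = 0")
      case False
      have "(norm (f x))\<^sup>2 = Re (cinner x (R (f x)))" by (simp add: norm_sq_cinner f)
      also have "\<dots> \<le> norm x * norm (R (f x))" using Re_cinner_le[of x "R (f x)"] by linarith
      also have "\<dots> \<le> norm x * (norm R * norm (f x))" by (intro mult_left_mono norm_blinfun) auto
      finally show ?thesis using False by (simp add: power2_eq_square mult.commute)
    qed simp
  qed (use f in \<open>auto intro: that\<close>)
qed

text \<open>\<open>adj\<close> is defined through graphs and a \<open>THE\<close>; this is the
  bridge by which bounded adjoints are computed from a pairing identity.\<close>

lemma adj_eqI:
  fixes R R' :: "'h::chilbert_space \<Rightarrow>\<^sub>L 'h"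
  assumes "\<And>x y. cinner (R' x) y = cinner x (R y)"
  shows "adj R = R'"
proof -
  have "adjoint_op (op_of R) = op_of R'"
  proof (intro set_eqI iffI; clarify)
    fix x y assume "(x, y) \<in> adjoint_op (op_of R)"
    then have "cinner x (R v) = cinner y v" for v by (auto simp: adjoint_op_def)
    then have "y = R' x" using assms by (intro cinner_ext) (metis cinner_commute)
    then show "(x, y) \<in> op_of R'" by simp
  qed (auto simp: adjoint_op_def assms)
  then show ?thesis by (simp add: adj_def)
qed

lemma
  fixes R :: "'h::chilbert_space \<Rightarrow>\<^sub>L 'h"
  assumes "R \<in> BH"
  shows BH_adj: "adj R \<in> BH" and cinner_adj_left: "cinner (adj R x) y = cinner x (R y)"
    and cinner_adj_right: "cinner x (adj R y) = cinner (R x) y"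
proof -
  obtain R' where R': "R' \<in> BH" "\<And>x y. cinner (R' x) y = cinner x (R y)"
    using adjoint_exists[OF assms] by metis
  have "adj R = R'" by (rule adj_eqI) (rule R')
  then show "adj R \<in> BH" "cinner (adj R x) y = cinner x (R y)" for x y using R' by auto
  from this(2)[of y x] show "cinner x (adj R y) = cinner (R x) y" by (metis cinner_commute)
qed

lemma adj_adj: "R \<in> BH \<Longrightarrow> adj (adj R) = R"
  by (rule adj_eqI) (simp add: cinner_adj_right)

lemma norm_adj_le: "R \<in> BH \<Longrightarrow> norm (adj R) \<le> norm R"
proof (rule norm_blinfun_bound)
  fix x assume R: "R \<in> BH"
  show "norm (adj R x) \<le> norm R * norm x"
  proof (cases "adj R x = 0")
    case False
    have "(norm (adj R x))\<^sup>2 = Re (cinner x (R (adj R x)))"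
      by (simp add: norm_sq_cinner cinner_adj_left R)
    also have "\<dots> \<le> norm x * norm (R (adj R x))"
      using Re_cinner_le[of x "R (adj R x)"] by linarith
    also have "\<dots> \<le> norm x * (norm R * norm (adj R x))"
      by (intro mult_left_mono norm_blinfun) auto
    finally show ?thesis using False by (simp add: power2_eq_square mult.commute)
  qed simp
qed simp

lemma adj_diff: "R \<in> BH \<Longrightarrow> R' \<in> BH \<Longrightarrow> adj (R - R') = adj R - adj R'"
  by (rule adj_eqI) (simp add: blinfun.bilinear_simps cinner_simps cinner_adj_left)

lemma adj_add: "R \<in> BH \<Longrightarrow> R' \<in> BH \<Longrightarrow> adj (R + R') = adj R + adj R'"
  by (rule adj_eqI) (simp add: blinfun.bilinear_simps cinner_simps cinner_adj_left)

lemma adj_compose: "R \<in> BH \<Longrightarrow> R' \<in> BH \<Longrightarrow> adj (R o\<^sub>L R') = adj R' o\<^sub>L adj R"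
  by (rule adj_eqI) (simp add: cinner_adj_left)

lemma adj_scale_bop: "R \<in> BH \<Longrightarrow> adj (scale_bop c R) = scale_bop (cnj c) (adj R)"
  by (rule adj_eqI) (simp add: blinfun_scale_bop cinner_simps cinner_adj_left)

lemma adj_tendsto:
  assumes "F \<longlonglongrightarrow> R" "\<And>n. F n \<in> BH" "R \<in> BH"
  shows "(\<lambda>n. adj (F n)) \<longlonglongrightarrow> adj R"
proof (rule Lim_transform_bound[of "\<lambda>n. adj (F n) - adj R" "\<lambda>n. F n - R" sequentially, THEN LIM_zero_cancel])
  show "\<forall>\<^sub>F n in sequentially. norm (adj (F n) - adj R) \<le> norm (F n - R)"
    using assms norm_adj_le[OF BH_diff] by (intro always_eventually) (auto simp flip: adj_diff)
  show "(\<lambda>n. F n - R) \<longlonglongrightarrow> 0" using assms(1) by (rule LIM_zero)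
qed

section \<open>Bounded self-adjoint and positive operators\<close>

text \<open>Phrased by the pairing instead of \<open>adj\<close>, so that limits and algebra act
  directly on inner products; \<open>selfadjoint_iff_adj\<close> gives the link.\<close>

definition selfadjoint :: "('h::chilbert_space \<Rightarrow>\<^sub>L 'h) \<Rightarrow> bool" where
  "selfadjoint A \<longleftrightarrow> A \<in> BH \<and> (\<forall>x y. cinner (A x) y = cinner x (A y))"

definition positive_bounded :: "('h::chilbert_space \<Rightarrow>\<^sub>L 'h) \<Rightarrow> bool" where
  "positive_bounded A \<longleftrightarrow> selfadjoint A \<and> (\<forall>x. 0 \<le> Re (cinner x (A x)))"

definition projection :: "('h::chilbert_space \<Rightarrow>\<^sub>L 'h) \<Rightarrow> bool" where
  "projection P \<longleftrightarrow> selfadjoint P \<and> P o\<^sub>L P = P"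

lemma selfadjointD:
  assumes "selfadjoint A"
  shows "A \<in> BH" "cinner (A x) y = cinner x (A y)" "adj A = A"
  using assms by (auto simp: selfadjoint_def intro!: adj_eqI)

lemma selfadjoint_iff_adj: "selfadjoint A \<longleftrightarrow> A \<in> BH \<and> adj A = A"
  by (metis selfadjoint_def selfadjointD(3) cinner_adj_left)

lemma selfadjoint_diff: "selfadjoint A \<Longrightarrow> selfadjoint B \<Longrightarrow> selfadjoint (A - B)"
  and selfadjoint_add: "selfadjoint A \<Longrightarrow> selfadjoint B \<Longrightarrow> selfadjoint (A + B)"
  and selfadjoint_scaleR: "selfadjoint A \<Longrightarrow> selfadjoint (r *\<^sub>R A)"
  and selfadjoint_id [simp]: "selfadjoint id_blinfun"
  and selfadjoint_zero [simp]: "selfadjoint 0"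
  by (auto simp: selfadjoint_def BH_add BH_diff BH_scaleR blinfun.bilinear_simps cinner_simps)

lemma selfadjoint_compose:
  "selfadjoint A \<Longrightarrow> selfadjoint B \<Longrightarrow> A o\<^sub>L B = B o\<^sub>L A \<Longrightarrow> selfadjoint (A o\<^sub>L B)"
  unfolding selfadjoint_def by (metis BH_compose blinfun_apply_blinfun_compose)

lemma closed_selfadjoint: "closed {A :: 'h::chilbert_space \<Rightarrow>\<^sub>L 'h. selfadjoint A}"
  unfolding closed_sequential_limits
proof (intro allI impI; elim conjE)
  fix F and R :: "'h \<Rightarrow>\<^sub>L 'h" assume F: "\<forall>n. F n \<in> {A. selfadjoint A}" "F \<longlonglongrightarrow> R"
  have BH: "R \<in> BH" using closed_sequentially[OF closed_BH _ F(2)] F(1) by (auto simp: selfadjointD)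
  have "cinner (R x) y = cinner x (R y)" for x y
  proof (rule LIMSEQ_unique)
    show "(\<lambda>n. cinner (F n x) y) \<longlonglongrightarrow> cinner (R x) y"
      by (intro tendsto_intros tendsto_blinfun_apply F(2))
    show "(\<lambda>n. cinner (F n x) y) \<longlonglongrightarrow> cinner x (R y)"
      using F(1) by (simp add: selfadjointD) (intro tendsto_intros tendsto_blinfun_apply F(2))
  qed
  then show "R \<in> {A. selfadjoint A}" using BH by (simp add: selfadjoint_def)
qed

text \<open>Evaluate the form at \<open>x - Ax / r\<close>.\<close>

lemma positive_norm_bound:
  assumes A: "positive_bounded A" and r: "r > 0" and le: "\<And>x. Re (cinner x (A x)) \<le> r * (norm x)\<^sup>2"
  shows "(norm (A x))\<^sup>2 \<le> r * Re (cinner x (A x))"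
proof -
  have sa: "selfadjoint A" using A by (simp add: positive_bounded_def)
  define y where "y = A x"
  have "0 \<le> Re (cinner (x - (1/r) *\<^sub>R y) (A (x - (1/r) *\<^sub>R y)))"
    using A by (simp add: positive_bounded_def)
  also have "\<dots> = Re (cinner x (A x)) - 2 / r * (norm y)\<^sup>2 + 1 / r\<^sup>2 * Re (cinner y (A y))"
    using selfadjointD(2)[OF sa, of x y] norm_sq_cinner[of y]
    by (simp add: blinfun.bilinear_simps cinner_simps y_def power2_eq_square)
       (use r in \<open>simp add: field_simps\<close>)
  also have "\<dots> \<le> Re (cinner x (A x)) - 2 / r * (norm y)\<^sup>2 + 1 / r\<^sup>2 * (r * (norm y)\<^sup>2)"
    using le[of y] r by (intro add_left_mono mult_left_mono) auto
  finally show ?thesis using r by (simp add: y_def field_simps power2_eq_square)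
qed

lemma Re_cinner_apply_le:
  fixes A :: "'h::chilbert_space \<Rightarrow>\<^sub>L 'h"
  shows "\<bar>Re (cinner x (A x))\<bar> \<le> norm A * (norm x)\<^sup>2"
proof -
  have "\<bar>Re (cinner x (A x))\<bar> \<le> norm x * norm (A x)" by (rule Re_cinner_le)
  also have "\<dots> \<le> norm x * (norm A * norm x)" by (intro mult_left_mono norm_blinfun) auto
  finally show ?thesis by (simp add: power2_eq_square mult_ac)
qed

lemma positive_form_zero:
  assumes A: "positive_bounded A" and "Re (cinner x (A x)) = 0"
  shows "A x = 0"
proof -
  \<comment> \<open>The summand 1 keeps the constant strictly positive when \<open>A\<close> is
    zero.\<close>
  have "(norm (A x))\<^sup>2 \<le> (norm A + 1) * Re (cinner x (A x))"
  proof (rule positive_norm_bound[OF A])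
    show "Re (cinner x (A x)) \<le> (norm A + 1) * (norm x)\<^sup>2" for x
      using Re_cinner_apply_le[of x A] by (simp add: algebra_simps add_increasing)
  qed (use norm_ge_zero[of A] in linarith)
  then show ?thesis using assms(2) by simp
qed

lemma selfadjoint_form_zero:
  assumes "selfadjoint A" "\<And>x. Re (cinner x (A x)) = 0"
  shows "A = 0"
  by (rule blinfun_eqI) (use assms positive_form_zero[of A] in \<open>simp add: positive_bounded_def\<close>)

text \<open>\<open>positive_norm_bound\<close> gives ||A x||^2 <= r <x, A x>, and the assumed form
  bound turns the right side into (r ||x||)^2. The case \<open>r = 0\<close> is separate because the
  first bound is for positive \<open>r\<close>.\<close>

lemma positive_norm_le:
  assumes A: "positive_bounded A" and r: "r \<ge> 0" and le: "\<And>x. Re (cinner x (A x)) \<le> r * (norm x)\<^sup>2"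
  shows "norm (A x) \<le> r * norm x"
proof (cases "r = 0")
  case True
  then show ?thesis using positive_form_zero[OF A, of x] le[of x] A by (simp add: positive_bounded_def order_antisym)
next
  case False
  then have "(norm (A x))\<^sup>2 \<le> r * Re (cinner x (A x))"
    using A r le by (intro positive_norm_bound) auto
  also have "\<dots> \<le> r * (r * (norm x)\<^sup>2)" using r le by (intro mult_left_mono) auto
  also have "\<dots> = (r * norm x)\<^sup>2" by (simp add: power2_eq_square)
  finally show ?thesis by (rule power2_le_imp_le) (use r in simp)
qed

lemma cinner_selfadjoint_square:
  "selfadjoint A \<Longrightarrow> Re (cinner x (A (A x))) = (norm (A x))\<^sup>2"
  using selfadjointD(2)[of A x "A x"] by (simp add: norm_sq_cinner)

lemma projectionD:
  assumes "projection P"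
  shows "selfadjoint P" "P \<in> BH" "P (P x) = P x" "cinner (P x) y = cinner x (P y)" "P o\<^sub>L P = P"
proof -
  show "selfadjoint P" "P o\<^sub>L P = P" using assms by (auto simp: projection_def)
  then show "P \<in> BH" "cinner (P x) y = cinner x (P y)" by (auto simp: selfadjointD)
  show "P (P x) = P x" by (metis \<open>P o\<^sub>L P = P\<close> blinfun_apply_blinfun_compose)
qed

lemma projectionI: "selfadjoint P \<Longrightarrow> (\<And>x. P (P x) = P x) \<Longrightarrow> projection P"
  by (auto simp: projection_def intro!: blinfun_eqI)

lemma cinner_projection: "projection P \<Longrightarrow> Re (cinner x (P x)) = (norm (P x))\<^sup>2"
  using cinner_selfadjoint_square[of P x] by (simp add: projectionD)

lemma norm_projection_pythagoras:
  assumes "projection P"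
  shows "(norm (P x))\<^sup>2 + (norm (x - P x))\<^sup>2 = (norm x)\<^sup>2"
  unfolding norm_sq_diff using cinner_projection[OF assms, of x] by simp

lemma norm_projection_le: "projection P \<Longrightarrow> norm (P x) \<le> norm x"
  by (rule power2_le_imp_le)
    (use norm_projection_pythagoras[of P x] zero_le_power2[of "norm (x - P x)"] in linarith, simp)

text \<open>The quadratic form of a projection is its squared norm, so equal norms give
  \<open>P - Q\<close> the zero form.\<close>

lemma projection_eqI:
  assumes "projection P" "projection Q" "\<And>x. norm (P x) = norm (Q x)"
  shows "P = Q"
proof -
  have "P - Q = 0"
    using assms by (intro selfadjoint_form_zero selfadjoint_diff projectionD)
      (simp_all add: blinfun.bilinear_simps cinner_diff_right cinner_projection)
  then show ?thesis by simp
qed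

lemma projection_compl: "projection P \<Longrightarrow> projection (id_blinfun - P)"
  by (rule projectionI) (auto intro!: selfadjoint_diff simp: projectionD blinfun.bilinear_simps)

lemma projection_id [simp]: "projection id_blinfun" and projection_zero [simp]: "projection 0"
  by (auto intro!: projectionI)

text \<open>At the vector \<open>Q x\<close> the hypothesis reads ||P Q x||^2 + ||Q x||^2 <= ||Q
  x||^2.\<close>

lemma projections_orthogonal:
  assumes "projection P" "projection Q" "\<And>x. (norm (P x))\<^sup>2 + (norm (Q x))\<^sup>2 \<le> (norm x)\<^sup>2"
  shows "P (Q x) = 0"
  using assms(3)[of "Q x"] assms(1,2) by (simp add: projectionD)

text \<open>The foot of the perpendicular is unique; linearity and the description of the fixed
  points come from this uniqueness, and symmetry from orthogonality of the residual.\<close>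

lemma projection_onto:
  fixes M :: "'h::chilbert_space set"
  assumes M: "complex_subspace M" and cl: "closed M"
  obtains P where "projection P" "\<And>x. P x = x \<longleftrightarrow> x \<in> M" "\<And>x. P x \<in> M"
proof -
  have "\<exists>p. p \<in> M \<and> (\<forall>q\<in>M. cinner q (x - p) = 0)" for x
    using projection_theorem[OF assms, of x] by metis
  then obtain f where f: "\<And>x. f x \<in> M" "\<And>x q. q \<in> M \<Longrightarrow> cinner q (x - f x) = 0"
    by metis
  have uniq: "f x = p" if "p \<in> M" "\<And>q. q \<in> M \<Longrightarrow> cinner q (x - p) = 0" for x p
  proof -
    have "f x - p \<in> M" using M f that by (intro complex_subspaceD)
    then have "cinner (f x - p) ((x - p) - (x - f x)) = 0"
      by (subst cinner_diff_right) (simp add: f that)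
    then show ?thesis using cinner_self[of "f x - p"] by simp
  qed
  have le: "norm (f x) \<le> norm x" for x
  proof (rule power2_le_imp_le)
    have "(norm (f x + (x - f x)))\<^sup>2 = (norm (f x))\<^sup>2 + (norm (x - f x))\<^sup>2"
      unfolding norm_sq_add by (simp add: f)
    then show "(norm (f x))\<^sup>2 \<le> (norm x)\<^sup>2" by simp
  qed simp
  obtain P where P: "P \<in> BH" "blinfun_apply P = f"
  proof (rule BH_of_linear)
    show "f (x + y) = f x + f y" for x y
    proof (rule uniq)
      show "f x + f y \<in> M" using M f by (intro complex_subspaceD)
      fix q assume "q \<in> M"
      then have "cinner q ((x - f x) + (y - f y)) = 0" by (simp add: cinner_add_right f)
      then show "cinner q (x + y - (f x + f y)) = 0" by (simp add: algebra_simps)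
    qed
    show "f (c *\<^sub>C x) = c *\<^sub>C f x" for c x
      using M f by (intro uniq complex_subspaceD)
        (auto simp: cinner_scaleC_right simp flip: scaleC_diff_right)
    show "norm (f x) \<le> 1 * norm x" for x using le by simp
  qed blast
  have fix_iff: "f x = x \<longleftrightarrow> x \<in> M" for x
    using f(1)[of x] uniq[of x x] by auto
  have "cinner (f x) y = cinner x (f y)" for x y
  proof -
    have "cinner (f x) (y - f y) = 0" "cinner (f y) (x - f x) = 0" by (simp_all add: f)
    then have "cinner (f x) y = cinner (f x) (f y)" "cinner (f y) x = cinner (f y) (f x)"
      by (simp_all add: cinner_diff_right)
    then show ?thesis by (metis cinner_commute)
  qed
  then have "projection P"
    using P by (intro projectionI) (auto simp: selfadjoint_def fix_iff f)
  then show ?thesis using that[of P] by (simp add: P fix_iff f)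
qed

section \<open>Square roots of bounded positive operators\<close>

text \<open>Collects the closure properties used by the square root iteration. Membership of the
  root in every such set that contains \<open>A\<close> expresses that it is a norm limit of real
  polynomials in \<open>A\<close>. The sets used later are the commutant of one bounded operator and
  the commutant of \<open>T\<close>.\<close>

definition closed_unital_algebra :: "('h::chilbert_space \<Rightarrow>\<^sub>L 'h) set \<Rightarrow> bool" where
  "closed_unital_algebra N \<longleftrightarrow> closed N \<and> id_blinfun \<in> N
     \<and> (\<forall>A\<in>N. \<forall>B\<in>N. A + B \<in> N \<and> A o\<^sub>L B \<in> N) \<and> (\<forall>A\<in>N. \<forall>r. r *\<^sub>R A \<in> N)"

lemma closed_unital_algebraD:
  assumes "closed_unital_algebra N"
  shows "closed N" "id_blinfun \<in> N" "A \<in> N \<Longrightarrow> B \<in> N \<Longrightarrow> A + B \<in> N"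
    "A \<in> N \<Longrightarrow> B \<in> N \<Longrightarrow> A o\<^sub>L B \<in> N" "A \<in> N \<Longrightarrow> r *\<^sub>R A \<in> N" "A \<in> N \<Longrightarrow> B \<in> N \<Longrightarrow> A - B \<in> N"
proof -
  show 1: "closed N" "id_blinfun \<in> N" "A \<in> N \<Longrightarrow> B \<in> N \<Longrightarrow> A + B \<in> N"
    "A \<in> N \<Longrightarrow> B \<in> N \<Longrightarrow> A o\<^sub>L B \<in> N" "A \<in> N \<Longrightarrow> r *\<^sub>R A \<in> N" for A B r
    using assms by (auto simp: closed_unital_algebra_def)
  show "A \<in> N \<Longrightarrow> B \<in> N \<Longrightarrow> A - B \<in> N"
    using 1(3)[of A "(-1) *\<^sub>R B"] 1(5)[of B "-1"] by simp
qed

lemma blinfun_compose_tendsto: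
  "F \<longlonglongrightarrow> R \<Longrightarrow> G \<longlonglongrightarrow> R' \<Longrightarrow> (\<lambda>n. F n o\<^sub>L G n) \<longlonglongrightarrow> (R o\<^sub>L R')"
  by (rule bounded_bilinear.tendsto[OF bounded_bilinear_blinfun_compose])

lemma blinfun_compose_simps:
  "(A + B) o\<^sub>L C = (A o\<^sub>L C) + (B o\<^sub>L C)" "C o\<^sub>L (A + B) = (C o\<^sub>L A) + (C o\<^sub>L B)"
  "(A - B) o\<^sub>L C = (A o\<^sub>L C) - (B o\<^sub>L C)" "C o\<^sub>L (A - B) = (C o\<^sub>L A) - (C o\<^sub>L B)"
  "(r *\<^sub>R A) o\<^sub>L C = r *\<^sub>R (A o\<^sub>L C)" "C o\<^sub>L (r *\<^sub>R A) = r *\<^sub>R (C o\<^sub>L A)"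
  "id_blinfun o\<^sub>L C = C" "C o\<^sub>L id_blinfun = C"
  by (auto intro!: blinfun_eqI simp: blinfun.bilinear_simps)

lemma blinfun_compose_assoc': "(A o\<^sub>L B) o\<^sub>L C = A o\<^sub>L (B o\<^sub>L C)"
  by (auto intro!: blinfun_eqI)

lemma closed_unital_algebra_commuting: "closed_unital_algebra {A. A o\<^sub>L Q = Q o\<^sub>L A}"
  unfolding closed_unital_algebra_def
proof (intro conjI ballI allI)
  show "closed {A. A o\<^sub>L Q = Q o\<^sub>L A}"
    unfolding closed_sequential_limits
  proof (intro allI impI; elim conjE)
    fix F R assume F: "\<forall>n. F n \<in> {A. A o\<^sub>L Q = Q o\<^sub>L A}" "F \<longlonglongrightarrow> R"
    have "(\<lambda>n. F n o\<^sub>L Q) \<longlonglongrightarrow> (R o\<^sub>L Q)" "(\<lambda>n. Q o\<^sub>L F n) \<longlonglongrightarrow> (Q o\<^sub>L R)"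
      using F(2) by (auto intro: blinfun_compose_tendsto tendsto_const)
    then show "R \<in> {A. A o\<^sub>L Q = Q o\<^sub>L A}" using F(1) LIMSEQ_unique by fastforce
  qed
next
  fix A B assume AB: "A \<in> {A. A o\<^sub>L Q = Q o\<^sub>L A}" "B \<in> {A. A o\<^sub>L Q = Q o\<^sub>L A}"
  then show "A o\<^sub>L B \<in> {A. A o\<^sub>L Q = Q o\<^sub>L A}"
    by (simp add: blinfun_compose_assoc') (simp flip: blinfun_compose_assoc')
qed (auto simp: blinfun_compose_simps)

text \<open>Writing P = I - Z and B = I - A turns P^2 = A into the fixed point equation Z = (B +
  Z^2) / 2, which is solved by iteration from 0 because ||B|| <= 1.\<close>

lemma positive_sqrt_exists_contraction:
  fixes A :: "'h::chilbert_space \<Rightarrow>\<^sub>L 'h"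
  assumes A: "positive_bounded A" and le: "norm A \<le> 1"
  shows "\<exists>P. positive_bounded P \<and> P o\<^sub>L P = A \<and> (\<forall>N. closed_unital_algebra N \<longrightarrow> A \<in> N \<longrightarrow> P \<in> N)"
proof -
  define B where "B = id_blinfun - A"
  have saA: "selfadjoint A" using A by (simp add: positive_bounded_def)
  have saB: "selfadjoint B" unfolding B_def using saA by (intro selfadjoint_diff) auto
  have form_B: "Re (cinner x (B x)) = (norm x)\<^sup>2 - Re (cinner x (A x))" for x
    by (simp add: B_def blinfun.bilinear_simps cinner_diff_right norm_sq_cinner)
  have "Re (cinner x (A x)) \<le> 1 * (norm x)\<^sup>2" for x
  proof -
    have "Re (cinner x (A x)) \<le> norm A * (norm x)\<^sup>2" using Re_cinner_apply_le[of x A] by linarith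
    also have "\<dots> \<le> 1 * (norm x)\<^sup>2" using le by (intro mult_right_mono) auto
    finally show ?thesis .
  qed
  then have "positive_bounded B" using saB by (simp add: positive_bounded_def form_B)
  have normB: "norm B \<le> 1"
  proof (rule norm_blinfun_bound)
    show "norm (B x) \<le> 1 * norm x" for x
      using A by (intro positive_norm_le \<open>positive_bounded B\<close>) (auto simp: form_B positive_bounded_def)
  qed simp
  define Y where "Y = rec_nat (0 :: 'h \<Rightarrow>\<^sub>L 'h) (\<lambda>_ Y. (1/2) *\<^sub>R (B + (Y o\<^sub>L Y)))"
  \<comment> \<open>The same iteration for the number 1 in place of \<open>B\<close>. It increases
    and is bounded by 1, and its increments dominate those of \<open>Y\<close> in norm.\<close>
  define y where "y = rec_nat (0 :: real) (\<lambda>_ y. (1 + y\<^sup>2) / 2)"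
  have Y: "Y 0 = 0" "Y (Suc n) = (1/2) *\<^sub>R (B + (Y n o\<^sub>L Y n))" for n by (simp_all add: Y_def)
  have y: "y 0 = 0" "y (Suc n) = (1 + (y n)\<^sup>2) / 2" for n by (simp_all add: y_def)
  have y01: "0 \<le> y n \<and> y n \<le> 1" for n
  proof (induction n)
    case (Suc n)
    then have "(y n)\<^sup>2 \<le> 1" by (simp add: power_le_one)
    then show ?case by (simp add: y)
  qed (simp add: y)
  have "y n \<le> y (Suc n)" for n
    using zero_le_power2[of "1 - y n"] by (simp add: y power2_eq_square algebra_simps)
  then have "incseq y" by (rule incseq_SucI)
  then have "convergent y" using y01 by (intro Bseq_mono_convergent BseqI'[of _ 1]) (auto simp: incseq_def)
  then have "Cauchy y" by (rule convergent_Cauchy)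
  have norm_Y: "norm (Y n) \<le> y n" for n
  proof (induction n)
    case (Suc n)
    have "norm (Y n o\<^sub>L Y n) \<le> norm (Y n) * norm (Y n)" by (rule norm_blinfun_compose)
    also have "\<dots> \<le> y n * y n" using Suc y01 by (intro mult_mono) auto
    finally have "norm (B + (Y n o\<^sub>L Y n)) \<le> 1 + (y n)\<^sup>2"
      using norm_triangle_ineq[of B "(Y n o\<^sub>L Y n)"] normB by (simp add: power2_eq_square)
    then show ?case by (simp add: Y y)
  qed (simp add: Y y)
  have step: "norm (Y (Suc n) - Y n) \<le> y (Suc n) - y n" for n
  proof (induction n)
    case 0
    show ?case using normB by (simp add: Y y)
  next
    case (Suc n)
    let ?D = "Y (Suc n) - Y n"
    have eq: "Y (Suc (Suc n)) - Y (Suc n) = (1/2) *\<^sub>R ((Y (Suc n) o\<^sub>L ?D) + (?D o\<^sub>L Y n))"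
    proof -
      have "Y (Suc (Suc n)) - Y (Suc n) = (1/2) *\<^sub>R (B + (Y (Suc n) o\<^sub>L Y (Suc n))) - (1/2) *\<^sub>R (B + (Y n o\<^sub>L Y n))"
        by (simp only: Y(2))
      also have "\<dots> = (1/2) *\<^sub>R ((Y (Suc n) o\<^sub>L Y (Suc n)) - (Y n o\<^sub>L Y n))"
        by (simp flip: scaleR_diff_right)
      \<comment> \<open>The splitting U^2 - V^2 = U (U - V) + (U - V) V is valid for noncommuting
        \<open>U\<close>, \<open>V\<close>.\<close>
      also have "(Y (Suc n) o\<^sub>L Y (Suc n)) - (Y n o\<^sub>L Y n) = (Y (Suc n) o\<^sub>L ?D) + (?D o\<^sub>L Y n)"
        by (simp add: blinfun_compose_simps)
      finally show ?thesis .
    qed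
    have "norm (Y (Suc n) o\<^sub>L ?D) \<le> y (Suc n) * (y (Suc n) - y n)"
      by (rule order_trans[OF norm_blinfun_compose]) (intro mult_mono norm_Y Suc, use y01 in auto)
    moreover have "norm (?D o\<^sub>L Y n) \<le> (y (Suc n) - y n) * y n"
      by (rule order_trans[OF norm_blinfun_compose])
        (intro mult_mono norm_Y Suc, use y01 \<open>incseq y\<close> in \<open>auto simp: incseq_Suc_iff\<close>)
    ultimately have "norm ((Y (Suc n) o\<^sub>L ?D) + (?D o\<^sub>L Y n))
        \<le> y (Suc n) * (y (Suc n) - y n) + (y (Suc n) - y n) * y n"
      using norm_triangle_ineq[of "(Y (Suc n) o\<^sub>L ?D)" "(?D o\<^sub>L Y n)"] by linarith
    also have "\<dots> = 2 * (y (Suc (Suc n)) - y (Suc n))"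
      using y(2)[of n] by (simp add: y(2)[of "Suc n"] power2_eq_square algebra_simps)
    finally show ?case unfolding eq by simp
  qed
  have le: "norm (Y m - Y n) \<le> y m - y n" if "n \<le> m" for m n
    using that
  proof (induction m rule: dec_induct)
    case (step m)
    have "norm (Y (Suc m) - Y n) \<le> norm (Y (Suc m) - Y m) + norm (Y m - Y n)"
      using norm_triangle_ineq[of "Y (Suc m) - Y m" "Y m - Y n"] by simp
    then show ?case using step \<open>norm (Y (Suc m) - Y m) \<le> y (Suc m) - y m\<close> by linarith
  qed simp
  have "Cauchy Y"
  proof (rule Cauchy_dominated[OF \<open>Cauchy y\<close>, where K=1])
    show "norm (Y m - Y n) \<le> 1 * dist (y m) (y n)" for m n
      using le[of m n] le[of n m]
      by (cases "n \<le> m") (auto simp: norm_minus_commute dist_real_def)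
  qed
  then obtain Z where Z: "Y \<longlonglongrightarrow> Z" by (auto simp: Cauchy_convergent_iff convergent_def)
  have "(\<lambda>n. Y (Suc n)) \<longlonglongrightarrow> (1/2) *\<^sub>R (B + (Z o\<^sub>L Z))"
    unfolding Y(2) by (intro tendsto_intros blinfun_compose_tendsto Z)
  then have fix_Z: "Z = (1/2) *\<^sub>R (B + (Z o\<^sub>L Z))"
    using Z LIMSEQ_Suc LIMSEQ_unique by blast
  have "selfadjoint (Y n)" for n
    by (induction n) (auto simp: Y intro!: selfadjoint_scaleR selfadjoint_add saB selfadjoint_compose)
  then have saZ: "selfadjoint Z" using closed_sequentially[OF closed_selfadjoint _ Z] by auto
  \<comment> \<open>This is what makes \<open>id_blinfun - Z\<close> positive.\<close>
  have normZ: "norm Z \<le> 1"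
    by (rule LIMSEQ_le_const2[OF tendsto_norm[OF Z]]) (use norm_Y y01 order_trans in blast)
  define P where "P = id_blinfun - Z"
  have "2 *\<^sub>R Z = B + (Z o\<^sub>L Z)" using arg_cong[OF fix_Z, of "(*\<^sub>R) 2"] by simp
  then have "B = Z + Z - (Z o\<^sub>L Z)" by (simp add: scaleR_2)
  moreover have "P o\<^sub>L P = id_blinfun - (Z + Z - (Z o\<^sub>L Z))" by (simp add: P_def blinfun_compose_simps)
  ultimately have "P o\<^sub>L P = id_blinfun - B" by simp
  then have "P o\<^sub>L P = A" by (simp add: B_def)
  moreover have "positive_bounded P"
    unfolding positive_bounded_def
  proof (intro conjI allI)
    fix x
    have "Re (cinner x (Z x)) \<le> norm Z * (norm x)\<^sup>2" using Re_cinner_apply_le[of x Z] by linarith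
    also have "\<dots> \<le> 1 * (norm x)\<^sup>2" using normZ by (intro mult_right_mono) auto
    finally show "0 \<le> Re (cinner x (P x))"
      by (simp add: P_def blinfun.bilinear_simps cinner_diff_right norm_sq_cinner)
  qed (auto simp: P_def intro!: selfadjoint_diff saZ)
  moreover have "P \<in> N" if N: "closed_unital_algebra N" "A \<in> N" for N
  proof -
    note D = closed_unital_algebraD[OF N(1)]
    have B: "B \<in> N" unfolding B_def by (rule D(6)[OF D(2) N(2)])
    have "0 \<in> N" using D(5)[OF N(2), of 0] by simp
    then have "Y n \<in> N" for n by (induction n) (simp_all add: Y D(3-5) B)
    then have "Z \<in> N" using closed_sequentially[OF D(1) _ Z] by blast
    then show ?thesis unfolding P_def by (rule D(6)[OF D(2)])
  qed
  ultimately show ?thesis by blast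
qed

lemma positive_scaleR: "positive_bounded A \<Longrightarrow> r \<ge> 0 \<Longrightarrow> positive_bounded (r *\<^sub>R A)"
  by (auto simp: positive_bounded_def selfadjoint_scaleR blinfun.bilinear_simps cinner_scaleR_right)

lemma positive_sqrt_exists:
  fixes A :: "'h::chilbert_space \<Rightarrow>\<^sub>L 'h"
  assumes A: "positive_bounded A"
  shows "\<exists>P. positive_bounded P \<and> P o\<^sub>L P = A \<and> (\<forall>N. closed_unital_algebra N \<longrightarrow> A \<in> N \<longrightarrow> P \<in> N)"
proof -
  \<comment> \<open>Scaling by a positive number above the norm reduces to a contraction; the root
    is rescaled by \<open>sqrt c\<close>.\<close>
  define c where "c = norm A + 1"
  have c: "c > 0" using norm_ge_zero[of A] by (simp add: c_def add_nonneg_pos)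
  have "positive_bounded ((1/c) *\<^sub>R A)" using A c by (intro positive_scaleR) auto
  moreover have "norm ((1/c) *\<^sub>R A) \<le> 1" using c by (simp add: c_def)
  ultimately obtain P where P: "positive_bounded P" "P o\<^sub>L P = (1/c) *\<^sub>R A"
    "\<And>N. closed_unital_algebra N \<Longrightarrow> (1/c) *\<^sub>R A \<in> N \<Longrightarrow> P \<in> N"
    using positive_sqrt_exists_contraction by blast
  show ?thesis
  proof (intro exI conjI allI impI)
    show "positive_bounded (sqrt c *\<^sub>R P)" using P(1) c by (intro positive_scaleR) auto
    show "((sqrt c *\<^sub>R P) o\<^sub>L (sqrt c *\<^sub>R P)) = A"
      using c by (simp add: blinfun_compose_simps P(2))
    show "sqrt c *\<^sub>R P \<in> N" if "closed_unital_algebra N" "A \<in> N" for N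
      by (rule closed_unital_algebraD(5)[OF that(1)], rule P(3)[OF that(1)],
        rule closed_unital_algebraD(5)[OF that])
  qed
qed

text \<open>Commutation gives (P + Q)(P - Q) = 0. At y = (P - Q) x the two nonnegative forms sum to
  zero, so P y = Q y = 0, hence (P - Q)^2 x = 0 and then (P - Q) x = 0.\<close>

lemma commuting_positive_roots_eq:
  assumes P: "positive_bounded P" and Q: "positive_bounded Q" and sq: "P o\<^sub>L P = Q o\<^sub>L Q" and comm: "P o\<^sub>L Q = Q o\<^sub>L P"
  shows "P = Q"
proof -
  have sa: "selfadjoint P" "selfadjoint Q" "selfadjoint (P - Q)"
    using P Q by (auto simp: positive_bounded_def selfadjoint_diff)
  have "(P - Q) x = 0" for x
  proof -
    define y where "y = (P - Q) x"
    have "((P + Q) o\<^sub>L (P - Q)) = 0" by (simp add: blinfun_compose_simps sq comm)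
    then have "P y + Q y = 0"
      by (metis blinfun.add_left blinfun.zero_left blinfun_apply_blinfun_compose y_def)
    then have "Re (cinner y (P y)) + Re (cinner y (Q y)) = 0"
      by (metis cinner_add_right cinner_zero_right plus_complex.sel(1) zero_complex.sel(1))
    then have "Re (cinner y (P y)) = 0" "Re (cinner y (Q y)) = 0"
      using P Q by (auto simp: positive_bounded_def add_nonneg_eq_0_iff)
    then have "P y = 0" "Q y = 0" using P Q positive_form_zero by blast+
    then have "(P - Q) y = 0" by (simp add: blinfun.diff_left)
    then have "(P - Q) ((P - Q) x) = 0" by (simp only: y_def)
    then show ?thesis using cinner_selfadjoint_square[OF sa(3), of x] by simp
  qed
  then have "P - Q = 0" by (intro blinfun_eqI) simp
  then show ?thesis by simp
qed

definition bsqrt :: "('h::chilbert_space \<Rightarrow>\<^sub>L 'h) \<Rightarrow> ('h \<Rightarrow>\<^sub>L 'h)" where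
  "bsqrt A = (SOME P. positive_bounded P \<and> P o\<^sub>L P = A \<and> (\<forall>N. closed_unital_algebra N \<longrightarrow> A \<in> N \<longrightarrow> P \<in> N))"

lemma bsqrt:
  assumes "positive_bounded A"
  shows "positive_bounded (bsqrt A)" "(bsqrt A o\<^sub>L bsqrt A) = A"
    "\<And>N. closed_unital_algebra N \<Longrightarrow> A \<in> N \<Longrightarrow> bsqrt A \<in> N"
  using someI_ex[OF positive_sqrt_exists[OF assms], folded bsqrt_def] by simp_all

lemma bsqrt_commute: "positive_bounded A \<Longrightarrow> A o\<^sub>L Q = Q o\<^sub>L A \<Longrightarrow> bsqrt A o\<^sub>L Q = Q o\<^sub>L bsqrt A"
  using bsqrt(3)[OF _ closed_unital_algebra_commuting, of A Q] by simp

text \<open>The root built by iteration commutes with everything that commutes with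
  \<open>P o\<^sub>L P\<close>, in particular with \<open>P\<close>, so commuting roots are
  compared.\<close>

lemma bsqrt_unique:
  assumes "positive_bounded P"
  shows "bsqrt (P o\<^sub>L P) = P"
proof -
  have sa: "selfadjoint P" using assms by (simp add: positive_bounded_def)
  have pos: "positive_bounded (P o\<^sub>L P)"
    unfolding positive_bounded_def using sa
    by (auto intro!: selfadjoint_compose simp: cinner_selfadjoint_square)
  have "bsqrt (P o\<^sub>L P) o\<^sub>L P = P o\<^sub>L bsqrt (P o\<^sub>L P)"
    by (rule bsqrt_commute[OF pos blinfun_compose_assoc'])
  then show ?thesis
    using commuting_positive_roots_eq[OF bsqrt(1)[OF pos] assms bsqrt(2)[OF pos]] by blast
qed

section \<open>Integration with respect to a projection-valued measure\<close>

lemma continuous_blinfun [continuous_intros]: "continuous_on X (blinfun_apply A)"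
  by (intro linear_continuous_on blinfun.bounded_linear_right)

locale pvm =
  fixes E :: "real set \<Rightarrow> ('h::chilbert_space \<Rightarrow>\<^sub>L 'h)"
  assumes pvm: "projection_valued_measure E"
begin

lemma projection: "A \<in> sets borel \<Longrightarrow> projection (E A)"
  using pvm by (auto simp: projection_valued_measure_def projection_def selfadjoint_iff_adj)

lemma E_UNIV [simp]: "E UNIV = id_blinfun"
  using pvm by (auto simp: projection_valued_measure_def)

lemma E_sums:
  "range A \<subseteq> sets borel \<Longrightarrow> disjoint_family A \<Longrightarrow> (\<lambda>n. E (A n) x) sums E (\<Union>n. A n) x"
  using pvm by (auto simp: projection_valued_measure_def)

text \<open>A constant sequence with convergent sum has value zero.\<close>

lemma E_empty [simp]: "E {} = 0"
proof (rule blinfun_eqI)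
  fix x
  have "(\<lambda>n::nat. E {} x) sums E {} x" using E_sums[of "\<lambda>_. {}" x] by (simp add: disjoint_family_on_def)
  then have "(\<lambda>n::nat. E {} x) \<longlonglongrightarrow> 0" by (intro summable_LIMSEQ_zero sums_summable)
  then show "E {} x = blinfun_apply 0 x" by (simp add: LIMSEQ_const_iff)
qed

lemma E_Un:
  assumes "A \<in> sets borel" "B \<in> sets borel" "A \<inter> B = {}"
  shows "E (A \<union> B) x = E A x + E B x"
proof -
  have "(\<lambda>n. E (binaryset A B n) x) sums E (\<Union>n. binaryset A B n) x"
    using assms by (intro E_sums) (auto simp: binaryset_def disjoint_family_on_def)
  moreover have "(\<lambda>n. E (binaryset A B n) x) sums (E A x + E B x)"
    by (rule binaryset_sums) simp
  ultimately show ?thesis by (simp add: UN_binaryset_eq sums_unique2)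
qed

text \<open>Multiplicativity is a consequence of additivity. For disjoint sets ||E A x||^2 + ||E B
  x||^2 is the squared norm of a single projection, hence at most ||x||^2, so the ranges are
  orthogonal. The general case splits both sets along their intersection.\<close>

lemma E_Int:
  assumes A: "A \<in> sets borel" and B: "B \<in> sets borel"
  shows "E A (E B x) = E (A \<inter> B) x"
proof -
  have disj: "E A (E B x) = 0" if "A \<in> sets borel" "B \<in> sets borel" "A \<inter> B = {}" for A B x
  proof (rule projections_orthogonal)
    show "(norm (E A x))\<^sup>2 + (norm (E B x))\<^sup>2 \<le> (norm x)\<^sup>2" for x
    proof -
      have "(norm (E A x))\<^sup>2 + (norm (E B x))\<^sup>2 = Re (cinner x (E (A \<union> B) x))"
        using that by (simp add: E_Un cinner_add_right cinner_projection projection)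
      also have "\<dots> = (norm (E (A \<union> B) x))\<^sup>2" using that by (intro cinner_projection projection) auto
      also have "\<dots> \<le> (norm x)\<^sup>2" using that by (intro power_mono norm_projection_le projection) auto
      finally show ?thesis .
    qed
  qed (use that projection in auto)
  have "E A = E ((A \<inter> B) \<union> (A - B))" "E B = E ((A \<inter> B) \<union> (B - A))"
    by (simp_all add: Int_Diff_Un Int_commute[of A B])
      (simp add: Un_commute Un_Diff_Int Int_commute)
  then have "E A (E B x) = E ((A \<inter> B) \<union> (A - B)) (E ((A \<inter> B) \<union> (B - A)) x)" by simp
  also have "\<dots> = E (A \<inter> B) (E (A \<inter> B) x)"
  proof -
    have "E (A \<inter> B) (E (B - A) x) = 0" "E (A - B) (E (A \<inter> B) x) = 0" "E (A - B) (E (B - A) x) = 0"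
      using A B by (auto intro!: disj)
    then show ?thesis
      using A B by (subst (1 2) E_Un) (auto simp: blinfun.bilinear_simps)
  qed
  also have "\<dots> = E (A \<inter> B) x" using A B by (intro projectionD projection) auto
  finally show ?thesis .
qed

lemma E_UN_finite:
  assumes "finite I" "\<And>i. i \<in> I \<Longrightarrow> A i \<in> sets borel" "disjoint_family_on A I"
  shows "E (\<Union>i\<in>I. A i) x = (\<Sum>i\<in>I. E (A i) x)"
  using assms
proof (induction I)
  case (insert j I)
  have "A j \<inter> (\<Union>i\<in>I. A i) = {}"
    using insert by (auto simp: disjoint_family_on_def)
  then have "E (\<Union>i\<in>insert j I. A i) x = E (A j) x + E (\<Union>i\<in>I. A i) x"
    using insert by (auto intro!: E_Un)
  then show ?case using insert by (simp add: disjoint_family_on_def)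
qed simp

subsection \<open>The scalar measures\<close>

abbreviation \<mu> :: "'h \<Rightarrow> real measure" where "\<mu> \<equiv> vector_measure E"

lemma sets_mu [simp, measurable_cong]: "sets (\<mu> x) = sets borel"
  using sets.sigma_sets_eq[of "borel :: real measure"] by (simp add: vector_measure_def)

lemma space_mu [simp]: "space (\<mu> x) = UNIV"
  by (simp add: vector_measure_def)

lemma emeasure_mu:
  assumes "A \<in> sets borel"
  shows "emeasure (\<mu> x) A = ennreal ((norm (E A x))\<^sup>2)"
proof -
  have eq: "Re (cinner x (E A x)) = (norm (E A x))\<^sup>2" if "A \<in> sets borel" for A
    using that by (intro cinner_projection projection)
  have "emeasure (\<mu> x) A = ennreal (Re (cinner x (E A x)))"
    unfolding vector_measure_def
  proof (rule emeasure_measure_of_sigma)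
    show "sigma_algebra UNIV (sets borel)" using sets.sigma_algebra_axioms[of borel] by simp
    show "Sigma_Algebra.positive (sets borel) (\<lambda>A. ennreal (Re (cinner x (E A x))))"
      by (simp add: Sigma_Algebra.positive_def)
    show "countably_additive (sets borel) (\<lambda>A. ennreal (Re (cinner x (E A x))))"
    proof (rule countably_additiveI)
      fix A :: "nat \<Rightarrow> real set" assume A: "range A \<subseteq> sets borel" "disjoint_family A"
      have "(\<lambda>n. Re (cinner x (E (A n) x))) sums Re (cinner x (E (\<Union>n. A n) x))"
        using bounded_linear.sums[OF bounded_linear_compose[OF bounded_linear_Re
          bounded_bilinear.bounded_linear_right[OF bounded_bilinear_cinner, of x]] E_sums[OF A]] .
      moreover have "0 \<le> Re (cinner x (E (A n) x))" for n using A eq[of "A n"] by auto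
      ultimately show "(\<Sum>n. ennreal (Re (cinner x (E (A n) x)))) = ennreal (Re (cinner x (E (\<Union>n. A n) x)))"
        by (intro suminf_ennreal_eq)
    qed
  qed fact
  then show ?thesis using eq[OF assms] by simp
qed

text \<open>The comparison on sets passes to simple functions and then to the supremum defining the
  integral, so it holds for every \<open>f\<close>. It controls the measures of \<open>x + y\<close>
  and of images under operators, that is, the domain of a spectral integral.\<close>

lemma nn_integral_mu_le:
  assumes le: "\<And>A. A \<in> sets borel \<Longrightarrow> emeasure (\<mu> z) A \<le> a * emeasure (\<mu> x) A + b * emeasure (\<mu> y) A"
  shows "(\<integral>\<^sup>+t. f t \<partial>\<mu> z) \<le> a * (\<integral>\<^sup>+t. f t \<partial>\<mu> x) + b * (\<integral>\<^sup>+t. f t \<partial>\<mu> y)"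
  unfolding nn_integral_def[of "\<mu> z"]
proof (rule SUP_least, clarify)
  fix g assume g: "simple_function (\<mu> z) g" "g \<le> f"
  have sf: "simple_function (\<mu> w) g" for w
    using g(1) by (simp add: simple_function_def)
  have le_nn: "integral\<^sup>S (\<mu> w) g \<le> (\<integral>\<^sup>+t. f t \<partial>\<mu> w)" for w
    unfolding nn_integral_def using sf g(2) by (intro SUP_upper) auto
  have "integral\<^sup>S (\<mu> z) g \<le> (\<Sum>v\<in>range g. v * (a * emeasure (\<mu> x) (g -` {v}) + b * emeasure (\<mu> y) (g -` {v})))"
    unfolding simple_integral_def space_mu Int_UNIV_right
  proof (intro sum_mono mult_left_mono le)
    show "g -` {v} \<in> sets borel" for v using simple_functionD(2)[OF g(1), of "{v}"] by simp
  qed simp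
  also have "\<dots> = a * integral\<^sup>S (\<mu> x) g + b * integral\<^sup>S (\<mu> y) g"
    by (simp add: simple_integral_def sum_distrib_left distrib_left sum.distrib mult.left_commute)
  also have "\<dots> \<le> a * (\<integral>\<^sup>+t. f t \<partial>\<mu> x) + b * (\<integral>\<^sup>+t. f t \<partial>\<mu> y)"
    by (intro add_mono mult_left_mono le_nn) auto
  finally show "integral\<^sup>S (\<mu> z) g \<le> \<dots>" .
qed

lemma nn_integral_mu_add_le:
  "(\<integral>\<^sup>+t. f t \<partial>\<mu> (x + y)) \<le> 2 * (\<integral>\<^sup>+t. f t \<partial>\<mu> x) + 2 * (\<integral>\<^sup>+t. f t \<partial>\<mu> y)"
proof (rule nn_integral_mu_le)
  fix A :: "real set" assume A: "A \<in> sets borel"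
  have "(norm (E A (x + y)))\<^sup>2 \<le> (norm (E A x) + norm (E A y))\<^sup>2"
    by (simp add: blinfun.add_right norm_triangle_ineq power_mono)
  also have "\<dots> \<le> 2 * (norm (E A x))\<^sup>2 + 2 * (norm (E A y))\<^sup>2"
    using sum_squares_bound[of "norm (E A x)" "norm (E A y)"] by (simp add: power2_sum)
  finally have "ennreal ((norm (E A (x + y)))\<^sup>2) \<le> ennreal (2 * (norm (E A x))\<^sup>2 + 2 * (norm (E A y))\<^sup>2)"
    by (rule ennreal_leI)
  then show "emeasure (\<mu> (x + y)) A \<le> 2 * emeasure (\<mu> x) A + 2 * emeasure (\<mu> y) A"
    using A by (simp add: emeasure_mu ennreal_mult)
qed

lemma nn_integral_mu_apply_le:
  assumes "\<And>A. A \<in> sets borel \<Longrightarrow> norm (E A z) \<le> c * norm (E A x)"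
  shows "(\<integral>\<^sup>+t. f t \<partial>\<mu> z) \<le> ennreal (c\<^sup>2) * (\<integral>\<^sup>+t. f t \<partial>\<mu> x)"
proof -
  have "(\<integral>\<^sup>+t. f t \<partial>\<mu> z) \<le> ennreal (c\<^sup>2) * (\<integral>\<^sup>+t. f t \<partial>\<mu> x) + 0 * (\<integral>\<^sup>+t. f t \<partial>\<mu> x)"
  proof (rule nn_integral_mu_le)
    fix A :: "real set" assume A: "A \<in> sets borel"
    have "(norm (E A z))\<^sup>2 \<le> (c * norm (E A x))\<^sup>2" using assms[OF A] by (intro power_mono) auto
    then have "ennreal ((norm (E A z))\<^sup>2) \<le> ennreal (c\<^sup>2) * ennreal ((norm (E A x))\<^sup>2)"
      by (simp add: power_mult_distrib ennreal_leI flip: ennreal_mult)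
    then show "emeasure (\<mu> z) A \<le> ennreal (c\<^sup>2) * emeasure (\<mu> x) A + 0 * emeasure (\<mu> x) A"
      using A by (simp add: emeasure_mu)
  qed
  then show ?thesis by simp
qed

subsection \<open>Integrals of simple functions\<close>

abbreviation SI :: "(real \<Rightarrow> complex) \<Rightarrow> 'h \<Rightarrow> 'h" where "SI \<equiv> simple_spectral_integral E"

text \<open>The level sets of \<open>p\<close> refine those of the composite, so the sum may be
  taken over the values of \<open>p\<close>. With \<open>p\<close> a pair of simple functions this
  gives a common refinement on which sums and products are computed.\<close>

lemma SI_comp:
  assumes p: "simple_function borel p"
  shows "SI (\<lambda>t. \<phi> (p t)) x = (\<Sum>v\<in>range p. \<phi> v *\<^sub>C E (p -` {v}) x)"
proof -
  have fin: "finite (range p)" and meas: "p -` V \<in> sets borel" for V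
    using simple_functionD[OF p] by auto
  have "E ((\<lambda>t. \<phi> (p t)) -` {c}) x = (\<Sum>v\<in>{v \<in> range p. \<phi> v = c}. E (p -` {v}) x)" for c
  proof -
    have "(\<lambda>t. \<phi> (p t)) -` {c} = (\<Union>v\<in>{v \<in> range p. \<phi> v = c}. p -` {v})" by auto
    moreover have "E (\<Union>v\<in>{v \<in> range p. \<phi> v = c}. p -` {v}) x = (\<Sum>v\<in>{v \<in> range p. \<phi> v = c}. E (p -` {v}) x)"
      using fin meas by (intro E_UN_finite) (auto simp: disjoint_family_on_def)
    ultimately show ?thesis by simp
  qed
  then have "SI (\<lambda>t. \<phi> (p t)) x
      = (\<Sum>c\<in>range (\<lambda>t. \<phi> (p t)). \<Sum>v\<in>{v \<in> range p. \<phi> v = c}. \<phi> v *\<^sub>C E (p -` {v}) x)"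
    unfolding simple_spectral_integral_def by (intro sum.cong) (simp_all add: scaleC_sum_right)
  also have "\<dots> = (\<Sum>v\<in>range p. \<phi> v *\<^sub>C E (p -` {v}) x)"
    using fin finite_imageI[OF fin, of \<phi>] by (intro sum.group) (auto simp: image_image)
  finally show ?thesis .
qed

lemma SI_superset:
  assumes "finite C" "range s \<subseteq> C"
  shows "SI s x = (\<Sum>c\<in>C. c *\<^sub>C E (s -` {c}) x)"
  unfolding simple_spectral_integral_def
proof (rule sum.mono_neutral_left[OF assms], clarify)
  fix c assume "c \<notin> range s"
  then have "s -` {c} = {}" by auto
  then show "c *\<^sub>C E (s -` {c}) x = 0" by simp
qed

lemma SI_indicator: "A \<in> sets borel \<Longrightarrow> SI (indicator A) x = E A x"
proof -
  have "(indicator A :: real \<Rightarrow> complex) -` {1} = A" by (auto simp: indicator_def)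
  then show ?thesis by (subst SI_superset[of "{0, 1}"]) (auto simp: indicator_def)
qed

context
  fixes s s' :: "real \<Rightarrow> complex"
  assumes s: "simple_function borel s" and s': "simple_function borel s'"
begin

lemma SI_pair: "SI (\<lambda>t. \<phi> (s t) (s' t)) x = (\<Sum>v\<in>range (\<lambda>t. (s t, s' t)).
    \<phi> (fst v) (snd v) *\<^sub>C E ((\<lambda>t. (s t, s' t)) -` {v}) x)"
  using SI_comp[of "\<lambda>t. (s t, s' t)" "\<lambda>v. \<phi> (fst v) (snd v)" x] s s' by simp

lemma SI_add: "SI (\<lambda>t. s t + s' t) x = SI s x + SI s' x"
  using SI_pair[of "\<lambda>a b. a + b" x] SI_pair[of "\<lambda>a b. a" x] SI_pair[of "\<lambda>a b. b" x]
  by (simp add: scaleC_add_left sum.distrib)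

lemma SI_diff: "SI (\<lambda>t. s t - s' t) x = SI s x - SI s' x"
  using SI_pair[of "\<lambda>a b. a - b" x] SI_pair[of "\<lambda>a b. a" x] SI_pair[of "\<lambda>a b. b" x]
  by (simp add: scaleC_diff_left sum_subtractf)

text \<open>On the common refinement the projections of different cells annihilate each other, so
  only the diagonal terms of the double sum survive.\<close>

lemma SI_mult: "SI (\<lambda>t. s t * s' t) x = SI s (SI s' x)"
proof -
  let ?p = "\<lambda>t. (s t, s' t)"
  have p: "simple_function borel ?p" using s s' by simp
  have fin: "finite (range ?p)" and meas: "?p -` V \<in> sets borel" for V
    using simple_functionD[OF p] by auto
  let ?E = "\<lambda>v. E (?p -` {v})"
  have hom: "?E v (c *\<^sub>C y) = c *\<^sub>C ?E v y" for v c y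
    using meas by (intro BH_scaleC projectionD projection)
  have "SI s (SI s' x) = (\<Sum>v\<in>range ?p. fst v *\<^sub>C ?E v (\<Sum>w\<in>range ?p. snd w *\<^sub>C ?E w x))"
    using SI_pair[of "\<lambda>a b. a"] SI_pair[of "\<lambda>a b. b"] by simp
  also have "\<dots> = (\<Sum>v\<in>range ?p. fst v *\<^sub>C snd v *\<^sub>C ?E v x)"
  proof (intro sum.cong refl arg_cong2[where f="(*\<^sub>C)"])
    fix v assume v: "v \<in> range ?p"
    have "?E v (\<Sum>w\<in>range ?p. snd w *\<^sub>C ?E w x) = (\<Sum>w\<in>range ?p. snd w *\<^sub>C E (?p -` {v} \<inter> ?p -` {w}) x)"
      by (simp add: blinfun.sum_right hom E_Int meas)
    also have "\<dots> = (\<Sum>w\<in>range ?p. if w = v then snd v *\<^sub>C ?E v x else 0)"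
    proof (intro sum.cong refl)
      fix w
      have "?p -` {v} \<inter> ?p -` {w} = (if w = v then ?p -` {v} else {})" by auto
      then show "snd w *\<^sub>C E (?p -` {v} \<inter> ?p -` {w}) x = (if w = v then snd v *\<^sub>C ?E v x else 0)"
        by (simp only:) simp
    qed
    also have "\<dots> = snd v *\<^sub>C ?E v x" using fin v by simp
    finally show "?E v (\<Sum>w\<in>range ?p. snd w *\<^sub>C ?E w x) = snd v *\<^sub>C ?E v x" .
  qed
  also have "\<dots> = SI (\<lambda>t. s t * s' t) x"
    using SI_pair[of "\<lambda>a b. a * b"] by (simp add: scaleC_scaleC)
  finally show ?thesis ..
qed

end

context
  fixes s :: "real \<Rightarrow> complex"
  assumes s: "simple_function borel s"
begin

lemma finite_range_simple: "finite (range s)" and vimage_simple: "s -` V \<in> sets borel"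
  using simple_functionD[OF s] by auto

lemma SI_cmult: "SI (\<lambda>t. c * s t) x = c *\<^sub>C SI s x"
  unfolding SI_comp[OF s, of "\<lambda>v. c * v"]
  by (simp add: simple_spectral_integral_def scaleC_sum_right scaleC_scaleC)

lemma SI_add_vector: "SI s (x + y) = SI s x + SI s y"
  by (simp add: simple_spectral_integral_def blinfun.add_right scaleC_add_right sum.distrib)

lemma SI_commute:
  assumes R: "R \<in> BH" and comm: "\<And>A y. A \<in> sets borel \<Longrightarrow> R (E A y) = E A (R y)"
  shows "SI s (R x) = R (SI s x)"
  by (simp add: simple_spectral_integral_def blinfun.sum_right BH_scaleC[OF R] comm vimage_simple)

lemma SI_adjoint: "cinner y (SI s x) = cinner (SI (\<lambda>t. cnj (s t)) y) x"
  unfolding SI_comp[OF s, of cnj]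
  by (simp add: simple_spectral_integral_def cinner_sum_right cinner_sum_left cinner_simps
      projectionD(4)[OF projection[OF vimage_simple]])

lemma SI_continuous: "continuous_on UNIV (SI s)"
  unfolding simple_spectral_integral_def by (intro continuous_intros)

text \<open>The isometry of the integral: moving one factor across by \<open>SI_adjoint\<close>
  turns ||SI s x||^2 into the form of the integral of |s|^2.\<close>

lemma SI_norm: "(\<integral>\<^sup>+t. ennreal ((cmod (s t))\<^sup>2) \<partial>\<mu> x) = ennreal ((norm (SI s x))\<^sup>2)"
proof -
  have cs: "simple_function borel (\<lambda>t. cnj (s t))" using simple_function_compose[OF s, of cnj] by (simp add: comp_def)
  have "(norm (SI s x))\<^sup>2 = Re (cinner x (SI (\<lambda>t. cnj (s t)) (SI s x)))"
    unfolding norm_sq_cinner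
    using SI_adjoint[of "SI s x" x] by (metis cinner_commute complex_cnj cnj.sel(1))
  also have "SI (\<lambda>t. cnj (s t)) (SI s x) = SI (\<lambda>t. cnj (s t) * s t) x"
    by (simp add: SI_mult[OF cs s])
  also have "\<dots> = (\<Sum>c\<in>range s. of_real ((cmod c)\<^sup>2) *\<^sub>C E (s -` {c}) x)"
    unfolding SI_comp[OF s, of "\<lambda>v. cnj v * v"] by (simp only: complex_norm_square mult.commute)
  also have "Re (cinner x \<dots>) = (\<Sum>c\<in>range s. (cmod c)\<^sup>2 * (norm (E (s -` {c}) x))\<^sup>2)"
    by (simp add: cinner_sum_right cinner_simps cinner_projection[OF projection[OF vimage_simple]] del: of_real_power)
  finally have 1: "(norm (SI s x))\<^sup>2 = (\<Sum>c\<in>range s. (cmod c)\<^sup>2 * (norm (E (s -` {c}) x))\<^sup>2)" .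
  have "ennreal ((cmod (s t))\<^sup>2) = (\<Sum>c\<in>range s. ennreal ((cmod c)\<^sup>2) * indicator (s -` {c}) t)" for t
  proof -
    have "(\<Sum>c\<in>range s. ennreal ((cmod c)\<^sup>2) * indicator (s -` {c}) t)
        = (\<Sum>c\<in>range s. if c = s t then ennreal ((cmod c)\<^sup>2) else 0)"
      by (intro sum.cong) (auto simp: indicator_def)
    then show ?thesis using finite_range_simple by simp
  qed
  then have "(\<integral>\<^sup>+t. ennreal ((cmod (s t))\<^sup>2) \<partial>\<mu> x)
      = (\<integral>\<^sup>+t. (\<Sum>c\<in>range s. ennreal ((cmod c)\<^sup>2) * indicator (s -` {c}) t) \<partial>\<mu> x)" by simp
  also have "\<dots> = (\<Sum>c\<in>range s. ennreal ((cmod c)\<^sup>2) * emeasure (\<mu> x) (s -` {c}))"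
    using vimage_simple by (subst nn_integral_sum) (auto intro!: sum.cong nn_integral_cmult_indicator)
  also have "\<dots> = ennreal ((norm (SI s x))\<^sup>2)"
    unfolding 1 using vimage_simple
    by (subst sum_ennreal[symmetric]) (auto simp: emeasure_mu ennreal_mult)
  finally show ?thesis .
qed

end

end

lemma borel_measurable_cnj: "g \<in> borel_measurable M \<Longrightarrow> (\<lambda>t. cnj (g t)) \<in> borel_measurable M"
  by (erule measurable_compose[where f=g and N=borel])
    (intro borel_measurable_continuous_onI continuous_intros)

context pvm
begin

subsection \<open>Integrals of Borel functions\<close>

abbreviation SP :: "(real \<Rightarrow> complex) \<Rightarrow> 'h op" where "SP \<equiv> spectral_integral E"

text \<open>The squared L^2 norm for the scalar measure of \<open>x\<close>. For Borel
  \<open>g\<close> its finiteness says that \<open>x\<close> is in the domain of the integral of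
  \<open>g\<close>.\<close>

definition sqn :: "(real \<Rightarrow> complex) \<Rightarrow> 'h \<Rightarrow> ennreal" where
  "sqn g x = (\<integral>\<^sup>+t. ennreal ((cmod (g t))\<^sup>2) \<partial>\<mu> x)"

lemma mem_SP: "(x, y) \<in> SP g \<longleftrightarrow> sqn g x < \<infinity> \<and> (\<exists>s. (\<forall>n. simple_function borel (s n))
    \<and> (\<lambda>n. sqn (\<lambda>t. g t - s n t) x) \<longlonglongrightarrow> 0 \<and> (\<lambda>n. SI (s n) x) \<longlonglongrightarrow> y)"
  by (simp add: spectral_integral_def sqn_def)

lemma sqn_SI: "simple_function borel s \<Longrightarrow> sqn s x = ennreal ((norm (SI s x))\<^sup>2)"
  by (simp add: sqn_def SI_norm)

lemma sqn_mono: "(\<And>t. cmod (f t) \<le> cmod (g t)) \<Longrightarrow> sqn f x \<le> sqn g x"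
  unfolding sqn_def by (intro nn_integral_mono ennreal_leI power_mono) auto

lemma borel_measurable_mu_simple [measurable_dest]: "simple_function borel s \<Longrightarrow> s \<in> borel_measurable borel"
  for s :: "real \<Rightarrow> complex"
  by (rule borel_measurable_simple_function)

lemma sqn_add_le:
  assumes [measurable]: "f \<in> borel_measurable borel" "g \<in> borel_measurable borel"
  shows "sqn (\<lambda>t. f t + g t) x \<le> 2 * sqn f x + 2 * sqn g x"
proof -
  have "ennreal ((cmod (f t + g t))\<^sup>2) \<le> 2 * ennreal ((cmod (f t))\<^sup>2) + 2 * ennreal ((cmod (g t))\<^sup>2)" for t
  proof -
    have "(cmod (f t + g t))\<^sup>2 \<le> (cmod (f t) + cmod (g t))\<^sup>2" by (simp add: norm_triangle_ineq power_mono)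
    also have "\<dots> \<le> 2 * (cmod (f t))\<^sup>2 + 2 * (cmod (g t))\<^sup>2"
      using sum_squares_bound[of "cmod (f t)" "cmod (g t)"] by (simp add: power2_sum)
    finally have "ennreal ((cmod (f t + g t))\<^sup>2) \<le> ennreal (2 * (cmod (f t))\<^sup>2 + 2 * (cmod (g t))\<^sup>2)"
      by (rule ennreal_leI)
    then show ?thesis by (simp add: ennreal_mult)
  qed
  then have "sqn (\<lambda>t. f t + g t) x
      \<le> (\<integral>\<^sup>+t. 2 * ennreal ((cmod (f t))\<^sup>2) + 2 * ennreal ((cmod (g t))\<^sup>2) \<partial>\<mu> x)"
    unfolding sqn_def by (intro nn_integral_mono)
  also have "\<dots> = 2 * sqn f x + 2 * sqn g x"
    unfolding sqn_def by (subst nn_integral_add) (auto simp: nn_integral_cmult)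
  finally show ?thesis .
qed

lemma sqn_cmult:
  assumes [measurable]: "f \<in> borel_measurable borel"
  shows "sqn (\<lambda>t. c * f t) x = ennreal ((cmod c)\<^sup>2) * sqn f x"
  unfolding sqn_def by (simp add: norm_mult power_mult_distrib ennreal_mult nn_integral_cmult)

lemma sqn_bounded:
  assumes "AE t in \<mu> x. cmod (g t) \<le> K"
  shows "sqn g x \<le> ennreal ((K * norm x)\<^sup>2)"
proof -
  have "sqn g x \<le> (\<integral>\<^sup>+t. ennreal (K\<^sup>2) \<partial>\<mu> x)"
    unfolding sqn_def
    by (rule nn_integral_mono_AE) (use assms in eventually_elim, auto intro!: ennreal_leI power_mono)
  also have "\<dots> = ennreal ((K * norm x)\<^sup>2)"
    using emeasure_mu[of UNIV x] by (simp add: power_mult_distrib ennreal_mult)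
  finally show ?thesis .
qed

lemma sqn_dominated:
  assumes [measurable]: "\<And>n. f n \<in> borel_measurable borel" "g \<in> borel_measurable borel"
    and fin: "sqn g x < \<infinity>" and dom: "\<And>n t. cmod (f n t) \<le> cmod (g t)"
    and lim: "\<And>t. (\<lambda>n. f n t) \<longlonglongrightarrow> h t"
  shows "(\<lambda>n. sqn (f n) x) \<longlonglongrightarrow> sqn h x"
proof -
  have [measurable]: "h \<in> borel_measurable borel"
    by (rule borel_measurable_LIMSEQ_metric[OF _ lim]) auto
  show ?thesis
    unfolding sqn_def
    by (rule nn_integral_dominated_convergence[where w="\<lambda>t. ennreal ((cmod (g t))\<^sup>2)"])
      (use fin in \<open>auto simp: sqn_def intro!: ennreal_leI power_mono dom tendsto_intros lim\<close>)
qed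

text \<open>The definition of \<open>spectral_integral\<close> lets the simple functions depend on
  the vector and asks only for L^2 convergence. Pointwise convergence with domination yields one
  sequence that serves all vectors of the domain at once. The factor 2 is the one in
  \<open>borel_measurable_implies_sequence_metric\<close>.\<close>

definition approximates :: "(nat \<Rightarrow> real \<Rightarrow> complex) \<Rightarrow> (real \<Rightarrow> complex) \<Rightarrow> bool" where
  "approximates s g \<longleftrightarrow> (\<forall>n. simple_function borel (s n)) \<and> (\<forall>t. (\<lambda>n. s n t) \<longlonglongrightarrow> g t)
     \<and> (\<forall>n t. cmod (s n t) \<le> 2 * cmod (g t))"

lemma approximates_exists:
  assumes "g \<in> borel_measurable borel"
  obtains s where "approximates s g"
  using borel_measurable_implies_sequence_metric[OF assms, of 0] by (auto simp: approximates_def)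

lemma approximatesD:
  assumes "approximates s g"
  shows "simple_function borel (s n)" "s n \<in> borel_measurable borel" "(\<lambda>n. s n t) \<longlonglongrightarrow> g t"
    "cmod (s n t) \<le> 2 * cmod (g t)"
  using assms by (auto simp: approximates_def dest: borel_measurable_mu_simple)

lemma approximates_sqn:
  assumes g [measurable]: "g \<in> borel_measurable borel" and fin: "sqn g x < \<infinity>" and s: "approximates s g"
  shows "(\<lambda>n. sqn (\<lambda>t. g t - s n t) x) \<longlonglongrightarrow> 0" "(\<lambda>n. sqn (s n) x) \<longlonglongrightarrow> sqn g x"
proof -
  note [measurable] = approximatesD(2)[OF s]
  \<comment> \<open>The dominating function is \<open>3 * g\<close>, since |g - s n| <= |g| + 2
    |g|.\<close>
  have fin3: "sqn (\<lambda>t. 3 * g t) x < \<infinity>"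
    using fin by (simp add: sqn_cmult ennreal_mult_less_top)
  have b: "cmod (g t - s n t) \<le> cmod (3 * g t)" for n t
    using norm_triangle_ineq4[of "g t" "s n t"] approximatesD(4)[OF s, of n t] by (simp add: norm_mult)
  have "(\<lambda>n. sqn (\<lambda>t. g t - s n t) x) \<longlonglongrightarrow> sqn (\<lambda>t. g t - g t) x"
  proof (rule sqn_dominated[OF _ _ fin3 b])
    show "(\<lambda>n. g t - s n t) \<longlonglongrightarrow> g t - g t" for t
      by (rule tendsto_diff[OF tendsto_const approximatesD(3)[OF s]])
  qed measurable
  then show "(\<lambda>n. sqn (\<lambda>t. g t - s n t) x) \<longlonglongrightarrow> 0" by (simp add: sqn_def)
  show "(\<lambda>n. sqn (s n) x) \<longlonglongrightarrow> sqn g x"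
  proof (rule sqn_dominated[OF _ _ fin3])
    show "cmod (s n t) \<le> cmod (3 * g t)" for n t
      using approximatesD(4)[OF s, of n t] norm_ge_zero[of "g t"] norm_mult[of 3 "g t"]
      unfolding norm_numeral by linarith
  qed (auto intro!: approximatesD(3)[OF s])
qed

lemma sqn_simple_diff_le:
  assumes [measurable]: "g \<in> borel_measurable borel" and r: "simple_function borel r" and s: "simple_function borel s"
  shows "ennreal ((norm (SI r x - SI s x))\<^sup>2) \<le> 2 * sqn (\<lambda>t. g t - r t) x + 2 * sqn (\<lambda>t. g t - s t) x"
proof -
  note [measurable] = borel_measurable_mu_simple[OF r] borel_measurable_mu_simple[OF s]
  have "simple_function borel (\<lambda>t. r t - s t)" using r s by (rule simple_function_compose2)
  then have "ennreal ((norm (SI r x - SI s x))\<^sup>2) = sqn (\<lambda>t. r t - s t) x"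
    by (simp add: sqn_SI SI_diff[OF r s])
  also have "\<dots> = sqn (\<lambda>t. - 1 * (g t - r t) + (g t - s t)) x" by simp
  also have "\<dots> \<le> 2 * sqn (\<lambda>t. - 1 * (g t - r t)) x + 2 * sqn (\<lambda>t. g t - s t) x"
    by (rule sqn_add_le) auto
  also have "\<dots> = 2 * sqn (\<lambda>t. g t - r t) x + 2 * sqn (\<lambda>t. g t - s t) x"
    by (subst sqn_cmult) auto
  finally show ?thesis .
qed

lemma SI_diff_tendsto_zero:
  assumes g: "g \<in> borel_measurable borel"
    and r: "\<And>n. simple_function borel (r n)" "(\<lambda>n. sqn (\<lambda>t. g t - r n t) x) \<longlonglongrightarrow> 0"
    and s: "\<And>n. simple_function borel (s n)" "(\<lambda>n. sqn (\<lambda>t. g t - s n t) x) \<longlonglongrightarrow> 0"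
  shows "(\<lambda>n. SI (r n) x - SI (s n) x) \<longlonglongrightarrow> 0"
proof -
  have lim: "(\<lambda>n. 2 * sqn (\<lambda>t. g t - r n t) x + 2 * sqn (\<lambda>t. g t - s n t) x) \<longlonglongrightarrow> 2 * 0 + 2 * 0"
    using r(2) s(2) by (intro tendsto_add ennreal_tendsto_cmult) auto
  have "(\<lambda>n. ennreal ((norm (SI (r n) x - SI (s n) x))\<^sup>2)) \<longlonglongrightarrow> 0"
  proof (rule tendsto_sandwich[OF _ _ tendsto_const])
    show "(\<lambda>n. 2 * sqn (\<lambda>t. g t - r n t) x + 2 * sqn (\<lambda>t. g t - s n t) x) \<longlonglongrightarrow> 0"
      using lim by simp
    show "\<forall>\<^sub>F n in sequentially. ennreal ((norm (SI (r n) x - SI (s n) x))\<^sup>2)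
        \<le> 2 * sqn (\<lambda>t. g t - r n t) x + 2 * sqn (\<lambda>t. g t - s n t) x"
      by (intro always_eventually allI sqn_simple_diff_le[OF g r(1) s(1)])
  qed simp
  then have "(\<lambda>n. (norm (SI (r n) x - SI (s n) x))\<^sup>2) \<longlonglongrightarrow> 0"
    by (subst (asm) ennreal_tendsto_0_iff) auto
  then show ?thesis by (simp add: tendsto_norm_zero_iff)
qed

text \<open>Two sequences of simple functions with the same L^2 limit have integrals with difference
  tending to zero, so the existential sequence may be replaced by any fixed approximating
  one.\<close>

lemma mem_SP_iff_approximates:
  assumes g: "g \<in> borel_measurable borel" and s: "approximates s g"
  shows "(x, y) \<in> SP g \<longleftrightarrow> sqn g x < \<infinity> \<and> (\<lambda>n. SI (s n) x) \<longlonglongrightarrow> y"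
proof
  assume "(x, y) \<in> SP g"
  then obtain r where fin: "sqn g x < \<infinity>" and r: "\<And>n. simple_function borel (r n)"
      "(\<lambda>n. sqn (\<lambda>t. g t - r n t) x) \<longlonglongrightarrow> 0" "(\<lambda>n. SI (r n) x) \<longlonglongrightarrow> y"
    by (auto simp: mem_SP)
  have "(\<lambda>n. SI (s n) x - SI (r n) x) \<longlonglongrightarrow> 0"
    by (intro SI_diff_tendsto_zero[OF g] approximatesD[OF s] approximates_sqn[OF g fin s] r)
  from tendsto_add[OF this r(3)] fin show "sqn g x < \<infinity> \<and> (\<lambda>n. SI (s n) x) \<longlonglongrightarrow> y" by simp
next
  assume "sqn g x < \<infinity> \<and> (\<lambda>n. SI (s n) x) \<longlonglongrightarrow> y"
  then show "(x, y) \<in> SP g"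
    using approximates_sqn[OF g _ s] approximatesD[OF s] by (auto simp: mem_SP)
qed

lemma SP_exists:
  assumes g: "g \<in> borel_measurable borel" and fin: "sqn g x < \<infinity>"
  obtains y where "(x, y) \<in> SP g"
proof -
  obtain s where s: "approximates s g" using approximates_exists[OF g] .
  have "Cauchy (\<lambda>n. SI (s n) x)"
  proof (rule metric_CauchyI)
    fix e :: real assume "e > 0"
    \<comment> \<open>The quarter compensates the factor 2 in each of the two terms of
      \<open>sqn_simple_diff_le\<close>.\<close>
    have "\<forall>\<^sub>F n in sequentially. sqn (\<lambda>t. g t - s n t) x < ennreal (e\<^sup>2 / 4)"
      using \<open>e > 0\<close> by (intro order_tendstoD(2)[OF approximates_sqn(1)[OF g fin s]]) auto
    then obtain N where N: "\<And>n. n \<ge> N \<Longrightarrow> sqn (\<lambda>t. g t - s n t) x < ennreal (e\<^sup>2 / 4)"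
      by (auto simp: eventually_sequentially)
    have "dist (SI (s m) x) (SI (s n) x) < e" if "m \<ge> N" "n \<ge> N" for m n
    proof -
      have "ennreal ((norm (SI (s m) x - SI (s n) x))\<^sup>2)
          \<le> 2 * sqn (\<lambda>t. g t - s m t) x + 2 * sqn (\<lambda>t. g t - s n t) x"
        by (intro sqn_simple_diff_le g approximatesD[OF s])
      also have "\<dots> < 2 * ennreal (e\<^sup>2 / 4) + 2 * ennreal (e\<^sup>2 / 4)"
        using N[OF that(1)] N[OF that(2)] by (intro add_strict_mono ennreal_mult_strict_left_mono) auto
      also have "\<dots> = ennreal (2 * (e\<^sup>2 / 4) + 2 * (e\<^sup>2 / 4))"
        by (simp only: ennreal_plus ennreal_mult ennreal_numeral zero_le_power2 zero_le_numeral
          divide_nonneg_nonneg mult_nonneg_nonneg)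
      also have "2 * (e\<^sup>2 / 4) + 2 * (e\<^sup>2 / 4) = e\<^sup>2" by simp
      finally have "(norm (SI (s m) x - SI (s n) x))\<^sup>2 < e\<^sup>2" by (simp add: ennreal_less_iff)
      then show ?thesis using \<open>e > 0\<close> by (simp add: dist_norm power_less_imp_less_base)
    qed
    then show "\<exists>N. \<forall>m\<ge>N. \<forall>n\<ge>N. dist (SI (s m) x) (SI (s n) x) < e" by blast
  qed
  then obtain y where "(\<lambda>n. SI (s n) x) \<longlonglongrightarrow> y" by (auto simp: Cauchy_convergent_iff convergent_def)
  then show ?thesis using that fin by (simp add: mem_SP_iff_approximates[OF g s])
qed

context
  fixes g :: "real \<Rightarrow> complex"
  assumes g [measurable]: "g \<in> borel_measurable borel"
begin

lemma SP_unique: "(x, y) \<in> SP g \<Longrightarrow> (x, z) \<in> SP g \<Longrightarrow> y = z"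
proof -
  obtain s where s: "approximates s g" using approximates_exists[OF g] .
  show "(x, y) \<in> SP g \<Longrightarrow> (x, z) \<in> SP g \<Longrightarrow> y = z"
    by (auto simp: mem_SP_iff_approximates[OF g s] intro: LIMSEQ_unique)
qed

lemma SP_norm:
  assumes "(x, y) \<in> SP g"
  shows "sqn g x = ennreal ((norm y)\<^sup>2)"
proof -
  obtain s where s: "approximates s g" using approximates_exists[OF g] .
  have fin: "sqn g x < \<infinity>" and lim: "(\<lambda>n. SI (s n) x) \<longlonglongrightarrow> y"
    using assms by (auto simp: mem_SP_iff_approximates[OF g s])
  have "(\<lambda>n. sqn (s n) x) \<longlonglongrightarrow> ennreal ((norm y)\<^sup>2)"
    using approximatesD(1)[OF s] by (simp add: sqn_SI) (intro tendsto_intros lim)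
  then show ?thesis using approximates_sqn(2)[OF g fin s] LIMSEQ_unique by blast
qed

lemma SP_add_vector:
  assumes "(x, y) \<in> SP g" "(x', y') \<in> SP g"
  shows "(x + x', y + y') \<in> SP g"
proof -
  obtain s where s: "approximates s g" using approximates_exists[OF g] .
  have *: "sqn g x < \<infinity>" "(\<lambda>n. SI (s n) x) \<longlonglongrightarrow> y" "sqn g x' < \<infinity>" "(\<lambda>n. SI (s n) x') \<longlonglongrightarrow> y'"
    using assms by (auto simp: mem_SP_iff_approximates[OF g s])
  have "sqn g (x + x') \<le> 2 * sqn g x + 2 * sqn g x'" unfolding sqn_def by (rule nn_integral_mu_add_le)
  also have "\<dots> < \<infinity>" using * by (simp add: ennreal_mult_less_top)
  finally have "sqn g (x + x') < \<infinity>" .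
  moreover have "(\<lambda>n. SI (s n) (x + x')) \<longlonglongrightarrow> y + y'"
    using approximatesD(1)[OF s] by (simp add: SI_add_vector) (intro tendsto_intros *)
  ultimately show ?thesis by (simp add: mem_SP_iff_approximates[OF g s])
qed

text \<open>Since \<open>R\<close> passes through each projection, ||E A (R x)|| <= ||R|| ||E A x||,
  so \<open>R\<close> preserves the domain; on simple functions the commutation is exact and
  survives the limit. Affiliation and the range of the calculus both rest on this.\<close>

lemma SP_commute:
  assumes xy: "(x, y) \<in> SP g" and R: "R \<in> BH"
    and comm: "\<And>A y. A \<in> sets borel \<Longrightarrow> R (E A y) = E A (R y)"
  shows "(R x, R y) \<in> SP g"
proof -
  obtain s where s: "approximates s g" using approximates_exists[OF g] .
  have *: "sqn g x < \<infinity>" "(\<lambda>n. SI (s n) x) \<longlonglongrightarrow> y"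
    using xy by (auto simp: mem_SP_iff_approximates[OF g s])
  have "sqn g (R x) \<le> ennreal ((norm R)\<^sup>2) * sqn g x"
    unfolding sqn_def by (rule nn_integral_mu_apply_le) (simp add: norm_blinfun flip: comm)
  also have "\<dots> < \<infinity>" using * by (simp add: ennreal_mult_less_top)
  finally have "sqn g (R x) < \<infinity>" .
  moreover have "(\<lambda>n. SI (s n) (R x)) \<longlonglongrightarrow> R y"
    using approximatesD(1)[OF s] by (simp add: SI_commute[OF _ R comm]) (intro blinfun.tendsto tendsto_const *)
  ultimately show ?thesis by (simp add: mem_SP_iff_approximates[OF g s])
qed

lemma SP_scaleC_vector: "(x, y) \<in> SP g \<Longrightarrow> (c *\<^sub>C x, c *\<^sub>C y) \<in> SP g"
  using SP_commute[of x y "scale_bop c id_blinfun"]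
  by (simp add: BH_scale_bop blinfun_scale_bop BH_scaleC[OF projectionD(2)[OF projection]])

lemma linear_op_SP: "linear_op (SP g)"
proof -
  have "sqn g 0 < \<infinity>"
    using nn_integral_mu_apply_le[of 0 0 0 "\<lambda>t. ennreal ((cmod (g t))\<^sup>2)"] by (simp add: sqn_def)
  then obtain y where "(0, y) \<in> SP g" using SP_exists[OF g] by blast
  then have "(0, 0) \<in> SP g" using SP_scaleC_vector[of 0 y 0] by simp
  then show ?thesis
    unfolding linear_op_def single_valued_def
  proof (intro conjI allI impI ballI; (clarify)?)
    show "y = z" if "(x, y) \<in> SP g" "(x, z) \<in> SP g" for x y z using that by (rule SP_unique)
    show "(x + x', y + y') \<in> SP g" if "(x, y) \<in> SP g" "(x', y') \<in> SP g" for x y x' y'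
      using that by (rule SP_add_vector)
    show "(c *\<^sub>C x, c *\<^sub>C y) \<in> SP g" if "(x, y) \<in> SP g" for x y c
      using that by (rule SP_scaleC_vector)
  qed
qed

lemma SP_mult_simple:
  assumes xy: "(x, y) \<in> SP g" and r: "simple_function borel r"
  shows "(x, SI r y) \<in> SP (\<lambda>t. r t * g t)"
proof -
  note [measurable] = borel_measurable_mu_simple[OF r]
  obtain s where s: "approximates s g" using approximates_exists[OF g] .
  note [measurable] = approximatesD(2)[OF s]
  have fin: "sqn g x < \<infinity>" and lim: "(\<lambda>n. SI (s n) x) \<longlonglongrightarrow> y"
    using xy by (auto simp: mem_SP_iff_approximates[OF g s])
  obtain K where K: "\<And>t. cmod (r t) \<le> K"
    using finite_imp_bounded[OF finite_range_simple[OF r]] by (auto simp: bounded_iff)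
  then have K0: "0 \<le> K" using norm_ge_zero order_trans by blast
  have le: "sqn (\<lambda>t. r t * f t) x \<le> ennreal (K\<^sup>2) * sqn f x"
    if [measurable]: "f \<in> borel_measurable borel" for f
  proof -
    have "sqn (\<lambda>t. r t * f t) x \<le> sqn (\<lambda>t. of_real K * f t) x"
      using K K0 by (intro sqn_mono) (simp add: norm_mult mult_right_mono)
    then show ?thesis using K0 by (simp add: sqn_cmult)
  qed
  have "sqn (\<lambda>t. r t * g t) x < \<infinity>"
    using le_less_trans[OF le[OF g]] fin by (simp add: ennreal_mult_less_top)
  moreover have "simple_function borel (\<lambda>t. r t * s n t)" for n
    using r approximatesD(1)[OF s] by (rule simple_function_compose2)
  moreover have "(\<lambda>n. sqn (\<lambda>t. r t * g t - r t * s n t) x) \<longlonglongrightarrow> 0"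
  proof (rule tendsto_sandwich[OF _ _ tendsto_const])
    show "\<forall>\<^sub>F n in sequentially. sqn (\<lambda>t. r t * g t - r t * s n t) x
        \<le> ennreal (K\<^sup>2) * sqn (\<lambda>t. g t - s n t) x"
      using le[of "\<lambda>t. g t - s n t" for n] by (intro always_eventually) (simp add: right_diff_distrib)
    show "(\<lambda>n. ennreal (K\<^sup>2) * sqn (\<lambda>t. g t - s n t) x) \<longlonglongrightarrow> 0"
      using ennreal_tendsto_cmult[OF _ approximates_sqn(1)[OF g fin s], of "ennreal (K\<^sup>2)"] by simp
  qed simp
  moreover have "(\<lambda>n. SI (\<lambda>t. r t * s n t) x) \<longlonglongrightarrow> SI r y"
    using continuous_on_tendsto_compose[OF SI_continuous[OF r] lim]
    by (simp add: SI_mult[OF r approximatesD(1)[OF s]])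
  ultimately show ?thesis unfolding mem_SP by (intro conjI exI[of _ "\<lambda>n t. r t * s n t"]) auto
qed

lemma SP_restrict: "(x, y) \<in> SP g \<Longrightarrow> A \<in> sets borel \<Longrightarrow> (x, E A y) \<in> SP (\<lambda>t. indicator A t * g t)"
  using SP_mult_simple[of x y "indicator A"] SI_indicator[of A y] by simp

end

text \<open>The sum of approximants for \<open>g\<close> and \<open>h\<close> need not be dominated
  by 2 |g + h|, so L^2 convergence is checked directly against the definition of the
  integral.\<close>

lemma SP_add:
  assumes g [measurable]: "g \<in> borel_measurable borel" and h [measurable]: "h \<in> borel_measurable borel"
    and xy: "(x, y) \<in> SP g" and xz: "(x, z) \<in> SP h"
  shows "(x, y + z) \<in> SP (\<lambda>t. g t + h t)"
proof -
  obtain r s where r: "approximates r g" and s: "approximates s h"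
    using approximates_exists[OF g] approximates_exists[OF h] by metis
  note [measurable] = approximatesD(2)[OF r] approximatesD(2)[OF s]
  have *: "sqn g x < \<infinity>" "(\<lambda>n. SI (r n) x) \<longlonglongrightarrow> y" "sqn h x < \<infinity>" "(\<lambda>n. SI (s n) x) \<longlonglongrightarrow> z"
    using xy xz by (auto simp: mem_SP_iff_approximates[OF g r] mem_SP_iff_approximates[OF h s])
  have "sqn (\<lambda>t. g t + h t) x < \<infinity>"
    using le_less_trans[OF sqn_add_le[OF g h]] * by (simp add: ennreal_mult_less_top)
  moreover have "simple_function borel (\<lambda>t. r n t + s n t)" for n
    using approximatesD(1)[OF r] approximatesD(1)[OF s] by (rule simple_function_compose2)
  moreover have "(\<lambda>n. sqn (\<lambda>t. g t + h t - (r n t + s n t)) x) \<longlonglongrightarrow> 0"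
  proof (rule tendsto_sandwich[OF _ _ tendsto_const])
    have "sqn (\<lambda>t. (g t - r n t) + (h t - s n t)) x
        \<le> 2 * sqn (\<lambda>t. g t - r n t) x + 2 * sqn (\<lambda>t. h t - s n t) x" for n
      by (rule sqn_add_le) auto
    then show "\<forall>\<^sub>F n in sequentially. sqn (\<lambda>t. g t + h t - (r n t + s n t)) x
        \<le> 2 * sqn (\<lambda>t. g t - r n t) x + 2 * sqn (\<lambda>t. h t - s n t) x"
      by (intro always_eventually) (simp add: algebra_simps)
    have "(\<lambda>n. 2 * sqn (\<lambda>t. g t - r n t) x + 2 * sqn (\<lambda>t. h t - s n t) x) \<longlonglongrightarrow> 2 * 0 + 2 * 0"
      by (intro tendsto_add ennreal_tendsto_cmult approximates_sqn(1)[OF g *(1) r] approximates_sqn(1)[OF h *(3) s]) auto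
    then show "(\<lambda>n. 2 * sqn (\<lambda>t. g t - r n t) x + 2 * sqn (\<lambda>t. h t - s n t) x) \<longlonglongrightarrow> 0" by simp
  qed simp
  moreover have "(\<lambda>n. SI (\<lambda>t. r n t + s n t) x) \<longlonglongrightarrow> y + z"
    by (simp add: SI_add[OF approximatesD(1)[OF r] approximatesD(1)[OF s]]) (intro tendsto_intros *)
  ultimately show ?thesis unfolding mem_SP by (intro conjI exI[of _ "\<lambda>n t. r n t + s n t"]) auto
qed

lemma SP_simple:
  assumes "simple_function borel s"
  shows "(x, SI s x) \<in> SP s"
  unfolding mem_SP using assms sqn_SI[OF assms, of x]
  by (intro conjI exI[of _ "\<lambda>_. s"]) (auto simp: sqn_def)

lemma SP_cmult:
  assumes "g \<in> borel_measurable borel" "(x, y) \<in> SP g"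
  shows "(x, c *\<^sub>C y) \<in> SP (\<lambda>t. c * g t)"
proof -
  have "SI (\<lambda>_. c) y = c *\<^sub>C y" by (simp add: simple_spectral_integral_def)
  then show ?thesis using SP_mult_simple[OF assms, of "\<lambda>_. c"] by simp
qed

text \<open>Let \<open>w\<close> be the value of the integral of the product at \<open>x\<close>.
  For simple approximants \<open>r n\<close> of \<open>h\<close> the product rule is known, and
  \<open>SI (r n) y\<close> converges both to \<open>w\<close>, by dominated convergence, and to
  \<open>z\<close>, by definition.\<close>

lemma SP_mult:
  assumes g [measurable]: "g \<in> borel_measurable borel" and h [measurable]: "h \<in> borel_measurable borel"
    and K: "\<And>t. cmod (h t) \<le> K" and xy: "(x, y) \<in> SP g" and yz: "(y, z) \<in> SP h"
  shows "(x, z) \<in> SP (\<lambda>t. h t * g t)"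
proof -
  obtain r where r: "approximates r h" using approximates_exists[OF h] .
  note [measurable] = approximatesD(2)[OF r]
  have fin: "sqn g x < \<infinity>" using xy by (simp add: mem_SP)
  have lim: "(\<lambda>n. SI (r n) y) \<longlonglongrightarrow> z" using yz by (simp add: mem_SP_iff_approximates[OF h r])
  have K0: "0 \<le> K" by (rule order_trans[OF norm_ge_zero K])
  \<comment> \<open>From |h - r n| <= |h| + 2 |h| <= 3 K.\<close>
  have finK: "sqn (\<lambda>t. of_real (3 * K) * g t) x < \<infinity>"
    using fin by (simp add: sqn_cmult[OF g] ennreal_mult_less_top del: of_real_mult)
  have b: "cmod (h t * g t) \<le> cmod (of_real (3 * K) * g t)" for t
    using K[of t] K0 by (simp add: norm_mult) (intro mult_right_mono; simp)
  obtain w where w: "(x, w) \<in> SP (\<lambda>t. h t * g t)"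
    using SP_exists[of "\<lambda>t. h t * g t" x] le_less_trans[OF sqn_mono[OF b] finK] by auto
  have diff: "(x, w - SI (r n) y) \<in> SP (\<lambda>t. h t * g t + (-1) * (r n t * g t))" for n
    using SP_add[OF _ _ w SP_cmult[OF _ SP_mult_simple[OF g xy approximatesD(1)[OF r, of n]], of "-1"]]
    by simp
  have "(\<lambda>n. sqn (\<lambda>t. h t * g t + (-1) * (r n t * g t)) x) \<longlonglongrightarrow> sqn (\<lambda>t. h t * g t + (-1) * (h t * g t)) x"
  proof (rule sqn_dominated[OF _ _ finK])
    fix n t
    have "cmod (h t - r n t) \<le> 3 * K"
      using norm_triangle_ineq4[of "h t" "r n t"] approximatesD(4)[OF r, of n t] K[of t] by linarith
    then show "cmod (h t * g t + (-1) * (r n t * g t)) \<le> cmod (of_real (3 * K) * g t)"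
      using K0 by (simp add: norm_mult mult_right_mono flip: left_diff_distrib)
    show "(\<lambda>n. h t * g t + (-1) * (r n t * g t)) \<longlonglongrightarrow> h t * g t + (-1) * (h t * g t)"
      by (intro tendsto_intros approximatesD(3)[OF r])
  qed measurable
  then have "(\<lambda>n. ennreal ((norm (w - SI (r n) y))\<^sup>2)) \<longlonglongrightarrow> 0"
    using SP_norm[OF _ diff] by (simp add: sqn_def)
  then have "(\<lambda>n. (norm (w - SI (r n) y))\<^sup>2) \<longlonglongrightarrow> 0"
    by (subst (asm) ennreal_tendsto_0_iff) auto
  then have "(\<lambda>n. w - SI (r n) y) \<longlonglongrightarrow> 0" by (simp add: tendsto_norm_zero_iff)
  moreover have "(\<lambda>n. w - SI (r n) y) \<longlonglongrightarrow> w - z" by (intro tendsto_intros lim)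
  ultimately have "w = z" using LIMSEQ_unique by fastforce
  then show ?thesis using w by simp
qed

text \<open>Conjugating approximants of \<open>g\<close> gives approximants of its conjugate, so the
  identity for simple functions passes to the limit.\<close>

lemma SP_adjoint:
  assumes g [measurable]: "g \<in> borel_measurable borel"
    and xy: "(x, y) \<in> SP g" and uv: "(u, v) \<in> SP (\<lambda>t. cnj (g t))"
  shows "cinner u y = cinner v x"
proof -
  obtain s where s: "approximates s g" using approximates_exists[OF g] .
  have s': "approximates (\<lambda>n t. cnj (s n t)) (\<lambda>t. cnj (g t))"
    using approximatesD[OF s] simple_function_compose[OF approximatesD(1)[OF s], of cnj]
    by (auto simp: approximates_def comp_def intro!: tendsto_cnj)
  have lim: "(\<lambda>n. SI (s n) x) \<longlonglongrightarrow> y" using xy by (simp add: mem_SP_iff_approximates[OF g s])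
  have lim': "(\<lambda>n. SI (\<lambda>t. cnj (s n t)) u) \<longlonglongrightarrow> v" using uv by (subst (asm) mem_SP_iff_approximates[OF borel_measurable_cnj[OF g] s']) auto
  have "(\<lambda>n. cinner u (SI (s n) x)) \<longlonglongrightarrow> cinner u y" by (intro tendsto_intros lim)
  moreover have "(\<lambda>n. cinner u (SI (s n) x)) \<longlonglongrightarrow> cinner v x"
    unfolding SI_adjoint[OF approximatesD(1)[OF s]] by (intro tendsto_intros lim')
  ultimately show ?thesis by (rule LIMSEQ_unique)
qed

lemma SP_bounded:
  assumes g [measurable]: "g \<in> borel_measurable borel" and K: "\<And>t. cmod (g t) \<le> K"
  obtains G where "G \<in> BH" "op_of G = SP g" "norm G \<le> K"
proof -
  have K0: "0 \<le> K" by (rule order_trans[OF norm_ge_zero K])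
  have bound: "sqn g x \<le> ennreal ((K * norm x)\<^sup>2)" for x by (rule sqn_bounded) (simp add: K)
  then have "sqn g x < \<infinity>" for x by (rule le_less_trans) simp
  then have "\<exists>y. (x, y) \<in> SP g" for x using SP_exists[OF g] by blast
  then obtain f where f: "\<And>x. (x, f x) \<in> SP g" by metis
  have f': "(x, y) \<in> SP g \<longleftrightarrow> y = f x" for x y using SP_unique[OF g f] f by blast
  have le: "norm (f x) \<le> K * norm x" for x
  proof (rule power2_le_imp_le)
    show "(norm (f x))\<^sup>2 \<le> (K * norm x)\<^sup>2"
      using bound[of x] SP_norm[OF g f[of x]] by (simp add: ennreal_le_iff)
  qed (use K0 in simp)
  obtain G where G: "G \<in> BH" "blinfun_apply G = f"
  proof (rule BH_of_linear)
    show "f (x + y) = f x + f y" for x y using SP_add_vector[OF g f f] by (simp add: f')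
    show "f (c *\<^sub>C x) = c *\<^sub>C f x" for c x using SP_scaleC_vector[OF g f] by (simp add: f')
  qed (rule le)
  show ?thesis
  proof (rule that)
    show "op_of G = SP g" by (auto simp: op_of_def G f')
    show "norm G \<le> K" using K0 le by (intro norm_blinfun_bound) (auto simp: G)
  qed (rule G)
qed

text \<open>Closedness: on \<open>A\<^sub>n = {|g| \<le> n}\<close> the integral is bounded, so a limit \<open>(x, y)\<close> of the graph
  satisfies \<open>(x, E(A\<^sub>n) y) \<in> \<integral> g 1\<^bsub>A\<^sub>n\<^esub> dE\<close>; let \<open>n\<close> tend to infinity.\<close>

lemma closed_op_SP:
  assumes g [measurable]: "g \<in> borel_measurable borel"
  shows "closed_op (SP g)"
  unfolding closed_op_def
proof (intro conjI linear_op_SP[OF g])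
  define A where "A n = {t. cmod (g t) \<le> real n}" for n :: nat
  define gn where "gn n = (\<lambda>t. indicator (A n) t * g t)" for n
  have A [measurable]: "A n \<in> sets borel" for n unfolding A_def by measurable
  have gn [measurable]: "gn n \<in> borel_measurable borel" for n unfolding gn_def by measurable
  have incA: "incseq A" by (auto simp: incseq_def A_def)
  have UNA: "(\<Union>n. A n) = UNIV" by (auto simp: A_def real_arch_simple)
  have gn_le: "cmod (gn n t) \<le> real n" for n t by (auto simp: gn_def A_def indicator_def)
  show "closed (SP g)"
    unfolding closed_sequential_limits
  proof (intro allI impI; elim conjE)
    fix p l assume p: "\<forall>k. p k \<in> SP g" "p \<longlonglongrightarrow> l"
    obtain x y where l: "l = (x, y)" by force
    have limx: "(\<lambda>k. fst (p k)) \<longlonglongrightarrow> x" and limy: "(\<lambda>k. snd (p k)) \<longlonglongrightarrow> y"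
      using tendsto_fst[OF p(2)] tendsto_snd[OF p(2)] by (auto simp: l)
    have restr: "(x, E (A n) y) \<in> SP (gn n)" for n
    proof -
      obtain G where G: "op_of G = SP (gn n)" using SP_bounded[OF gn gn_le] by metis
      have "(fst (p k), E (A n) (snd (p k))) \<in> SP (gn n)" for k
        unfolding gn_def using p(1) by (intro SP_restrict[OF g _ A]) simp
      then have "E (A n) (snd (p k)) = G (fst (p k))" for k by (simp flip: G)
      moreover have "(\<lambda>k. E (A n) (snd (p k))) \<longlonglongrightarrow> E (A n) y"
        by (intro blinfun.tendsto tendsto_const limy)
      moreover have "(\<lambda>k. G (fst (p k))) \<longlonglongrightarrow> G x"
        by (intro blinfun.tendsto tendsto_const limx)
      ultimately have "E (A n) y = G x" using LIMSEQ_unique by auto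
      then show ?thesis by (simp flip: G)
    qed
    \<comment> \<open>Monotone convergence over the truncations bounds \<open>sqn g x\<close> by
      ||y||^2, which puts \<open>x\<close> into the domain.\<close>
    have "sqn g x = (\<integral>\<^sup>+t. (SUP n. ennreal ((cmod (gn n t))\<^sup>2)) \<partial>\<mu> x)"
      unfolding sqn_def
    proof (intro nn_integral_cong antisym)
      fix t
      obtain n where "t \<in> A n" using UNA by blast
      then have "gn n t = g t" by (simp add: gn_def)
      then show "ennreal ((cmod (g t))\<^sup>2) \<le> (SUP n. ennreal ((cmod (gn n t))\<^sup>2))"
        using SUP_upper[of n UNIV "\<lambda>n. ennreal ((cmod (gn n t))\<^sup>2)"] by simp
      show "(SUP n. ennreal ((cmod (gn n t))\<^sup>2)) \<le> ennreal ((cmod (g t))\<^sup>2)"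
        by (intro SUP_least ennreal_leI power_mono) (auto simp: gn_def indicator_def)
    qed
    also have "\<dots> = (SUP n. sqn (gn n) x)"
      unfolding sqn_def
    proof (rule nn_integral_monotone_convergence_SUP)
      show "incseq (\<lambda>n t. ennreal ((cmod (gn n t))\<^sup>2))"
        unfolding incseq_def le_fun_def
        by (auto simp: gn_def indicator_def A_def intro!: ennreal_leI)
    qed measurable
    also have "\<dots> \<le> ennreal ((norm y)\<^sup>2)"
    proof (rule SUP_least)
      fix n
      show "sqn (gn n) x \<le> ennreal ((norm y)\<^sup>2)"
        unfolding SP_norm[OF gn restr]
        by (intro ennreal_leI power_mono norm_projection_le projection) auto
    qed
    finally have "sqn g x < \<infinity>" by (rule le_less_trans) simp
    then obtain y' where y': "(x, y') \<in> SP g" using SP_exists[OF g] by blast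
    \<comment> \<open>The value \<open>y'\<close> at \<open>x\<close> and the limit \<open>y\<close>
      agree on every \<open>A n\<close>; as these sets exhaust the line, the scalar measure of
      \<open>y - y'\<close> vanishes.\<close>
    have "E (A n) (y - y') = 0" for n
      using SP_unique[OF gn restr SP_restrict[OF g y' A, folded gn_def]] by (simp add: blinfun.diff_right)
    then have "emeasure (\<mu> (y - y')) (A n) = 0" for n by (simp add: emeasure_mu)
    then have "emeasure (\<mu> (y - y')) (\<Union>n. A n) = 0"
      by (intro emeasure_UN_eq_0) auto
    then have "norm (y - y') = 0" unfolding UNA by (simp add: emeasure_mu)
    then show "l \<in> SP g" using y' l by simp
  qed
qed

end

section \<open>The spectral theorem for bounded self-adjoint operators\<close>

text \<open>\<open>P\<close> is the projection onto the kernel of \<open>A\<^sup>+ = (|A| + A) / 2\<close>, and \<open>1 - P\<close> kills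
  the range of \<open>A\<^sup>- = (|A| - A) / 2\<close> because \<open>A\<^sup>+ A\<^sup>- = 0\<close>.\<close>

lemma spectral_projection_exists:
  fixes A :: "'h::chilbert_space \<Rightarrow>\<^sub>L 'h"
  assumes A: "selfadjoint A"
  shows "\<exists>P. projection P \<and> (\<forall>Q\<in>BH. A o\<^sub>L Q = Q o\<^sub>L A \<longrightarrow> P o\<^sub>L Q = Q o\<^sub>L P)
    \<and> (\<forall>x. P x = x \<longrightarrow> Re (cinner x (A x)) \<le> 0) \<and> (\<forall>x. P x = 0 \<longrightarrow> 0 \<le> Re (cinner x (A x)))
    \<and> (\<forall>x. A x = 0 \<longrightarrow> P x = x)"
proof -
  have pos_sq: "positive_bounded (A o\<^sub>L A)"
    unfolding positive_bounded_def using A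
    by (auto intro!: selfadjoint_compose simp: cinner_selfadjoint_square)
  define B where "B = bsqrt (A o\<^sub>L A)"
  have B: "positive_bounded B" "B o\<^sub>L B = A o\<^sub>L A" unfolding B_def by (rule bsqrt[OF pos_sq])+
  then have saB: "selfadjoint B" by (simp add: positive_bounded_def)
  have B_comm: "B o\<^sub>L Q = Q o\<^sub>L B" if "A o\<^sub>L Q = Q o\<^sub>L A" for Q
  proof -
    have "(A o\<^sub>L A) o\<^sub>L Q = Q o\<^sub>L (A o\<^sub>L A)"
      by (metis blinfun_compose_assoc' that)
    then show ?thesis unfolding B_def by (rule bsqrt_commute[OF pos_sq])
  qed
  have BA: "B (A x) = A (B x)" for x
    using B_comm[of A] by (metis blinfun_apply_blinfun_compose)
  have BB: "B (B x) = A (A x)" for x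
    using B(2) by (metis blinfun_apply_blinfun_compose)
  define M where "M = {x. B x + A x = 0}"
  have hom: "B (c *\<^sub>C x) = c *\<^sub>C B x" "A (c *\<^sub>C x) = c *\<^sub>C A x" for c x
    using A saB by (auto intro!: BH_scaleC selfadjointD)
  have "complex_subspace M"
    unfolding complex_subspace_def M_def
  proof (intro conjI ballI allI; simp add: blinfun.add_right hom flip: scaleC_add_right)
    fix x y assume *: "B x + A x = 0" "B y + A y = 0"
    have "B x + B y + (A x + A y) = (B x + A x) + (B y + A y)" by simp
    then show "B x + B y + (A x + A y) = 0" using * by simp
  qed
  moreover have "closed M"
    unfolding M_def by (intro closed_Collect_eq continuous_intros)
  ultimately obtain P where P: "projection P" "\<And>x. P x = x \<longleftrightarrow> x \<in> M" "\<And>x. P x \<in> M"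
    using projection_onto by blast
  have invariant: "P (Q (P x)) = Q (P x)" if "A o\<^sub>L Q = Q o\<^sub>L A" for Q x
  proof -
    have Q: "A (Q y) = Q (A y)" "B (Q y) = Q (B y)" for y
      using that B_comm[OF that] by (metis blinfun_apply_blinfun_compose)+
    have "Q (B (P x) + A (P x)) = 0" using P(3)[of x] by (simp add: M_def)
    then have "Q (P x) \<in> M" by (simp add: M_def blinfun.add_right Q)
    then show ?thesis by (simp add: P(2))
  qed
  \<comment> \<open>A projection whose range is invariant under \<open>Q\<close> and under
    \<open>adj Q\<close> commutes with \<open>Q\<close>. The adjoint also commutes with
    \<open>A\<close> because \<open>A\<close> is self-adjoint.\<close>
  have commute: "P o\<^sub>L Q = Q o\<^sub>L P" if Q: "Q \<in> BH" "A o\<^sub>L Q = Q o\<^sub>L A" for Q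
  proof (rule blinfun_eqI)
    fix x
    have "A o\<^sub>L adj Q = adj Q o\<^sub>L A"
      using arg_cong[OF Q(2), of adj] A Q(1) by (simp add: adj_compose selfadjointD)
    from invariant[OF this] have inv': "P (adj Q (P y)) = adj Q (P y)" for y .
    have "cinner y (P (Q x)) = cinner y (P (Q (P x)))" for y
    proof -
      have "cinner y (P (Q x)) = cinner (adj Q (P y)) x"
        by (simp add: cinner_adj_left Q projectionD(4)[OF P(1)])
      also have "\<dots> = cinner (P (adj Q (P y))) x" by (simp add: inv')
      also have "\<dots> = cinner y (P (Q (P x)))"
        by (simp add: cinner_adj_left Q projectionD(4)[OF P(1)])
      finally show ?thesis .
    qed
    then have "P (Q x) = P (Q (P x))" by (rule cinner_ext)
    then show "(P o\<^sub>L Q) x = (Q o\<^sub>L P) x" using invariant[OF Q(2)] by simp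
  qed
  have le: "Re (cinner x (A x)) \<le> 0" if "P x = x" for x
  proof -
    have "B x + A x = 0" using that P(2) by (auto simp: M_def)
    then have "A x = - B x" by (simp add: eq_neg_iff_add_eq_0 add.commute)
    then show ?thesis using B(1) by (simp add: positive_bounded_def)
  qed
  have ge: "0 \<le> Re (cinner x (A x))" if "P x = 0" for x
  proof -
    have "cinner v (B x - A x) = 0" for v
    proof -
      have "B v - A v \<in> M" by (simp add: M_def blinfun.diff_right BA BB)
      then have "P (B v - A v) = B v - A v" by (simp add: P(2))
      then have "cinner (B v - A v) x = 0"
        using projectionD(4)[OF P(1), of "B v - A v" x] that by simp
      then show ?thesis
        by (simp add: cinner_simps selfadjointD(2)[OF A] selfadjointD(2)[OF saB])
    qed
    then have "B x = A x" using cinner_self[of "B x - A x"] by simp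
    then show ?thesis using B(1) by (metis positive_bounded_def)
  qed
  \<comment> \<open>Kernel vectors of \<open>A\<close> lie under \<open>P\<close>; applied to
    \<open>S - l\<close>, this convention makes the spectral family right continuous.\<close>
  have fixed: "P x = x" if "A x = 0" for x
  proof -
    have "(norm (B x))\<^sup>2 = 0" using cinner_selfadjoint_square[OF saB, of x] by (simp add: BB that)
    then show ?thesis by (simp add: P(2) M_def that)
  qed
  show ?thesis using P(1) commute le ge fixed by (intro exI[of _ P]) auto
qed

text \<open>By Pythagoras the partial sums are Cauchy because the squared norms are summable.
  \<open>b\<close> is a separate parameter since it will be the measure of a countable
  union.\<close>

lemma orthogonal_projections_sums:
  fixes P :: "nat \<Rightarrow> 'h::chilbert_space \<Rightarrow>\<^sub>L 'h"
  assumes P: "\<And>i. projection (P i)" and orth: "\<And>i j x. i \<noteq> j \<Longrightarrow> P i (P j x) = 0"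
    and bessel: "\<And>x. (\<lambda>i. (norm (P i x))\<^sup>2) sums b x" "\<And>x. b x \<le> (norm x)\<^sup>2"
  shows "\<exists>Q. projection Q \<and> (\<forall>x. (\<lambda>i. P i x) sums Q x) \<and> (\<forall>x. (norm (Q x))\<^sup>2 = b x)"
proof -
  have pyth: "(norm (\<Sum>i\<in>I. P i x))\<^sup>2 = (\<Sum>i\<in>I. (norm (P i x))\<^sup>2)" if "finite I" for I x
    using that
  proof (induction I)
    case (insert j I)
    have "cinner (P j x) (\<Sum>i\<in>I. P i x) = (\<Sum>i\<in>I. cinner x (P j (P i x)))"
      by (simp add: cinner_sum_right projectionD(4)[OF P])
    also have "\<dots> = 0"
    proof (intro sum.neutral ballI)
      fix i assume "i \<in> I"
      then have "j \<noteq> i" using insert by blast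
      then show "cinner x (P j (P i x)) = 0" by (simp add: orth)
    qed
    finally show ?case using insert by (simp add: norm_sq_add)
  qed simp
  have "summable (\<lambda>i. P i x)" for x
    unfolding summable_Cauchy
  proof (intro allI impI)
    fix e :: real assume "e > 0"
    have "summable (\<lambda>i. (norm (P i x))\<^sup>2)" using bessel(1) by (rule sums_summable)
    then obtain N where N: "\<And>m n. m \<ge> N \<Longrightarrow> norm (\<Sum>i=m..<n. (norm (P i x))\<^sup>2) < e\<^sup>2"
      unfolding summable_Cauchy using \<open>e > 0\<close> zero_less_power by blast
    have "norm (\<Sum>i=m..<n. P i x) < e" if "m \<ge> N" for m n
    proof (rule power_less_imp_less_base)
      show "(norm (\<Sum>i=m..<n. P i x))\<^sup>2 < e\<^sup>2" using N[OF that, of n] by (simp add: pyth)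
    qed (use \<open>e > 0\<close> in simp)
    then show "\<exists>N. \<forall>m\<ge>N. \<forall>n. norm (\<Sum>i=m..<n. P i x) < e" by blast
  qed
  then obtain f where f: "\<And>x. (\<lambda>i. P i x) sums f x" unfolding summable_def by metis
  have norm_f: "(norm (f x))\<^sup>2 = b x" for x
  proof (rule LIMSEQ_unique)
    show "(\<lambda>n. (norm (\<Sum>i<n. P i x))\<^sup>2) \<longlonglongrightarrow> (norm (f x))\<^sup>2"
      using f[of x] by (intro tendsto_intros) (simp add: sums_def)
    show "(\<lambda>n. (norm (\<Sum>i<n. P i x))\<^sup>2) \<longlonglongrightarrow> b x"
      using bessel(1)[of x] by (simp add: pyth sums_def)
  qed
  have le: "norm (f x) \<le> norm x" for x
    by (rule power2_le_imp_le) (simp_all add: norm_f bessel)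
  have hom: "f (c *\<^sub>C x) = c *\<^sub>C f x" for c x
  proof (rule sums_unique2)
    show "(\<lambda>i. P i (c *\<^sub>C x)) sums f (c *\<^sub>C x)" by (rule f)
    show "(\<lambda>i. P i (c *\<^sub>C x)) sums (c *\<^sub>C f x)"
      using bounded_linear.sums[OF bounded_bilinear.bounded_linear_right[OF bounded_bilinear_scaleC] f, of c x]
      by (simp add: BH_scaleC[OF projectionD(2)[OF P]])
  qed
  obtain Q where Q: "Q \<in> BH" "blinfun_apply Q = f"
  proof (rule BH_of_linear)
    show "f (x + y) = f x + f y" for x y
      by (rule sums_unique2[OF f[of "x + y"]]) (simp add: blinfun.add_right sums_add f)
    show "norm (f x) \<le> 1 * norm x" for x using le by simp
  qed (rule hom)
  have Pf: "P i (f x) = P i x" for i x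
  proof (rule sums_unique2)
    show "(\<lambda>j. P i (P j x)) sums P i (f x)"
      by (rule bounded_linear.sums[OF blinfun.bounded_linear_right f])
    have "(\<lambda>j. P i (P j x)) = (\<lambda>j. if j = i then P i x else 0)"
      using orth projectionD(3)[OF P] by (auto intro!: ext)
    then show "(\<lambda>j. P i (P j x)) sums P i x" using sums_single[of i "\<lambda>_. P i x"] by simp
  qed
  have "projection Q"
  proof (rule projectionI)
    have "cinner (f x) y = cinner x (f y)" for x y
    proof (rule sums_unique2)
      show "(\<lambda>i. cinner (P i x) y) sums cinner (f x) y"
        by (rule bounded_linear.sums[OF bounded_bilinear.bounded_linear_left[OF bounded_bilinear_cinner] f])
      show "(\<lambda>i. cinner (P i x) y) sums cinner x (f y)"
        unfolding projectionD(4)[OF P]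
        by (rule bounded_linear.sums[OF bounded_bilinear.bounded_linear_right[OF bounded_bilinear_cinner] f])
    qed
    then show "selfadjoint Q" by (simp add: selfadjoint_def Q)
    show "Q (Q x) = Q x" for x
      unfolding Q(2) by (rule sums_unique2[OF f]) (simp only: Pf f)
  qed
  then show ?thesis using f norm_f by (intro exI[of _ Q]) (simp add: Q)
qed

text \<open>Adding \<open>d\<close> times the identity gives a positive operator with form at most
  2d; subtracting it again costs one more \<open>d\<close>.\<close>

lemma selfadjoint_norm_le:
  assumes A: "selfadjoint A" and d: "0 \<le> d" and le: "\<And>x. \<bar>Re (cinner x (A x))\<bar> \<le> d * (norm x)\<^sup>2"
  shows "norm (A x) \<le> 3 * d * norm x"
proof -
  have form: "Re (cinner x ((A + d *\<^sub>R id_blinfun) x)) = Re (cinner x (A x)) + d * (norm x)\<^sup>2" for x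
    by (simp add: blinfun.bilinear_simps cinner_simps norm_sq_cinner)
  have "positive_bounded (A + d *\<^sub>R id_blinfun)"
    unfolding positive_bounded_def form
  proof (intro conjI allI selfadjoint_add selfadjoint_scaleR A selfadjoint_id)
    show "0 \<le> Re (cinner x (A x)) + d * (norm x)\<^sup>2" for x using le[of x] by linarith
  qed
  then have "norm ((A + d *\<^sub>R id_blinfun) x) \<le> (2 * d) * norm x"
  proof (rule positive_norm_le)
    show "Re (cinner x ((A + d *\<^sub>R id_blinfun) x)) \<le> 2 * d * (norm x)\<^sup>2" for x
      unfolding form using le[of x] by linarith
  qed (use d in simp)
  moreover have "norm (A x) \<le> norm ((A + d *\<^sub>R id_blinfun) x) + norm (d *\<^sub>R x)"
    using norm_triangle_ineq4[of "A x + d *\<^sub>R x" "d *\<^sub>R x"] by (simp add: blinfun.bilinear_simps)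
  ultimately show ?thesis using d by simp
qed

lemma grid_cell_exists:
  fixes a :: "nat \<Rightarrow> real"
  assumes "a 0 < t" "t \<le> a n"
  obtains k where "k < n" "a k < t" "t \<le> a (Suc k)"
proof -
  have "\<exists>k<n. a k < t \<and> t \<le> a (Suc k)" using assms(2)
  proof (induction n)
    case 0
    then show ?case using assms(1) by simp
  next
    case (Suc n)
    then show ?case by (cases "t \<le> a n") (use less_Suc_eq in force)+
  qed
  then show ?thesis using that by blast
qed

section \<open>The spectral family of a bounded self-adjoint operator\<close>

locale bounded_selfadjoint =
  fixes S :: "'h::chilbert_space \<Rightarrow>\<^sub>L 'h"
  assumes S: "selfadjoint S"
begin

text \<open>The spectral family: \<open>F l\<close> plays the role of the spectral projection of the
  half line up to and including \<open>l\<close>. The clauses are those of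
  \<open>spectral_projection_exists\<close> for \<open>S - l\<close>.\<close>

definition F :: "real \<Rightarrow> 'h \<Rightarrow>\<^sub>L 'h" where
  "F l = (SOME P. projection P
    \<and> (\<forall>Q\<in>BH. (S - l *\<^sub>R id_blinfun) o\<^sub>L Q = Q o\<^sub>L (S - l *\<^sub>R id_blinfun) \<longrightarrow> P o\<^sub>L Q = Q o\<^sub>L P)
    \<and> (\<forall>x. P x = x \<longrightarrow> Re (cinner x ((S - l *\<^sub>R id_blinfun) x)) \<le> 0)
    \<and> (\<forall>x. P x = 0 \<longrightarrow> 0 \<le> Re (cinner x ((S - l *\<^sub>R id_blinfun) x)))
    \<and> (\<forall>x. (S - l *\<^sub>R id_blinfun) x = 0 \<longrightarrow> P x = x))"

lemma form_shift: "Re (cinner x ((S - l *\<^sub>R id_blinfun) x)) = Re (cinner x (S x)) - l * (norm x)\<^sup>2"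
  by (simp add: blinfun.bilinear_simps cinner_simps norm_sq_cinner)

lemma F:
  shows projection_F: "projection (F l)"
    and F_commute: "Q \<in> BH \<Longrightarrow> S o\<^sub>L Q = Q o\<^sub>L S \<Longrightarrow> F l o\<^sub>L Q = Q o\<^sub>L F l"
    and F_fixed_le: "F l x = x \<Longrightarrow> Re (cinner x (S x)) \<le> l * (norm x)\<^sup>2"
    and F_zero_ge: "F l x = 0 \<Longrightarrow> l * (norm x)\<^sup>2 \<le> Re (cinner x (S x))"
    and F_eigen: "S x = l *\<^sub>R x \<Longrightarrow> F l x = x"
proof -
  have "selfadjoint (S - l *\<^sub>R id_blinfun)"
    using S by (intro selfadjoint_diff selfadjoint_scaleR) auto
  note * = someI_ex[OF spectral_projection_exists[OF this], folded F_def]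
  show "projection (F l)" using * by blast
  show "F l x = x \<Longrightarrow> Re (cinner x (S x)) \<le> l * (norm x)\<^sup>2"
    "F l x = 0 \<Longrightarrow> l * (norm x)\<^sup>2 \<le> Re (cinner x (S x))"
    using * unfolding form_shift by auto
  show "S x = l *\<^sub>R x \<Longrightarrow> F l x = x" using * by (auto simp: blinfun.bilinear_simps)
  show "F l o\<^sub>L Q = Q o\<^sub>L F l" if "Q \<in> BH" "S o\<^sub>L Q = Q o\<^sub>L S"
  proof -
    have "(S - l *\<^sub>R id_blinfun) o\<^sub>L Q = Q o\<^sub>L (S - l *\<^sub>R id_blinfun)"
      using that(2) by (simp add: blinfun_compose_simps)
    then show ?thesis using * that(1) by blast
  qed
qed

lemma F_S: "F l (S x) = S (F l x)"
  using F_commute[of S l] S by (metis selfadjointD(1) blinfun_apply_blinfun_compose)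

text \<open>\<open>F m\<close> commutes with \<open>S\<close>, and \<open>F l\<close> commutes with
  every bounded complex-linear operator that does.\<close>

lemma F_F: "F l (F m x) = F m (F l x)"
proof -
  have "S o\<^sub>L F m = F m o\<^sub>L S" by (intro blinfun_eqI) (simp add: F_S)
  then show ?thesis
    using F_commute[of "F m" l] projectionD(2)[OF projection_F] by (metis blinfun_apply_blinfun_compose)
qed

text \<open>A vector in the range of \<open>F l\<close> and the kernel of \<open>F m\<close> has
  form at most l ||y||^2 and at least m ||y||^2, so it vanishes when l < m.\<close>

lemma F_mono: "l \<le> m \<Longrightarrow> F m (F l x) = F l x"
proof (cases "l = m")
  case False
  assume "l \<le> m"
  define y where "y = F l x - F m (F l x)"
  have "F l y = y"
    by (simp add: y_def blinfun.diff_right projectionD(3)[OF projection_F] F_F[of l m])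
  then have 1: "Re (cinner y (S y)) \<le> l * (norm y)\<^sup>2" by (rule F_fixed_le)
  have "F m y = 0"
    by (simp add: y_def blinfun.diff_right projectionD(3)[OF projection_F])
  then have 2: "m * (norm y)\<^sup>2 \<le> Re (cinner y (S y))" by (rule F_zero_ge)
  have "(m - l) * (norm y)\<^sup>2 \<le> 0" using 1 2 by (simp add: algebra_simps)
  then have "y = 0" using False \<open>l \<le> m\<close> by (simp add: mult_le_0_iff)
  then show ?thesis by (simp add: y_def)
qed (simp add: projectionD(3)[OF projection_F])

lemma F_diff_norm:
  assumes "l \<le> m"
  shows "projection (F m - F l)" "(norm ((F m - F l) x))\<^sup>2 = (norm (F m x))\<^sup>2 - (norm (F l x))\<^sup>2"
proof -
  show P: "projection (F m - F l)"
    using F_mono[OF assms] F_F[of l m]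
    by (intro projectionI selfadjoint_diff projectionD(1)[OF projection_F])
      (simp add: blinfun.bilinear_simps projectionD(3)[OF projection_F])
  show "(norm ((F m - F l) x))\<^sup>2 = (norm (F m x))\<^sup>2 - (norm (F l x))\<^sup>2"
    using cinner_projection[OF P, of x] cinner_projection[OF projection_F, of x]
    by (simp add: blinfun.bilinear_simps cinner_diff_right)
qed

lemma F_below: "l < - norm S \<Longrightarrow> F l = 0"
proof (rule blinfun_eqI)
  fix x assume l: "l < - norm S"
  define y where "y = F l x"
  have "F l y = y" by (simp add: y_def projectionD(3)[OF projection_F])
  then have "Re (cinner y (S y)) \<le> l * (norm y)\<^sup>2" by (rule F_fixed_le)
  then have "(- norm S - l) * (norm y)\<^sup>2 \<le> 0" using Re_cinner_apply_le[of y S] by (simp add: algebra_simps)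
  then show "F l x = blinfun_apply 0 x" using l by (simp add: mult_le_0_iff y_def)
qed

lemma F_above: "norm S < l \<Longrightarrow> F l = id_blinfun"
proof (rule blinfun_eqI)
  fix x assume l: "norm S < l"
  define y where "y = x - F l x"
  have "F l y = 0" by (simp add: y_def blinfun.diff_right projectionD(3)[OF projection_F])
  then have "l * (norm y)\<^sup>2 \<le> Re (cinner y (S y))" by (rule F_zero_ge)
  then have "(l - norm S) * (norm y)\<^sup>2 \<le> 0" using Re_cinner_apply_le[of y S] by (simp add: algebra_simps)
  then show "F l x = id_blinfun x" using l by (simp add: mult_le_0_iff y_def)
qed

text \<open>Decreasing projections converge strongly. The difference \<open>y\<close> of the limit
  and \<open>F l x\<close> is fixed by every \<open>F (l + 1/(n+1))\<close> and killed by
  \<open>F l\<close>, so its form is exactly l ||y||^2. Positivity of \<open>S - l\<close> on the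
  kernel of \<open>F l\<close> then makes \<open>y\<close> an eigenvector, and
  \<open>F_eigen\<close> forces it to be zero.\<close>

lemma F_right_continuous_seq: "(\<lambda>n. F (l + 1 / real (Suc n)) x) \<longlonglongrightarrow> F l x"
proof -
  define G where "G n = F (l + 1 / real (Suc n))" for n
  have dec: "l + 1 / real (Suc n) \<le> l + 1 / real (Suc m)" if "m \<le> n" for m n
    using that by (simp add: frac_le)
  have GG: "G m (G n y) = G n y" if "m \<le> n" for m n y
    unfolding G_def by (rule F_mono[OF dec[OF that]])
  have diff: "(norm (G m x - G n x))\<^sup>2 = (norm (G m x))\<^sup>2 - (norm (G n x))\<^sup>2" if "m \<le> n" for m n
    using F_diff_norm(2)[OF dec[OF that], of x] by (simp add: G_def blinfun.diff_left)
  have "decseq (\<lambda>n. (norm (G n x))\<^sup>2)"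
    unfolding decseq_def
  proof (intro allI impI)
    show "(norm (G n x))\<^sup>2 \<le> (norm (G m x))\<^sup>2" if "m \<le> n" for m n
      using diff[OF that] zero_le_power2[of "norm (G m x - G n x)"] by linarith
  qed
  then have "convergent (\<lambda>n. (norm (G n x))\<^sup>2)"
    by (intro Bseq_monoseq_convergent BseqI'[of _ "(norm x)\<^sup>2"] decseq_imp_monoseq)
      (auto simp: G_def intro!: power_mono norm_projection_le projection_F)
  then have C: "Cauchy (\<lambda>n. (norm (G n x))\<^sup>2)" by (rule convergent_Cauchy)
  have "Cauchy (\<lambda>n. G n x)"
  proof (rule metric_CauchyI)
    fix e :: real assume "e > 0"
    then obtain N where N: "\<And>m n. m \<ge> N \<Longrightarrow> n \<ge> N \<Longrightarrow> \<bar>(norm (G m x))\<^sup>2 - (norm (G n x))\<^sup>2\<bar> < e\<^sup>2"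
      using C unfolding Cauchy_def dist_real_def by (metis zero_less_power)
    have "dist (G m x) (G n x) < e" if "m \<ge> N" "n \<ge> N" for m n
    proof -
      have "(norm (G m x - G n x))\<^sup>2 < e\<^sup>2"
        using N[OF that] diff[of m n] diff[of n m] nat_le_linear[of m n] norm_minus_commute[of "G m x" "G n x"]
        by (auto simp: abs_if split: if_splits)
      then show ?thesis using \<open>e > 0\<close> by (simp add: dist_norm power_less_imp_less_base)
    qed
    then show "\<exists>N. \<forall>m\<ge>N. \<forall>n\<ge>N. dist (G m x) (G n x) < e" by blast
  qed
  then obtain z where z: "(\<lambda>n. G n x) \<longlonglongrightarrow> z" by (auto simp: Cauchy_convergent_iff convergent_def)
  define y where "y = z - F l x"
  have Gy: "G m y = y" for m
  proof -
    have "(\<lambda>n. G m (G (n + m) x)) \<longlonglongrightarrow> G m z"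
      by (intro blinfun.tendsto tendsto_const LIMSEQ_ignore_initial_segment z)
    moreover have "(\<lambda>n. G m (G (n + m) x)) \<longlonglongrightarrow> z"
      by (simp add: GG) (rule LIMSEQ_ignore_initial_segment[OF z])
    ultimately have "G m z = z" by (rule LIMSEQ_unique)
    moreover have "G m (F l x) = F l x" unfolding G_def by (rule F_mono) simp
    ultimately show ?thesis by (simp add: y_def blinfun.diff_right)
  qed
  have Fy: "F l y = 0"
  proof -
    have "(\<lambda>n. F l (G n x)) \<longlonglongrightarrow> F l z" by (intro blinfun.tendsto tendsto_const z)
    moreover have "F l (G n x) = F l x" for n
      unfolding G_def F_F[of l] by (rule F_mono) simp
    ultimately have "F l z = F l x" by (simp add: LIMSEQ_const_iff)
    then show ?thesis by (simp add: y_def blinfun.diff_right projectionD(3)[OF projection_F])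
  qed
  have "Re (cinner y (S y)) \<le> l * (norm y)\<^sup>2"
  proof (rule LIMSEQ_le_const)
    have "(\<lambda>n. l + 1 / real (Suc n)) \<longlonglongrightarrow> l + 0"
      using LIMSEQ_inverse_real_of_nat by (intro tendsto_intros) (simp add: inverse_eq_divide)
    then show "(\<lambda>n. (l + 1 / real (Suc n)) * (norm y)\<^sup>2) \<longlonglongrightarrow> l * (norm y)\<^sup>2"
      by (intro tendsto_intros) simp
    show "\<exists>N. \<forall>n\<ge>N. Re (cinner y (S y)) \<le> (l + 1 / real (Suc n)) * (norm y)\<^sup>2"
      using F_fixed_le Gy unfolding G_def by blast
  qed
  then have form: "Re (cinner y (S y)) = l * (norm y)\<^sup>2" using F_zero_ge[OF Fy] by simp
  define Q where "Q = id_blinfun - F l"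
  have Q: "projection Q" unfolding Q_def by (intro projection_compl projection_F)
  have SQ: "S (Q v) = Q (S v)" for v by (simp add: Q_def blinfun.bilinear_simps F_S)
  have FQ: "F l (Q v) = 0" for v
    by (simp add: Q_def blinfun.bilinear_simps projectionD(3)[OF projection_F])
  \<comment> \<open>Compressing to the kernel of \<open>F l\<close> makes \<open>S - l\<close>
    positive, so a vanishing form at \<open>y\<close> gives \<open>A y = 0\<close>.\<close>
  define A where "A = (S - l *\<^sub>R id_blinfun) o\<^sub>L Q"
  have formA: "Re (cinner v (A v)) = Re (cinner (Q v) (S (Q v))) - l * (norm (Q v))\<^sup>2" for v
    using projectionD(3,4)[OF Q] cinner_projection[OF Q, of v]
    by (simp add: A_def blinfun.bilinear_simps cinner_simps SQ)
  have "positive_bounded A"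
    unfolding positive_bounded_def formA
  proof (intro conjI allI)
    show "selfadjoint A" unfolding A_def
      using S projectionD(1)[OF Q]
      by (intro selfadjoint_compose selfadjoint_diff selfadjoint_scaleR)
        (auto intro!: blinfun_eqI simp: blinfun.bilinear_simps SQ)
    show "0 \<le> Re (cinner (Q v) (S (Q v))) - l * (norm (Q v))\<^sup>2" for v
      using F_zero_ge[OF FQ, of v] by simp
  qed
  moreover have Qy: "Q y = y" by (simp add: Q_def blinfun.bilinear_simps Fy)
  ultimately have "A y = 0" using form by (intro positive_form_zero) (simp_all add: formA)
  then have "S y = l *\<^sub>R y" by (simp add: A_def Qy blinfun.bilinear_simps)
  then have "y = 0" using F_eigen[of y l] Fy by simp
  then show ?thesis using z by (simp add: y_def G_def)
qed

subsection \<open>From the spectral family to a projection-valued measure\<close>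

definition dist_fun :: "'h \<Rightarrow> real \<Rightarrow> real" where "dist_fun x l = (norm (F l x))\<^sup>2"

lemma dist_fun_mono: "l \<le> m \<Longrightarrow> dist_fun x l \<le> dist_fun x m"
  using F_diff_norm(2)[of l m x] zero_le_power2[of "norm ((F m - F l) x)"] by (simp add: dist_fun_def)

text \<open>Monotonicity lifts convergence along \<open>l + 1/(n+1)\<close> to the right-hand limit
  required for a Stieltjes measure.\<close>

lemma dist_fun_right_continuous: "continuous (at_right l) (dist_fun x)"
  unfolding continuous_within
proof (rule order_tendstoI)
  fix a assume a: "a < dist_fun x l"
  have "\<forall>\<^sub>F m in at_right l. l < m" by (simp add: eventually_at_right_less)
  then show "\<forall>\<^sub>F m in at_right l. a < dist_fun x m"
    by eventually_elim (use a dist_fun_mono less_le_trans less_imp_le in metis)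
next
  fix a assume a: "dist_fun x l < a"
  have "(\<lambda>n. dist_fun x (l + 1 / real (Suc n))) \<longlonglongrightarrow> dist_fun x l"
    unfolding dist_fun_def by (intro tendsto_intros F_right_continuous_seq)
  from order_tendstoD(2)[OF this a] obtain n where n: "dist_fun x (l + 1 / real (Suc n)) < a"
    by (auto simp: eventually_sequentially)
  have "\<forall>\<^sub>F m in at_right l. m < l + 1 / real (Suc n)" by (rule eventually_at_rightI[of l "l + 1 / real (Suc n)"]) auto
  then show "\<forall>\<^sub>F m in at_right l. dist_fun x m < a"
    by eventually_elim (use n dist_fun_mono le_less_trans less_imp_le in metis)
qed

abbreviation \<nu> :: "'h \<Rightarrow> real measure" where "\<nu> x \<equiv> interval_measure (dist_fun x)"

lemma emeasure_nu_Ioc: "a \<le> b \<Longrightarrow> emeasure (\<nu> x) {a<..b} = ennreal ((norm ((F b - F a) x))\<^sup>2)"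
  by (subst emeasure_interval_measure_Ioc[OF _ dist_fun_mono dist_fun_right_continuous])
    (auto simp: F_diff_norm(2) dist_fun_def)

lemma emeasure_nu_UNIV: "emeasure (\<nu> x) UNIV = ennreal ((norm x)\<^sup>2)"
proof (rule LIMSEQ_unique)
  have UN: "(\<Union>n. {- real n<..real n}) = UNIV"
  proof (intro set_eqI iffI UNIV_I)
    fix t :: real
    obtain n where "\<bar>t\<bar> < real n" using reals_Archimedean2 by blast
    then have "t \<in> {- real n<..real n}" by auto
    then show "t \<in> (\<Union>n. {- real n<..real n})" by blast
  qed
  have "(\<lambda>n. emeasure (\<nu> x) {- real n<..real n}) \<longlonglongrightarrow> emeasure (\<nu> x) (\<Union>n. {- real n<..real n})"
    by (rule Lim_emeasure_incseq) (auto simp: incseq_def)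
  then show "(\<lambda>n. emeasure (\<nu> x) {- real n<..real n}) \<longlonglongrightarrow> emeasure (\<nu> x) UNIV" by (simp only: UN)
  obtain N where N: "norm S < real N" using reals_Archimedean2 by blast
  have "emeasure (\<nu> x) {- real n<..real n} = ennreal ((norm x)\<^sup>2)" if "n \<ge> N" for n
    using N that by (subst emeasure_nu_Ioc) (simp_all add: F_below F_above)
  then show "(\<lambda>n. emeasure (\<nu> x) {- real n<..real n}) \<longlonglongrightarrow> ennreal ((norm x)\<^sup>2)"
    by (intro tendsto_eventually) (auto simp: eventually_sequentially)
qed

text \<open>A projection represents \<open>A\<close> when it yields the Stieltjes measure of
  \<open>A\<close> for all vectors at once. Projections of Borel sets are thus obtained by a Dynkin
  argument, with no polarised complex measures.\<close>

definition is_measure_of :: "('h \<Rightarrow>\<^sub>L 'h) \<Rightarrow> real set \<Rightarrow> bool" where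
  "is_measure_of P A \<longleftrightarrow> projection P \<and> (\<forall>x. emeasure (\<nu> x) A = ennreal ((norm (P x))\<^sup>2))"

lemma is_measure_of_unique:
  assumes "is_measure_of P A" "is_measure_of Q A"
  shows "P = Q"
proof (rule projection_eqI)
  show "projection P" "projection Q" using assms by (auto simp: is_measure_of_def)
  fix x
  have "ennreal ((norm (P x))\<^sup>2) = ennreal ((norm (Q x))\<^sup>2)"
    using assms by (simp add: is_measure_of_def)
  then have "(norm (P x))\<^sup>2 = (norm (Q x))\<^sup>2" by (simp add: ennreal_inj)
  then show "norm (P x) = norm (Q x)" by (simp add: power2_eq_iff_nonneg)
qed

text \<open>Additivity of the scalar measures, together with their total mass ||x||^2, makes the
  projections mutually orthogonal with a Bessel bound; their strong sum then represents the
  union.\<close>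

lemma is_measure_of_UN:
  fixes A :: "nat \<Rightarrow> real set"
  assumes A: "range A \<subseteq> sets borel" "disjoint_family A" and P: "\<And>i. is_measure_of (P i) (A i)"
  obtains Q where "is_measure_of Q (\<Union>i. A i)" "\<And>x. (\<lambda>i. P i x) sums Q x"
proof -
  have proj: "projection (P i)" and em: "emeasure (\<nu> x) (A i) = ennreal ((norm (P i x))\<^sup>2)" for i x
    using P by (auto simp: is_measure_of_def)
  have le_UNIV: "emeasure (\<nu> x) B \<le> ennreal ((norm x)\<^sup>2)" for x B
    using emeasure_space[of "\<nu> x" B] by (simp add: emeasure_nu_UNIV)
  have UN: "(\<Sum>i. ennreal ((norm (P i x))\<^sup>2)) = emeasure (\<nu> x) (\<Union>i. A i)" for x
    unfolding em[symmetric] using A by (intro suminf_emeasure) simp_all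
  define b where "b x = measure (\<nu> x) (\<Union>i. A i)" for x
  have b: "ennreal (b x) = emeasure (\<nu> x) (\<Union>i. A i)" for x
    unfolding b_def
    using le_less_trans[OF le_UNIV ennreal_less_top, of x "\<Union>i. A i"]
    by (intro emeasure_eq_ennreal_measure[symmetric]) (simp only: less_top)
  have b0: "0 \<le> b x" for x by (simp add: b_def)
  have sums: "(\<lambda>i. (norm (P i x))\<^sup>2) sums b x" for x
  proof -
    have "(\<lambda>i. ennreal ((norm (P i x))\<^sup>2)) sums ennreal (b x)"
      using UN[of x] by (simp add: b sums_iff)
    then show ?thesis by (simp add: b0)
  qed
  have orth: "P i (P j x) = 0" if "i \<noteq> j" for i j x
  proof (rule projections_orthogonal[OF proj proj])
    fix x
    have "emeasure (\<nu> x) (A i \<union> A j) = emeasure (\<nu> x) (A i) + emeasure (\<nu> x) (A j)"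
      using A that by (intro plus_emeasure[symmetric]) (auto simp: disjoint_family_on_def)
    then have "ennreal ((norm (P i x))\<^sup>2 + (norm (P j x))\<^sup>2) \<le> ennreal ((norm x)\<^sup>2)"
      using le_UNIV[of x "A i \<union> A j"] by (simp add: em)
    then show "(norm (P i x))\<^sup>2 + (norm (P j x))\<^sup>2 \<le> (norm x)\<^sup>2" by (subst (asm) ennreal_le_iff) auto
  qed
  have b_le: "b x \<le> (norm x)\<^sup>2" for x
    using le_UNIV[of x "\<Union>i. A i"] by (simp add: ennreal_le_iff flip: b)
  obtain Q where Q: "projection Q" "\<And>x. (\<lambda>i. P i x) sums Q x" "\<And>x. (norm (Q x))\<^sup>2 = b x"
    using orthogonal_projections_sums[of P b, OF proj orth sums b_le] by blast
  show ?thesis using that[of Q] Q by (simp add: is_measure_of_def b)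
qed

lemma is_measure_of_Ioc: "a \<le> b \<Longrightarrow> is_measure_of (F b - F a) {a<..b}"
  by (simp add: is_measure_of_def F_diff_norm(1) emeasure_nu_Ioc)

lemma is_measure_of_UNIV: "is_measure_of id_blinfun UNIV"
  by (simp add: is_measure_of_def emeasure_nu_UNIV)

text \<open>The half-open intervals form an intersection-stable generator, and representability
  passes to complements and disjoint countable unions, so the Dynkin induction reaches every Borel
  set.\<close>

lemma is_measure_of_exists:
  assumes "A \<in> sets borel"
  shows "\<exists>P. is_measure_of P A"
proof -
  let ?G = "range (\<lambda>(a, b). {a<..b}) :: real set set"
  have A: "A \<in> sigma_sets UNIV ?G" using assms by (simp add: borel_sigma_sets_Ioc)
  have stable: "Int_stable ?G"
  proof (rule Int_stableI_image)
    fix i j :: "real \<times> real"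
    obtain a b c d where ij: "i = (a, b)" "j = (c, d)" by force
    have "{a<..b} \<inter> {c<..d} = {max a c<..min b d}" by auto
    then show "\<exists>k\<in>UNIV. (case i of (a, b) \<Rightarrow> {a<..b}) \<inter> (case j of (a, b) \<Rightarrow> {a<..b})
        = (case k of (a, b) \<Rightarrow> {a<..b})"
      by (intro bexI[of _ "(max a c, min b d)"]) (simp_all add: ij)
  qed
  have "?G \<subseteq> Pow UNIV" by simp
  from stable this A show ?thesis
  proof (induction A rule: sigma_sets_induct_disjoint)
    case (basic A)
    then obtain a b where A: "A = {a<..b}" by auto
    show ?case
    proof (cases "a \<le> b")
      case True
      then show ?thesis using is_measure_of_Ioc A by blast
    next
      case False
      then show ?thesis by (intro exI[of _ 0]) (simp add: is_measure_of_def A)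
    qed
  next
    case empty
    show ?case by (intro exI[of _ 0]) (simp add: is_measure_of_def)
  next
    case (compl A)
    then obtain P where P: "projection P" "\<And>x. emeasure (\<nu> x) A = ennreal ((norm (P x))\<^sup>2)"
      by (auto simp: is_measure_of_def)
    have A: "A \<in> sets borel" using compl by (simp add: borel_sigma_sets_Ioc)
    have "emeasure (\<nu> x) (UNIV - A) = ennreal ((norm ((id_blinfun - P) x))\<^sup>2)" for x
    proof -
      have "emeasure (\<nu> x) (UNIV - A) = ennreal ((norm x)\<^sup>2) - ennreal ((norm (P x))\<^sup>2)"
        using emeasure_compl[of A "\<nu> x"] A by (simp add: P emeasure_nu_UNIV)
      also have "\<dots> = ennreal ((norm x)\<^sup>2 - (norm (P x))\<^sup>2)" by (simp add: ennreal_minus)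
      also have "(norm x)\<^sup>2 - (norm (P x))\<^sup>2 = (norm ((id_blinfun - P) x))\<^sup>2"
        using norm_projection_pythagoras[OF P(1), of x] by (simp add: blinfun.bilinear_simps)
      finally show ?thesis .
    qed
    then show ?case using P(1) by (intro exI[of _ "id_blinfun - P"]) (simp add: is_measure_of_def projection_compl)
  next
    case (union A)
    then obtain P where P: "\<And>i. is_measure_of (P i) (A i)" by metis
    have "range A \<subseteq> sets borel" using union by (simp add: borel_sigma_sets_Ioc)
    from is_measure_of_UN[OF this union(1) P] show ?case by metis
  qed
qed

definition spectral_E :: "real set \<Rightarrow> 'h \<Rightarrow>\<^sub>L 'h" where
  "spectral_E A = (SOME P. is_measure_of P A)"

lemma spectral_E: "A \<in> sets borel \<Longrightarrow> is_measure_of (spectral_E A) A"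
  unfolding spectral_E_def by (rule someI_ex[OF is_measure_of_exists])

lemma spectral_E_Ioc: "a \<le> b \<Longrightarrow> spectral_E {a<..b} = F b - F a"
  by (rule is_measure_of_unique[OF spectral_E is_measure_of_Ioc]) auto

lemma pvm_spectral_E: "projection_valued_measure spectral_E"
  unfolding projection_valued_measure_def
proof (intro conjI ballI allI impI)
  fix A :: "real set" assume "A \<in> sets borel"
  then have "projection (spectral_E A)" using spectral_E by (auto simp: is_measure_of_def)
  then show "spectral_E A \<in> BH" "spectral_E A o\<^sub>L spectral_E A = spectral_E A" "adj (spectral_E A) = spectral_E A"
    by (auto simp: projectionD selfadjointD(3))
next
  show "spectral_E UNIV = id_blinfun" by (rule is_measure_of_unique[OF spectral_E is_measure_of_UNIV]) simp
next
  fix A :: "nat \<Rightarrow> real set" and x assume A: "range A \<subseteq> sets borel" "disjoint_family A"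
  obtain Q where Q: "is_measure_of Q (\<Union>i. A i)" "\<And>x. (\<lambda>i. spectral_E (A i) x) sums Q x"
    using is_measure_of_UN[OF A, of "\<lambda>i. spectral_E (A i)"] A(1) by (metis range_subsetD spectral_E)
  have "(\<Union>i. A i) \<in> sets borel" using A(1) by auto
  then have "spectral_E (\<Union>i. A i) = Q" using is_measure_of_unique[OF spectral_E Q(1)] by blast
  then show "(\<lambda>n. spectral_E (A n) x) sums spectral_E (\<Union>n. A n) x" using Q(2) by simp
qed

sublocale pvm spectral_E by standard (rule pvm_spectral_E)

text \<open>A Riemann-Stieltjes argument: the step function with left endpoints on a grid of mesh
  \<open>d n\<close> is uniformly close to the identity function, and the corresponding sum of
  spectral projections differs from \<open>S\<close> by an operator with form at most
  \<open>d n\<close>.\<close>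

lemma S_in_spectral_integral: "(x, S x) \<in> SP complex_of_real"
proof -
  \<comment> \<open>Strictly above the norm, so \<open>F (- m) = 0\<close> and \<open>F m\<close> is
    the identity; the grid cuts this interval into \<open>Suc n\<close> cells.\<close>
  define m where "m = norm S + 1"
  have m: "m > norm S" "m > 0" using norm_ge_zero[of S] by (auto simp: m_def add_nonneg_pos)
  define d where "d n = 2 * m / real (Suc n)" for n :: nat
  define a where "a n k = - m + k * d n" for n k :: nat
  have d0: "d n > 0" for n using m by (simp add: d_def)
  have a0: "a n 0 = - m" and aSuc: "a n (Suc k) = a n k + d n" for n k
    by (simp_all add: a_def algebra_simps)
  have aN: "a n (Suc n) = m" for n
    by (simp add: a_def d_def del: of_nat_Suc)
  have amono: "a n j \<le> a n k" if "j \<le> k" for n j k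
    using that d0[of n] by (simp add: a_def mult_right_mono)
  define I where "I n k = {a n k<..a n (Suc k)}" for n k
  have I [measurable]: "I n k \<in> sets borel" for n k by (simp add: I_def)
  define s where "s n t = (\<Sum>k<Suc n. complex_of_real (a n k) * indicator (I n k) t)" for n and t :: real
  have simple: "simple_function borel (\<lambda>t. \<Sum>k<N. of_real (a n k) * indicator (I n k) t :: complex)"
    and SI_sum: "SI (\<lambda>t. \<Sum>k<N. of_real (a n k) * indicator (I n k) t) x = (\<Sum>k<N. a n k *\<^sub>R spectral_E (I n k) x)"
    for N n x
  proof (induction N)
    case 0
    case 1 show ?case by simp
    case 2 show ?case by (simp add: simple_spectral_integral_def)
  next
    case (Suc N)
    have si: "simple_function borel (indicator (I n N) :: real \<Rightarrow> complex)" by simp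
    have sc: "simple_function borel (\<lambda>t. of_real (a n N) * indicator (I n N) t :: complex)"
      using simple_function_compose[OF si, of "\<lambda>z. of_real (a n N) * z"] by (simp add: comp_def)
    case 1 show ?case
      using simple_function_compose2[OF Suc(1) sc, of "(+)"] by simp
    case 2 show ?case
      using Suc SI_add[OF Suc(1) sc, of x] SI_cmult[OF si, of "of_real (a n N)" x]
      by (simp add: SI_indicator scaleR_scaleC)
  qed
  have s_val: "s n t = of_real (a n k)" if "t \<in> I n k" "k < Suc n" for n t k
  proof -
    have uniq: "j = k" if "t \<in> I n j" for j
      using that \<open>t \<in> I n k\<close> amono[of "Suc j" k n] amono[of "Suc k" j n]
      by (cases j k rule: linorder_cases) (auto simp: I_def)
    have "s n t = (\<Sum>j<Suc n. if j = k then of_real (a n k) else 0)"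
      unfolding s_def
    proof (rule sum.cong[OF refl])
      show "of_real (a n j) * indicator (I n j) t = (if j = k then complex_of_real (a n k) else 0)" for j
        using that(1) uniq[of j] by (cases "j = k") (auto simp: indicator_def)
    qed
    then show ?thesis using that(2) by simp
  qed
  have close: "cmod (of_real t - s n t) \<le> d n" if t: "t \<in> {-m<..m}" for n t
  proof -
    obtain k where k: "k < Suc n" "a n k < t" "t \<le> a n (Suc k)"
      using grid_cell_exists[of "a n" t "Suc n"] t by (auto simp: a0 aN)
    then have "s n t = of_real (a n k)" by (intro s_val) (auto simp: I_def)
    moreover have "\<bar>t - a n k\<bar> \<le> d n" using k aSuc[of n k] by simp
    ultimately show ?thesis by (metis norm_of_real of_real_diff)
  qed
  have E_m: "spectral_E {-m<..m} = id_blinfun"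
    using m by (simp add: spectral_E_Ioc F_below F_above)
  have AE_m: "AE t in \<mu> x. t \<in> {-m<..m}" for x
  proof (rule AE_I)
    have "spectral_E (UNIV - {-m<..m}) x = 0"
      using E_Un[of "{-m<..m}" "UNIV - {-m<..m}" x] by (simp add: E_m Un_Diff_cancel)
    then show "emeasure (\<mu> x) (UNIV - {-m<..m}) = 0" by (simp add: emeasure_mu)
  qed auto
  have AE_bound: "sqn g x \<le> ennreal ((K * norm x)\<^sup>2)" if "\<And>t. t \<in> {-m<..m} \<Longrightarrow> cmod (g t) \<le> K" for g K x
    by (rule sqn_bounded) (use AE_m in eventually_elim, rule that)
  have d_lim: "d \<longlonglongrightarrow> 0"
    unfolding d_def using tendsto_mult[OF tendsto_const LIMSEQ_inverse_real_of_nat, of "2 * m"]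
    by (simp add: field_simps)
  have 1: "sqn of_real x < \<infinity>"
    using AE_bound[of complex_of_real m x] by (rule le_less_trans) auto
  have 2: "(\<lambda>n. sqn (\<lambda>t. of_real t - s n t) x) \<longlonglongrightarrow> 0"
  proof (rule tendsto_sandwich[OF _ _ tendsto_const])
    show "\<forall>\<^sub>F n in sequentially. sqn (\<lambda>t. of_real t - s n t) x \<le> ennreal ((d n * norm x)\<^sup>2)"
      by (intro always_eventually allI AE_bound close)
    have "(\<lambda>n. ennreal ((d n * norm x)\<^sup>2)) \<longlonglongrightarrow> ennreal ((0 * norm x)\<^sup>2)"
      by (intro tendsto_intros d_lim)
    then show "(\<lambda>n. ennreal ((d n * norm x)\<^sup>2)) \<longlonglongrightarrow> 0" by simp
  qed simp
  have 3: "(\<lambda>n. SI (s n) x) \<longlonglongrightarrow> S x"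
  proof -
    define P where "P n k = spectral_E (I n k)" for n k
    have P_eq: "P n k = F (a n (Suc k)) - F (a n k)" for n k
      unfolding P_def I_def by (rule spectral_E_Ioc) (use d0[of n] in \<open>simp add: aSuc\<close>)
    have P: "projection (P n k)" for n k unfolding P_def by (intro projection I)
    have SP': "S (P n k y) = P n k (S y)" for n k y by (simp add: P_eq blinfun.bilinear_simps F_S)
    have sumP: "(\<Sum>k<Suc n. P n k y) = y" for n y
    proof -
      have "(\<Sum>k<Suc n. P n k y) = F (a n (Suc n)) y - F (a n 0) y"
        unfolding P_eq blinfun.diff_left by (rule sum_lessThan_telescope)
      then show ?thesis using m by (simp add: a0 aN F_below F_above del: sum.lessThan_Suc)
    qed
    \<comment> \<open>The error of the step approximation; a bound on its quadratic form suffices by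
      \<open>selfadjoint_norm_le\<close>.\<close>
    define D where "D n = S - (\<Sum>k<Suc n. a n k *\<^sub>R P n k)" for n
    have D_ap: "D n y = S y - SI (s n) y" for n y
      unfolding D_def s_def SI_sum by (simp add: blinfun.diff_left blinfun.sum_left blinfun.scaleR_left P_def del: sum.lessThan_Suc)
    have saD: "selfadjoint (D n)" for n
    proof -
      have "selfadjoint (\<Sum>k<N. a n k *\<^sub>R P n k)" for N
        by (induction N) (auto intro!: selfadjoint_add selfadjoint_scaleR[OF projectionD(1)[OF P]])
      then show ?thesis unfolding D_def by (intro selfadjoint_diff S)
    qed
    have form: "\<bar>Re (cinner y (D n y))\<bar> \<le> d n * (norm y)\<^sup>2" for n y
    proof -
      have sq: "(norm y)\<^sup>2 = (\<Sum>k<Suc n. (norm (P n k y))\<^sup>2)"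
      proof -
        have "(norm y)\<^sup>2 = Re (cinner y (\<Sum>k<Suc n. P n k y))" by (simp only: sumP norm_sq_cinner)
        then show ?thesis by (simp add: cinner_sum_right cinner_projection[OF P] del: sum.lessThan_Suc)
      qed
      have "Re (cinner y (D n y)) = Re (cinner y (S (\<Sum>k<Suc n. P n k y))) - (\<Sum>k<Suc n. a n k * (norm (P n k y))\<^sup>2)"
        unfolding D_def
        by (simp add: sumP blinfun.diff_left blinfun.sum_left blinfun.scaleR_left cinner_simps cinner_sum_right
          cinner_projection[OF P] del: sum.lessThan_Suc)
      also have "Re (cinner y (S (\<Sum>k<Suc n. P n k y))) = (\<Sum>k<Suc n. Re (cinner (P n k y) (S (P n k y))))"
        by (simp add: blinfun.sum_right cinner_sum_right projectionD(3,4)[OF P] SP' del: sum.lessThan_Suc)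
      finally have eq: "Re (cinner y (D n y))
          = (\<Sum>k<Suc n. Re (cinner (P n k y) (S (P n k y))) - a n k * (norm (P n k y))\<^sup>2)"
        by (simp add: sum_subtractf del: sum.lessThan_Suc)
      \<comment> \<open>The range of \<open>P n k\<close> lies under \<open>F\<close> of the right
        endpoint and in the kernel of \<open>F\<close> of the left one, so the form of
        \<open>S\<close> there is between the two endpoints.\<close>
      have "\<bar>Re (cinner (P n k y) (S (P n k y))) - a n k * (norm (P n k y))\<^sup>2\<bar> \<le> d n * (norm (P n k y))\<^sup>2" for k
      proof -
        have le: "a n k \<le> a n (Suc k)" by (rule amono) simp
        have "F (a n (Suc k)) (P n k y) = P n k y"
          using F_mono[OF le] by (simp add: P_eq blinfun.bilinear_simps projectionD(3)[OF projection_F])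
        then have "Re (cinner (P n k y) (S (P n k y))) \<le> a n (Suc k) * (norm (P n k y))\<^sup>2"
          by (rule F_fixed_le)
        moreover have "F (a n k) (P n k y) = 0"
          using F_mono[OF le, of y]
          by (simp add: P_eq blinfun.bilinear_simps F_F[of "a n k" "a n (Suc k)"] projectionD(3)[OF projection_F])
        then have "a n k * (norm (P n k y))\<^sup>2 \<le> Re (cinner (P n k y) (S (P n k y)))"
          by (rule F_zero_ge)
        ultimately show ?thesis by (simp add: aSuc algebra_simps)
      qed
      then show ?thesis
        unfolding eq sq sum_distrib_left
        by (intro order_trans[OF sum_abs] sum_mono)
    qed
    have le: "norm (S x - SI (s n) x) \<le> 3 * d n * norm x" for n
      using selfadjoint_norm_le[OF saD less_imp_le[OF d0] form, of n x] by (simp add: D_ap)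
    have "(\<lambda>n. S x - SI (s n) x) \<longlonglongrightarrow> 0"
    proof (rule Lim_null_comparison)
      show "\<forall>\<^sub>F n in sequentially. norm (S x - SI (s n) x) \<le> 3 * d n * norm x"
        by (intro always_eventually allI le)
      show "(\<lambda>n. 3 * d n * norm x) \<longlonglongrightarrow> 0"
        using tendsto_mult[OF tendsto_mult[OF tendsto_const d_lim] tendsto_const, of 3 "norm x"] by simp
    qed
    from tendsto_diff[OF tendsto_const[of "S x"] this] show ?thesis by simp
  qed
  have "simple_function borel (s n)" for n unfolding s_def by (rule simple)
  then show ?thesis using 1 2 3 unfolding mem_SP by blast
qed

lemma spectral_integral_spectral_E: "spectral_integral spectral_E complex_of_real = op_of S"
proof -
  have "complex_of_real \<in> borel_measurable borel" by (intro borel_measurable_continuous_onI continuous_intros)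
  then have "(x, y) \<in> SP complex_of_real \<longleftrightarrow> y = S x" for x y
    using SP_unique S_in_spectral_integral by blast
  then show ?thesis by (auto simp: op_of_def)
qed

end

text \<open>Existence justifies the \<open>SOME\<close> in \<open>spectral_measure\<close>. The
  chosen measure may differ from the one constructed and is used below only through these two
  properties.\<close>

lemma spectral_theorem:
  assumes "selfadjoint S"
  shows "projection_valued_measure (spectral_measure S)"
    "spectral_integral (spectral_measure S) complex_of_real = op_of S"
proof -
  interpret bounded_selfadjoint S by standard fact
  have "\<exists>E. projection_valued_measure E \<and> spectral_integral E complex_of_real = op_of S"
    using pvm_spectral_E spectral_integral_spectral_E by blast
  from someI_ex[OF this, folded spectral_measure_def]
  show "projection_valued_measure (spectral_measure S)"
    "spectral_integral (spectral_measure S) complex_of_real = op_of S" by auto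
qed

section \<open>The commutant of a self-adjoint operator and its spectral measure\<close>

locale spectral_resolution = pvm E for E :: "real set \<Rightarrow> 'h::chilbert_space \<Rightarrow>\<^sub>L 'h" +
  fixes S :: "'h \<Rightarrow>\<^sub>L 'h"
  assumes S: "selfadjoint S" and SP_id: "spectral_integral E complex_of_real = op_of S"
begin

lemma E_commute: "A \<in> sets borel \<Longrightarrow> B \<in> sets borel \<Longrightarrow> E A (E B x) = E B (E A x)"
  by (simp add: E_Int Int_commute)

lemma measurable_id: "complex_of_real \<in> borel_measurable borel"
  by (intro borel_measurable_continuous_onI continuous_intros)

lemma E_S: "A \<in> sets borel \<Longrightarrow> E A (S x) = S (E A x)"
  using SP_commute[OF measurable_id, of x "S x" "E A"]
  by (simp add: SP_id E_commute projectionD(2)[OF projection])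

text \<open>The isometry for t - c. It converts the distance of a spectral set from \<open>c\<close>
  into upper and lower bounds for \<open>S - c\<close> on the range of its projection.\<close>

lemma norm_shift: "ennreal ((norm (S x - c *\<^sub>R x))\<^sup>2) = sqn (\<lambda>t. complex_of_real (t - c)) x"
proof -
  have "SI (\<lambda>_. - complex_of_real c) x = - (c *\<^sub>R x)"
    by (simp add: simple_spectral_integral_def scaleR_scaleC)
  then have "(x, - (c *\<^sub>R x)) \<in> SP (\<lambda>_. - complex_of_real c)"
    using SP_simple[of "\<lambda>_. - complex_of_real c" x] by simp
  then have "(x, S x + - (c *\<^sub>R x)) \<in> SP (\<lambda>t. complex_of_real t + - complex_of_real c)"
    by (intro SP_add measurable_id) (auto simp: SP_id)
  then have "(x, S x - c *\<^sub>R x) \<in> SP (\<lambda>t. complex_of_real (t - c))" by simp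
  then show ?thesis
    by (subst SP_norm) (auto intro!: borel_measurable_continuous_onI continuous_intros)
qed

lemma AE_mu_fixed:
  assumes A: "A \<in> sets borel" and "E A x = x"
  shows "AE t in \<mu> x. t \<in> A"
proof (rule AE_I)
  have "E (UNIV - A) x = 0" using E_Int[of "UNIV - A" A x] A assms(2) by (simp add: Diff_Int_distrib2)
  then show "emeasure (\<mu> x) (UNIV - A) = 0" using A by (simp add: emeasure_mu)
qed (use A in auto)

lemma norm_shift_le:
  assumes "A \<in> sets borel" "E A x = x" "\<And>t. t \<in> A \<Longrightarrow> \<bar>t - c\<bar> \<le> r" "0 \<le> r"
  shows "norm (S x - c *\<^sub>R x) \<le> r * norm x"
proof (rule power2_le_imp_le)
  have "AE t in \<mu> x. cmod (complex_of_real (t - c)) \<le> r"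
    using AE_mu_fixed[OF assms(1,2)] by eventually_elim (unfold norm_of_real, rule assms(3))
  then have "ennreal ((norm (S x - c *\<^sub>R x))\<^sup>2) \<le> ennreal ((r * norm x)\<^sup>2)"
    unfolding norm_shift by (rule sqn_bounded)
  then show "(norm (S x - c *\<^sub>R x))\<^sup>2 \<le> (r * norm x)\<^sup>2" by (subst (asm) ennreal_le_iff) auto
qed (use assms in simp)

lemma norm_shift_ge:
  assumes "A \<in> sets borel" "E A x = x" "\<And>t. t \<in> A \<Longrightarrow> r \<le> \<bar>t - c\<bar>" "0 \<le> r"
  shows "r * norm x \<le> norm (S x - c *\<^sub>R x)"
proof (rule power2_le_imp_le)
  have "ennreal ((r * norm x)\<^sup>2) = (\<integral>\<^sup>+t. ennreal (r\<^sup>2) \<partial>\<mu> x)"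
    using emeasure_mu[of UNIV x] by (simp add: power_mult_distrib ennreal_mult)
  also have "\<dots> \<le> ennreal ((norm (S x - c *\<^sub>R x))\<^sup>2)"
    unfolding norm_shift sqn_def
  proof (rule nn_integral_mono_AE)
    show "AE t in \<mu> x. ennreal (r\<^sup>2) \<le> ennreal ((cmod (complex_of_real (t - c)))\<^sup>2)"
      using AE_mu_fixed[OF assms(1,2)]
      by eventually_elim (unfold norm_of_real, intro ennreal_leI power_mono assms(3,4))
  qed
  finally show "(r * norm x)\<^sup>2 \<le> (norm (S x - c *\<^sub>R x))\<^sup>2" by (subst (asm) ennreal_le_iff) auto
qed simp

text \<open>With \<open>D = S - c\<close>, the operator \<open>X = E(B) R E(J)\<close>
  satisfies \<open>D\<^sup>n X = X D\<^sup>n\<close>, while \<open>\<parallel>D\<^sup>n\<parallel> \<le> r\<^sup>n\<close> on the range of \<open>E(J)\<close> and \<open>D\<^sup>n\<close> expands by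
  \<open>q\<^sup>n\<close>, \<open>q > r\<close>, on the range of \<open>E(B)\<close>; hence \<open>X = 0\<close>.\<close>

lemma E_far_apply_near:
  fixes R :: "'h \<Rightarrow>\<^sub>L 'h"
  assumes R: "\<And>x. R (S x) = S (R x)"
    and J: "J \<in> sets borel" "\<And>t. t \<in> J \<Longrightarrow> \<bar>t - c\<bar> \<le> r" "0 \<le> r"
    and B: "B \<in> sets borel" "\<And>t. t \<in> B \<Longrightarrow> q \<le> \<bar>t - c\<bar>" and "r < q"
  shows "E B (R (E J x)) = 0"
proof -
  define D where "D y = S y - c *\<^sub>R y" for y
  define y where "y = E J x"
  have D_E: "D (E A z) = E A (D z)" if "A \<in> sets borel" for A z
    using that by (simp add: D_def E_S blinfun.bilinear_simps)
  have D_R: "D (R z) = R (D z)" for z by (simp add: D_def R blinfun.bilinear_simps)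
  have EJ: "E J ((D ^^ n) y) = (D ^^ n) y" for n
    by (induction n) (simp_all add: y_def projectionD(3)[OF projection] J(1) flip: D_E)
  have up: "norm ((D ^^ n) y) \<le> r ^ n * norm y" for n
  proof (induction n)
    case (Suc n)
    have "norm (D ((D ^^ n) y)) \<le> r * norm ((D ^^ n) y)"
      using norm_shift_le[OF J(1) EJ J(2,3)] by (simp add: D_def[of "(D ^^ n) y" for n])
    also have "\<dots> \<le> r * (r ^ n * norm y)" using Suc J(3) by (rule mult_left_mono)
    finally show ?case by simp
  qed simp
  have iter: "(D ^^ n) (E B (R y)) = E B (R ((D ^^ n) y))" for n
    by (induction n) (simp_all add: D_E B(1) D_R)
  have q: "0 < q" using assms by simp
  have low: "q ^ n * norm (E B (R y)) \<le> norm ((D ^^ n) (E B (R y)))" for n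
  proof (induction n)
    case (Suc n)
    have "E B ((D ^^ n) (E B (R y))) = (D ^^ n) (E B (R y))"
      unfolding iter by (simp add: projectionD(3)[OF projection] B(1))
    then have "q * norm ((D ^^ n) (E B (R y))) \<le> norm (D ((D ^^ n) (E B (R y))))"
      using norm_shift_ge[OF B(1) _ B(2), where x="(D ^^ n) (E B (R y))"] q
      by (simp add: D_def[of "(D ^^ n) (E B (R y))"])
    moreover have "q * (q ^ n * norm (E B (R y))) \<le> q * norm ((D ^^ n) (E B (R y)))"
      using Suc q by (intro mult_left_mono) auto
    ultimately show ?case by (simp add: mult.assoc)
  qed simp
  have bound: "norm (E B (R y)) \<le> (norm R * norm y) * (r / q) ^ n" for n
  proof -
    have "q ^ n * norm (E B (R y)) \<le> norm (E B (R ((D ^^ n) y)))" using low[of n] by (simp add: iter)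
    also have "\<dots> \<le> norm (R ((D ^^ n) y))" using B(1) by (intro norm_projection_le projection)
    also have "\<dots> \<le> norm R * norm ((D ^^ n) y)" by (rule norm_blinfun)
    also have "\<dots> \<le> norm R * (r ^ n * norm y)" by (intro mult_left_mono up) simp
    finally show ?thesis using q by (simp add: power_divide field_simps)
  qed
  have "(\<lambda>n. (norm R * norm y) * (r / q) ^ n) \<longlonglongrightarrow> (norm R * norm y) * 0"
    using J(3) \<open>r < q\<close> by (intro tendsto_mult_left LIMSEQ_realpow_zero) auto
  then have "norm (E B (R y)) \<le> 0"
    using bound by (intro LIMSEQ_le_const) auto
  then show ?thesis by (simp add: y_def)
qed

text \<open>The interval is the closed ball of radius \<open>r\<close> about its midpoint
  \<open>c\<close>, and its complement is the union of sets at distance at least r + 1/(n+1). Each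
  of these is strictly farther away, so \<open>E_far_apply_near\<close> applies to it.\<close>

lemma E_interval_invariant:
  fixes R :: "'h \<Rightarrow>\<^sub>L 'h"
  assumes R: "\<And>x. R (S x) = S (R x)" and "a \<le> b"
  shows "E {a..b} (R (E {a..b} x)) = R (E {a..b} x)"
proof -
  define c r where "c = (a + b) / 2" and "r = (b - a) / 2"
  define y where "y = R (E {a..b} x)"
  define B where "B n = {t. r + 1 / real (Suc n) \<le> \<bar>t - c\<bar>}" for n
  have B [measurable]: "B n \<in> sets borel" for n unfolding B_def by measurable
  have "E (B n) y = 0" for n
    unfolding y_def using R
    by (rule E_far_apply_near[where c=c and r=r and q="r + 1 / real (Suc n)"])
      (use \<open>a \<le> b\<close> in \<open>auto simp: c_def r_def B_def abs_le_iff field_simps\<close>)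
  then have "emeasure (\<mu> y) (B n) = 0" for n by (simp add: emeasure_mu)
  then have "emeasure (\<mu> y) (\<Union>n. B n) = 0" by (intro emeasure_UN_eq_0) auto
  moreover have "(\<Union>n. B n) = UNIV - {a..b}"
  proof (intro set_eqI iffI)
    fix t assume "t \<in> (\<Union>n. B n)"
    then obtain n where "r + 1 / real (Suc n) \<le> \<bar>t - c\<bar>" by (auto simp: B_def)
    moreover have "0 < 1 / real (Suc n)" by simp
    ultimately have "r < \<bar>t - c\<bar>" by linarith
    then show "t \<in> UNIV - {a..b}" by (auto simp: c_def r_def abs_if field_simps split: if_splits)
  next
    fix t assume "t \<in> UNIV - {a..b}"
    then have "t < a \<or> b < t" by auto
    moreover have "c - r = a" "c + r = b" by (simp_all add: c_def r_def field_simps)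
    ultimately have "0 < \<bar>t - c\<bar> - r" by linarith
    then obtain n where "1 / real (Suc n) < \<bar>t - c\<bar> - r" using nat_approx_posE by blast
    then have "t \<in> B n" by (simp add: B_def)
    then show "t \<in> (\<Union>n. B n)" by blast
  qed
  ultimately have "E (UNIV - {a..b}) y = 0" by (simp add: emeasure_mu)
  then have "E {a..b} y = y" using E_Un[of "{a..b}" "UNIV - {a..b}" y] by (simp add: Un_Diff_cancel)
  then show ?thesis by (simp add: y_def)
qed

text \<open>\<open>adj R\<close> commutes with \<open>S\<close> as well, so ranges of interval
  projections are invariant under \<open>R\<close> and its adjoint, which gives commutation.
  Complements and disjoint unions extend this to all Borel sets.\<close>

lemma E_commutes_with_commutant:
  assumes R: "R \<in> BH" "R o\<^sub>L S = S o\<^sub>L R" and A: "A \<in> sets borel"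
  shows "R (E A x) = E A (R x)"
proof -
  have RS: "R (S x) = S (R x)" for x using R(2) by (metis blinfun_apply_blinfun_compose)
  have "adj (R o\<^sub>L S) = adj (S o\<^sub>L R)" using R(2) by simp
  then have "S o\<^sub>L adj R = adj R o\<^sub>L S"
    using R(1) S by (simp add: adj_compose selfadjointD)
  then have RS': "adj R (S x) = S (adj R x)" for x by (metis blinfun_apply_blinfun_compose)
  show ?thesis
    using A
  proof (induction A arbitrary: x rule: borel_set_induct)
    case (interval a b)
    let ?P = "E {a..b}"
    have P: "projection ?P" by (intro projection) simp
    have "?P (R x) = ?P (R (?P x))"
    proof (rule cinner_ext)
      fix v
      have "cinner v (?P (R x)) = cinner (adj R (?P v)) x"
        by (simp add: cinner_adj_left R projectionD(4)[OF P])
      also have "\<dots> = cinner (?P (adj R (?P v))) x"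
        by (simp add: E_interval_invariant[OF RS' interval])
      also have "\<dots> = cinner v (?P (R (?P x)))"
        by (simp add: cinner_adj_left R projectionD(4)[OF P])
      finally show "cinner v (?P (R x)) = cinner v (?P (R (?P x)))" .
    qed
    then show ?case by (simp add: E_interval_invariant[OF RS interval])
  next
    case (compl A)
    have "E (- A) x = x - E A x" for x
      using E_Un[of A "- A" x] compl(1) by (simp add: Compl_eq_Diff_UNIV algebra_simps)
    then show ?case by (simp add: compl blinfun.diff_right)
  next
    case (union f)
    have sums: "(\<lambda>n. E (f n) x) sums E (\<Union>n. f n) x" for x
      using union by (intro E_sums) auto
    have "(\<lambda>n. R (E (f n) x)) sums R (E (\<Union>n. f n) x)"
      by (rule bounded_linear.sums[OF blinfun.bounded_linear_right sums])
    then have "(\<lambda>n. E (f n) (R x)) sums R (E (\<Union>n. f n) x)" by (simp only: union)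
    then show ?case using sums_unique2 sums by blast
  qed simp
qed

end

section \<open>Unbounded self-adjoint operators\<close>

locale selfadjoint_operator =
  fixes T :: "'h::chilbert_space op"
  assumes T: "self_adjoint_op T"
begin

section \<open>Graph arithmetic, closedness and resolvents\<close>

lemma T_unique: "(x, y) \<in> T \<Longrightarrow> (x, z) \<in> T \<Longrightarrow> y = z"
  using T by (auto simp: self_adjoint_op_def linear_op_def single_valued_def)

lemma T_zero: "(0, 0) \<in> T"
  using T by (auto simp: self_adjoint_op_def linear_op_def)

lemma T_add: "(x, y) \<in> T \<Longrightarrow> (x', y') \<in> T \<Longrightarrow> (x + x', y + y') \<in> T"
  using T unfolding self_adjoint_op_def linear_op_def by fast

lemma T_scaleC: "(x, y) \<in> T \<Longrightarrow> (c *\<^sub>C x, c *\<^sub>C y) \<in> T"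
  using T unfolding self_adjoint_op_def linear_op_def by fast

lemma T_scaleR: "(x, y) \<in> T \<Longrightarrow> (r *\<^sub>R x, r *\<^sub>R y) \<in> T"
  using T_scaleC by (simp add: scaleR_scaleC)

lemma T_diff: "(x, y) \<in> T \<Longrightarrow> (x', y') \<in> T \<Longrightarrow> (x - x', y - y') \<in> T"
  using T_add[of x y "-1 *\<^sub>C x'" "-1 *\<^sub>C y'"] T_scaleC[of x' y' "-1"] by simp

text \<open>Equality with the adjoint turns graph membership into a test against the graph itself;
  closedness and the resolvent construction use it to prove membership in the domain.\<close>

lemma T_iff: "(x, y) \<in> T \<longleftrightarrow> (\<forall>v w. (v, w) \<in> T \<longrightarrow> cinner x w = cinner y v)"
proof -
  have "adjoint_op T = T" using T by (simp add: self_adjoint_op_def)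
  then have "(x, y) \<in> T \<longleftrightarrow> (x, y) \<in> adjoint_op T" by simp
  then show ?thesis by (auto simp: adjoint_op_def)
qed

lemma T_symmetric: "(x, y) \<in> T \<Longrightarrow> (v, w) \<in> T \<Longrightarrow> cinner x w = cinner y v"
  using T_iff by blast

lemma T_closed:
  assumes "\<And>n. (X n, Y n) \<in> T" "X \<longlonglongrightarrow> x" "Y \<longlonglongrightarrow> y"
  shows "(x, y) \<in> T"
  proof (rule T_iff[THEN iffD2], intro allI impI)
  fix v w assume vw: "(v, w) \<in> T"
  have "(\<lambda>n. cinner (X n) w) \<longlonglongrightarrow> cinner x w" by (intro tendsto_intros assms)
  moreover have "(\<lambda>n. cinner (X n) w) \<longlonglongrightarrow> cinner y v"
    unfolding T_symmetric[OF assms(1) vw] by (intro tendsto_intros assms)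
  ultimately show "cinner x w = cinner y v" by (rule LIMSEQ_unique)
qed

text \<open>The lower bound makes the range of \<open>T - z\<close> closed and the inverse bounded
  by 1/e. The orthogonal complement of the range is the kernel of the adjoint,
  \<open>T - cnj z\<close>, which is trivial. The lemma serves both the points +i, -i and real
  points outside the spectrum of a bounded operator.\<close>

lemma resolvent_exists:
  assumes e: "e > 0" and low: "\<And>x y. (x, y) \<in> T \<Longrightarrow> e * norm x \<le> norm (y - z *\<^sub>C x)"
    and ker: "\<And>x. (x, cnj z *\<^sub>C x) \<in> T \<Longrightarrow> x = 0"
  shows "\<exists>R\<in>BH. op_of R = {(x, y - z *\<^sub>C x) | x y. (x, y) \<in> T}\<inverse>"
proof -
  define M where "M = {w. \<exists>x. (x, w + z *\<^sub>C x) \<in> T}"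
  have "complex_subspace M"
    unfolding complex_subspace_def
  proof (intro conjI ballI allI)
    show "0 \<in> M" using T_zero by (auto simp: M_def intro!: exI[of _ 0])
    fix v assume "v \<in> M"
    then obtain x where x: "(x, v + z *\<^sub>C x) \<in> T" by (auto simp: M_def)
    show "c *\<^sub>C v \<in> M" for c
      using T_scaleC[OF x, of c]
      by (auto simp: M_def scaleC_add_right scaleC_scaleC mult.commute intro!: exI[of _ "c *\<^sub>C x"])
    fix w assume "w \<in> M"
    then obtain y where y: "(y, w + z *\<^sub>C y) \<in> T" by (auto simp: M_def)
    show "v + w \<in> M"
      using T_add[OF x y] by (auto simp: M_def scaleC_add_right algebra_simps intro!: exI[of _ "x + y"])
  qed
  moreover have "closed M"
    unfolding closed_sequential_limits
  proof (intro allI impI; elim conjE)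
    fix W w assume W: "\<forall>n. W n \<in> M" "W \<longlonglongrightarrow> w"
    then obtain X where X: "\<And>n. (X n, W n + z *\<^sub>C X n) \<in> T" unfolding M_def by simp metis
    have "Cauchy X"
    proof (rule Cauchy_dominated[OF LIMSEQ_imp_Cauchy[OF W(2)], where K="1 / e"])
      show "norm (X m - X n) \<le> 1 / e * dist (W m) (W n)" for m n
        using low[OF T_diff[OF X X], of m n] e
        by (simp add: scaleC_diff_right dist_norm field_simps)
    qed
    then obtain x where x: "X \<longlonglongrightarrow> x" by (auto simp: Cauchy_convergent_iff convergent_def)
    have "(x, w + z *\<^sub>C x) \<in> T"
      by (rule T_closed[OF X x]) (intro tendsto_intros W x)
    then show "w \<in> M" by (auto simp: M_def)
  qed
  moreover have "q = 0" if q: "\<And>w. w \<in> M \<Longrightarrow> cinner w q = 0" for q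
  \<comment> \<open>A vector orthogonal to the range of \<open>T - z\<close> lies in the domain of
    the adjoint, hence of \<open>T\<close>, with eigenvalue \<open>cnj z\<close>.\<close>
  proof (rule ker)
    show "(q, cnj z *\<^sub>C q) \<in> T"
      proof (rule T_iff[THEN iffD2], intro allI impI)
      fix x y assume "(x, y) \<in> T"
      then have "y - z *\<^sub>C x \<in> M" by (auto simp: M_def intro!: exI[of _ x])
      then have "cinner (y - z *\<^sub>C x) q = 0" by (rule q)
      then have "cinner q (y - z *\<^sub>C x) = 0" by (metis cinner_commute complex_cnj_zero)
      then show "cinner q y = cinner (cnj z *\<^sub>C q) x" by (simp add: cinner_simps)
    qed
  qed
  ultimately have "M = UNIV" by (rule closed_subspace_eq_UNIV)
  then have "\<exists>x. (x, w + z *\<^sub>C x) \<in> T" for w by (auto simp: M_def)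
  then obtain f where f: "\<And>w. (f w, w + z *\<^sub>C f w) \<in> T" by metis
  have f_unique: "x = f w" if "(x, w + z *\<^sub>C x) \<in> T" for x w
  proof -
    have "e * norm (x - f w) \<le> 0"
      using low[OF T_diff[OF that f[of w]]] by (simp add: scaleC_diff_right)
    then show ?thesis using e by (simp add: mult_le_0_iff)
  qed
  have hom: "f (c *\<^sub>C w) = c *\<^sub>C f w" for c w
    using f_unique[of "c *\<^sub>C f w" "c *\<^sub>C w"] T_scaleC[OF f, of c w]
    by (simp add: scaleC_add_right scaleC_scaleC mult.commute)
  obtain Q where Q: "Q \<in> BH" "blinfun_apply Q = f"
  proof (rule BH_of_linear)
    show "f (v + w) = f v + f w" for v w
      using f_unique[of "f v + f w" "v + w"] T_add[OF f f, of v w] by (simp add: scaleC_add_right algebra_simps)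
    show "norm (f w) \<le> 1 / e * norm w" for w
      using low[OF f, of w] e by (simp add: field_simps)
  qed (rule hom)
  have "op_of Q = {(x, y - z *\<^sub>C x) | x y. (x, y) \<in> T}\<inverse>"
  proof (intro set_eqI)
    fix p :: "'h \<times> 'h"
    obtain w x where p: "p = (w, x)" by force
    have "p \<in> op_of Q \<longleftrightarrow> (x, w + z *\<^sub>C x) \<in> T"
      using f[of w] f_unique[of x w] by (auto simp: p Q)
    also have "\<dots> \<longleftrightarrow> p \<in> {(x, y - z *\<^sub>C x) | x y. (x, y) \<in> T}\<inverse>"
      by (auto simp: p intro: exI[of _ "w + z *\<^sub>C x"])
    finally show "p \<in> op_of Q \<longleftrightarrow> p \<in> {(x, y - z *\<^sub>C x) | x y. (x, y) \<in> T}\<inverse>" .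
  qed
  then show ?thesis using Q(1) by blast
qed

text \<open>Symmetry makes <y, x> real, so the cross term with \<open>s *\<^sub>C x\<close> is
  purely imaginary.\<close>

lemma norm_shift_imaginary:
  assumes "(x, y) \<in> T" and s: "s \<in> {\<i>, - \<i>}"
  shows "(norm (y - s *\<^sub>C x))\<^sup>2 = (norm y)\<^sup>2 + (norm x)\<^sup>2"
proof -
  have "cinner y x = cnj (cinner y x)"
    using T_symmetric[OF assms(1,1)] by (metis cinner_commute)
  then have "Im (cinner y x) = 0" by (metis add.inverse_neutral cnj.sel(2) equal_neg_zero)
  then have "Re (cinner y (s *\<^sub>C x)) = 0" using s by (auto simp: cinner_scaleC_right)
  moreover have "cmod s = 1" using s by auto
  ultimately show ?thesis by (simp add: norm_sq_diff norm_scaleC)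
qed

lemma shift_imaginary_solution:
  assumes s: "s \<in> {\<i>, - \<i>}"
  obtains R where "R \<in> BH" "\<And>w. (R w, w + s *\<^sub>C R w) \<in> T"
proof -
  have low: "1 * norm x \<le> norm (y - s *\<^sub>C x)" if "(x, y) \<in> T" for x y
  proof (rule power2_le_imp_le)
    show "(1 * norm x)\<^sup>2 \<le> (norm (y - s *\<^sub>C x))\<^sup>2" unfolding norm_shift_imaginary[OF that s] by simp
  qed simp
  have ker: "x = 0" if "(x, cnj s *\<^sub>C x) \<in> T" for x
  proof -
    have "cnj s \<in> {\<i>, - \<i>}" using s by auto
    from norm_shift_imaginary[OF that this] show ?thesis
      by (simp add: sum_power2_eq_zero_iff)
  qed
  obtain R where R: "R \<in> BH" "op_of R = {(x, y - s *\<^sub>C x) | x y. (x, y) \<in> T}\<inverse>"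
    using resolvent_exists[OF zero_less_one low ker] by blast
  have "(R w, w + s *\<^sub>C R w) \<in> T" for w
  proof -
    have "(w, R w) \<in> {(x, y - s *\<^sub>C x) | x y. (x, y) \<in> T}\<inverse>" by (simp flip: R(2))
    then obtain y where "w = y - s *\<^sub>C R w" "(R w, y) \<in> T" by auto
    then show ?thesis by (metis diff_add_cancel)
  qed
  then show ?thesis using R(1) that by blast
qed

section \<open>The inverse of \<open>I + T^2\<close>\<close>

lemma inverse_one_plus_square_exists:
  "\<exists>R. R \<in> BH \<and> (\<forall>w. \<exists>y. (blinfun_apply R w, y) \<in> T \<and> (y, w - R w) \<in> T)"
proof -
  \<comment> \<open>\<open>R1\<close> is the inverse of \<open>T - i\<close> and \<open>R2\<close>
    below that of \<open>T + i\<close>; the product inverts (T - i)(T + i) = T^2 + I.\<close>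
  obtain R1 where R1: "R1 \<in> BH" "\<And>w. (R1 w, w + \<i> *\<^sub>C R1 w) \<in> T"
    using shift_imaginary_solution[of \<i>] by auto
  obtain R2 where R2: "R2 \<in> BH" "\<And>w. (R2 w, w + (- \<i>) *\<^sub>C R2 w) \<in> T"
    using shift_imaginary_solution[of "- \<i>"] by auto
  have "\<exists>y. ((R2 o\<^sub>L R1) w, y) \<in> T \<and> (y, w - (R2 o\<^sub>L R1) w) \<in> T" for w
  proof (intro exI conjI)
    let ?x = "R2 (R1 w)"
    let ?y = "R1 w + (- \<i>) *\<^sub>C ?x"
    show "((R2 o\<^sub>L R1) w, ?y) \<in> T" using R2(2)[of "R1 w"] by simp
    have "(?y, (w + \<i> *\<^sub>C R1 w) + (- \<i>) *\<^sub>C ?y) \<in> T"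
      using T_add[OF R1(2)[of w] T_scaleC[OF R2(2)[of "R1 w"], of "- \<i>"]] by simp
    then show "(?y, w - (R2 o\<^sub>L R1) w) \<in> T"
      by (simp add: scaleC_diff_right scaleC_scaleC)
  qed
  then show ?thesis using R1(1) R2(1) BH_compose by blast
qed

definition R :: "'h \<Rightarrow>\<^sub>L 'h" where
  "R = (SOME R. R \<in> BH \<and> (\<forall>w. \<exists>y. (blinfun_apply R w, y) \<in> T \<and> (y, w - R w) \<in> T))"

lemma R_BH: "R \<in> BH" and R_solves: "\<exists>y. (R w, y) \<in> T \<and> (y, w - R w) \<in> T"
  using someI_ex[OF inverse_one_plus_square_exists, folded R_def] by blast+

text \<open>The form identity <x, w'> = <T x, T x'> + <x, x'> for solutions of (I + T^2) x = w.
  Uniqueness, symmetry and positivity of \<open>R\<close> are read off from it.\<close>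

lemma R_form:
  assumes "(x, y) \<in> T" "(y, w - x) \<in> T" "(x', y') \<in> T" "(y', w' - x') \<in> T"
  shows "cinner x w' = cinner y y' + cinner x x'"
  using T_symmetric[OF assms(1,4)] by (simp add: cinner_diff_right algebra_simps)

text \<open>The difference of two solutions solves the equation with right side 0, where the form
  identity is a sum of two squared norms.\<close>

lemma R_char:
  assumes "(x, y) \<in> T" "(y, w - x) \<in> T"
  shows "x = R w"
proof -
  obtain y' where y': "(R w, y') \<in> T" "(y', w - R w) \<in> T" using R_solves by blast
  have 1: "(x - R w, y - y') \<in> T" using T_diff[OF assms(1) y'(1)] .
  have 2: "(y - y', 0 - (x - R w)) \<in> T" using T_diff[OF assms(2) y'(2)] by simp
  have "cinner (y - y') (y - y') + cinner (x - R w) (x - R w) = 0"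
    using R_form[OF 1 2 1 2] by simp
  then have "(norm (y - y'))\<^sup>2 + (norm (x - R w))\<^sup>2 = 0"
    unfolding norm_sq_cinner by (metis plus_complex.sel(1) zero_complex.sel(1))
  then show ?thesis by (simp add: sum_power2_eq_zero_iff)
qed

lemma R_selfadjoint: "selfadjoint R"
  unfolding selfadjoint_def
proof (intro conjI allI R_BH)
  fix w w'
  obtain y y' where y: "(R w, y) \<in> T" "(y, w - R w) \<in> T" "(R w', y') \<in> T" "(y', w' - R w') \<in> T"
    using R_solves[of w] R_solves[of w'] by blast
  have "cinner (R w) w' = cinner y y' + cinner (R w) (R w')" by (rule R_form[OF y])
  also have "\<dots> = cnj (cinner y' y + cinner (R w') (R w))"
    using cinner_commute[of y y'] cinner_commute[of "R w" "R w'"] by simp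
  also have "\<dots> = cnj (cinner (R w') w)" by (simp only: R_form[OF y(3,4,1,2)])
  also have "\<dots> = cinner w (R w')" by (rule cinner_commute[symmetric])
  finally show "cinner (R w) w' = cinner w (R w')" .
qed

lemma R_form_norm:
  assumes "(R w, y) \<in> T" "(y, w - R w) \<in> T"
  shows "Re (cinner w (R w)) = (norm y)\<^sup>2 + (norm (R w))\<^sup>2"
  using R_form[OF assms assms] Re_cinner_commute[of w "R w"] by (simp add: norm_sq_cinner)

lemma R_positive: "positive_bounded R"
  unfolding positive_bounded_def
proof (intro conjI allI R_selfadjoint)
  fix w
  obtain y where "(R w, y) \<in> T" "(y, w - R w) \<in> T" using R_solves by blast
  from R_form_norm[OF this] show "0 \<le> Re (cinner w (R w))" by simp
qed

lemma R_injective: "R w = 0 \<Longrightarrow> w = 0"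
  using R_solves[of w] T_unique[OF _ T_zero] by (metis diff_zero)

section \<open>The square root \<open>C\<close> and its commutation with \<open>T\<close>\<close>

definition C :: "'h \<Rightarrow>\<^sub>L 'h" where "C = bsqrt R"

lemma C_positive: "positive_bounded C" and CC: "C (C x) = R x"
  using bsqrt(1,2)[OF R_positive] unfolding C_def by (auto simp flip: blinfun_apply_blinfun_compose)

lemma C_selfadjoint: "selfadjoint C" and C_BH: "C \<in> BH"
  using C_positive by (auto simp: positive_bounded_def selfadjointD)

lemma C_injective: "C x = 0 \<Longrightarrow> x = 0"
  using R_injective[of x] CC[of x] by simp

lemma complex_subspace_range: "A \<in> BH \<Longrightarrow> complex_subspace (range (blinfun_apply A))" for A :: "'h \<Rightarrow>\<^sub>L 'h"
  unfolding complex_subspace_def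
  by (auto simp flip: blinfun.add_right BH_scaleC intro: range_eqI[of _ _ 0])

lemma dense_range_C: "closure (range C) = UNIV"
proof (rule dense_subspaceI[OF complex_subspace_range[OF C_BH]])
  fix x assume x: "\<And>q. q \<in> range C \<Longrightarrow> cinner q x = 0"
  have "cinner v (C x) = 0" for v using x[of "C v"] by (simp add: selfadjointD(2)[OF C_selfadjoint])
  then have "C x = 0" using cinner_self[of "C x"] by simp
  then show "x = 0" by (rule C_injective)
qed

text \<open>Closedness of \<open>T\<close> makes its commutant norm closed. The square root
  iteration may therefore run inside it, which puts \<open>C\<close> there once \<open>R\<close>
  is.\<close>

lemma closed_unital_algebra_op_commutant: "closed_unital_algebra (op_commutant T)"
  unfolding closed_unital_algebra_def
proof (intro conjI ballI allI)
  show "closed (op_commutant T)"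
    unfolding closed_sequential_limits
  proof (intro allI impI; elim conjE)
    fix F A assume F: "\<forall>n. F n \<in> op_commutant T" "F \<longlonglongrightarrow> A"
    have "A \<in> BH" using closed_sequentially[OF closed_BH _ F(2)] F(1) by (simp add: op_commutant_def)
    moreover have "(A x, A y) \<in> T" if "(x, y) \<in> T" for x y
    proof -
      have "(F n x, F n y) \<in> T" for n
        using F(1) that by (auto simp: op_commutant_def commutes_with_def)
      then show ?thesis
        by (rule T_closed[OF _ tendsto_blinfun_apply[OF F(2)] tendsto_blinfun_apply[OF F(2)]])
    qed
    ultimately show "A \<in> op_commutant T" by (auto simp: op_commutant_def commutes_with_def)
  qed
qed (auto simp: op_commutant_def commutes_with_def BH_add BH_compose BH_scaleR blinfun.bilinear_simps
  intro: T_add T_scaleR dest: bspec)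

text \<open>If T v = w and y = T (R v), then T y = v - R v has image w - y under \<open>T\<close>,
  so \<open>y\<close> solves the equation that characterises \<open>R w\<close>.\<close>

lemma R_in_op_commutant: "R \<in> op_commutant T"
  unfolding op_commutant_def commutes_with_def
proof (intro CollectI conjI R_BH; clarify)
  fix v w assume vw: "(v, w) \<in> T"
  obtain y where y: "(R v, y) \<in> T" "(y, v - R v) \<in> T" using R_solves by blast
  have "y = R w" using y(2) T_diff[OF vw y(1)] by (rule R_char)
  then show "(R v, R w) \<in> T" using y by simp
qed

lemma C_in_op_commutant: "C \<in> op_commutant T"
  unfolding C_def
  by (rule bsqrt(3)[OF R_positive closed_unital_algebra_op_commutant R_in_op_commutant])

lemma C_T: "(v, w) \<in> T \<Longrightarrow> (C v, C w) \<in> T"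
  using C_in_op_commutant by (auto simp: op_commutant_def commutes_with_def)

lemma range_C_solves:
  "\<exists>y. (C (C w), y) \<in> T \<and> (norm y)\<^sup>2 + (norm (C (C w)))\<^sup>2 = (norm (C w))\<^sup>2"
proof -
  obtain y where y: "(R w, y) \<in> T" "(y, w - R w) \<in> T" using R_solves by blast
  have "Re (cinner w (R w)) = (norm (C w))\<^sup>2"
    using cinner_selfadjoint_square[OF C_selfadjoint, of w] by (simp add: CC)
  then show ?thesis using y R_form_norm[OF y] by (intro exI[of _ y]) (simp add: CC)
qed

text \<open>\<open>range_C_solves\<close> covers vectors of the dense range of \<open>C\<close>. The
  norm identity makes the images of an approximating sequence Cauchy, and closedness of
  \<open>T\<close> yields the value at \<open>x\<close>; thus \<open>C\<close> maps everything into
  the domain of \<open>T\<close>.\<close>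

lemma C_solves: "\<exists>z. (C x, z) \<in> T \<and> (norm z)\<^sup>2 + (norm (C x))\<^sup>2 = (norm x)\<^sup>2"
proof -
  have "x \<in> closure (range C)" using dense_range_C by simp
  then obtain X where X: "\<And>n. X n \<in> range C" "X \<longlonglongrightarrow> x" by (auto simp: closure_sequential)
  then have "\<exists>W. X n = C W" for n by auto
  then obtain W where W: "\<And>n. X n = C (W n)" by metis
  have "\<forall>n. \<exists>z. (C (X n), z) \<in> T \<and> (norm z)\<^sup>2 + (norm (C (X n)))\<^sup>2 = (norm (X n))\<^sup>2"
    unfolding W using range_C_solves by blast
  then obtain Z where Z: "\<And>n. (C (X n), Z n) \<in> T" "\<And>n. (norm (Z n))\<^sup>2 + (norm (C (X n)))\<^sup>2 = (norm (X n))\<^sup>2"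
    by metis
  \<comment> \<open>Differences stay in the range of \<open>C\<close>, with preimage
    \<open>W m - W n\<close>, so the norm identity applies to them as well.\<close>
  have le: "norm (Z m - Z n) \<le> norm (X m - X n)" for m n
  proof -
    obtain y where y: "(C (C (W m - W n)), y) \<in> T"
        "(norm y)\<^sup>2 + (norm (C (C (W m - W n))))\<^sup>2 = (norm (C (W m - W n)))\<^sup>2"
      using range_C_solves by blast
    have "C (W m - W n) = X m - X n" by (simp add: blinfun.diff_right W)
    with y have y': "(C (X m - X n), y) \<in> T" "(norm y)\<^sup>2 + (norm (C (X m - X n)))\<^sup>2 = (norm (X m - X n))\<^sup>2"
      by simp_all
    have eq: "Z m - Z n = y"
      using T_unique[OF T_diff[OF Z(1) Z(1)], of m n y] y'(1) by (simp add: blinfun.diff_right)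
    have "(norm (Z m - Z n))\<^sup>2 \<le> (norm (X m - X n))\<^sup>2"
      unfolding eq using y'(2) zero_le_power2[of "norm (C (X m - X n))"] by linarith
    then show ?thesis by (rule power2_le_imp_le) simp
  qed
  have "Cauchy Z"
    using le by (intro Cauchy_dominated[OF LIMSEQ_imp_Cauchy[OF X(2)], where K=1]) (simp add: dist_norm)
  then obtain z where z: "Z \<longlonglongrightarrow> z" by (auto simp: Cauchy_convergent_iff convergent_def)
  have CX: "(\<lambda>n. C (X n)) \<longlonglongrightarrow> C x" by (intro blinfun.tendsto tendsto_const X(2))
  have "(C x, z) \<in> T" by (rule T_closed[OF Z(1) CX z])
  moreover have "(norm z)\<^sup>2 + (norm (C x))\<^sup>2 = (norm x)\<^sup>2"
  proof (rule LIMSEQ_unique)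
    show "(\<lambda>n. (norm (X n))\<^sup>2) \<longlonglongrightarrow> (norm x)\<^sup>2" by (intro tendsto_intros X)
    show "(\<lambda>n. (norm (X n))\<^sup>2) \<longlonglongrightarrow> (norm z)\<^sup>2 + (norm (C x))\<^sup>2"
      unfolding Z(2)[symmetric] by (intro tendsto_intros z CX)
  qed
  ultimately show ?thesis by blast
qed

section \<open>The operator \<open>S = T C\<close>\<close>

lemma S_exists: "\<exists>S\<in>BH. \<forall>x. (C x, blinfun_apply S x) \<in> T \<and> (norm (S x))\<^sup>2 + (norm (C x))\<^sup>2 = (norm x)\<^sup>2"
proof -
  obtain f where f: "\<And>x. (C x, f x) \<in> T" "\<And>x. (norm (f x))\<^sup>2 + (norm (C x))\<^sup>2 = (norm x)\<^sup>2"
    using C_solves by metis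
  have hom: "f (c *\<^sub>C x) = c *\<^sub>C f x" for c x
    using T_unique[OF f(1)[of "c *\<^sub>C x"]] T_scaleC[OF f(1), of c x] by (simp add: BH_scaleC[OF C_BH])
  obtain S where "S \<in> BH" "blinfun_apply S = f"
  proof (rule BH_of_linear)
    show "f (x + y) = f x + f y" for x y
      using T_unique[OF f(1)[of "x + y"]] T_add[OF f(1) f(1), of x y] by (simp add: blinfun.add_right)
    show "norm (f x) \<le> 1 * norm x" for x
    proof (rule power2_le_imp_le)
      show "(norm (f x))\<^sup>2 \<le> (1 * norm x)\<^sup>2"
        using f(2)[of x] zero_le_power2[of "norm (C x)"] unfolding mult_1 by linarith
    qed simp
  qed (rule hom)
  then show ?thesis by (intro bexI[of _ S]) (simp_all add: f)
qed

definition S :: "'h \<Rightarrow>\<^sub>L 'h" where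
  "S = (SOME S. S \<in> BH \<and> (\<forall>x. (C x, blinfun_apply S x) \<in> T \<and> (norm (S x))\<^sup>2 + (norm (C x))\<^sup>2 = (norm x)\<^sup>2))"

lemma S_BH: "S \<in> BH" and C_S_in_T: "(C x, S x) \<in> T"
    and norm_S_C: "(norm (S x))\<^sup>2 + (norm (C x))\<^sup>2 = (norm x)\<^sup>2"
  using someI_ex[OF S_exists[unfolded Bex_def], folded S_def] by blast+

lemma C_S: "C (S x) = S (C x)"
  using T_unique[OF C_T[OF C_S_in_T] C_S_in_T] .

text \<open>Symmetry of \<open>T\<close> reads <S x, C z> = <C x, S z>. Since \<open>C\<close>
  commutes with \<open>S\<close>, this is symmetry of \<open>S\<close> against the dense range of
  \<open>C\<close>.\<close>

lemma S_selfadjoint: "selfadjoint S"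
  unfolding selfadjoint_def
proof (intro conjI allI S_BH)
  fix x y
  let ?M = "{y. cinner (S x) y = cinner x (S y)}"
  have "closed ?M" by (intro closed_Collect_eq continuous_intros)
  moreover have "range C \<subseteq> ?M"
  proof clarify
    fix z
    have "cinner (S x) (C z) = cinner (C x) (S z)"
      using T_symmetric[OF C_S_in_T C_S_in_T] by metis
    also have "\<dots> = cinner x (S (C z))" by (simp add: selfadjointD(2)[OF C_selfadjoint] C_S)
    finally show "cinner (S x) (C z) = cinner x (S (C z))" .
  qed
  ultimately have "closure (range C) \<subseteq> ?M" by (rule closure_minimal[rotated])
  then show "cinner (S x) y = cinner x (S y)" using dense_range_C by auto
qed

lemma SS_plus_CC: "S (S x) + C (C x) = x"
proof -
  have "(S o\<^sub>L S) + (C o\<^sub>L C) - id_blinfun = 0"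
  proof (rule selfadjoint_form_zero)
    show "selfadjoint ((S o\<^sub>L S) + (C o\<^sub>L C) - id_blinfun)"
      using S_selfadjoint C_selfadjoint
      by (intro selfadjoint_diff selfadjoint_add selfadjoint_compose) auto
    show "Re (cinner x (((S o\<^sub>L S) + (C o\<^sub>L C) - id_blinfun) x)) = 0" for x
      using norm_S_C[of x]
      by (simp add: blinfun.bilinear_simps cinner_simps norm_sq_cinner[of x, symmetric]
        cinner_selfadjoint_square[OF S_selfadjoint] cinner_selfadjoint_square[OF C_selfadjoint])
  qed
  then have "((S o\<^sub>L S) + (C o\<^sub>L C)) x = id_blinfun x" by simp
  then show ?thesis by (simp add: blinfun.add_left)
qed

lemma T_eq: "(v, w) \<in> T \<longleftrightarrow> (\<exists>x. v = C x \<and> w = S x)"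
proof
  assume vw: "(v, w) \<in> T"
  have Cw: "C w = S v" using T_unique[OF C_T[OF vw] C_S_in_T] .
  \<comment> \<open>If v = C x and w = S x, then C v + S w = (C^2 + S^2) x = x, which dictates this
    preimage.\<close>
  have "C (C v + S w) = v"
    using SS_plus_CC[of v] by (simp add: blinfun.add_right C_S Cw add.commute)
  moreover have "S (C v + S w) = w"
    using T_unique[OF C_S_in_T[of "C v + S w"]] vw calculation by simp
  ultimately show "\<exists>x. v = C x \<and> w = S x" by metis
qed (auto intro: C_S_in_T)

subsection \<open>The square root of \<open>I + T\<^sup>2\<close>\<close>

lemma one_plus_square_eq: "op_add Id (T O T) = (op_of R)\<inverse>"
proof (intro set_eqI iffI; clarify)
  fix x w assume "(x, w) \<in> op_add Id (T O T)"
  then obtain y z where "(x, y) \<in> T" "(y, z) \<in> T" "w = x + z" by (auto simp: op_add_def)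
  then show "(w, x) \<in> op_of R" using R_char[of x y w] by simp
next
  fix x w assume "(w, x) \<in> op_of R"
  then have x: "x = R w" by simp
  obtain y where "(x, y) \<in> T" "(y, w - x) \<in> T" using R_solves x by blast
  then have "(x, w - x) \<in> T O T" by blast
  then have "(x, x + (w - x)) \<in> op_add Id (T O T)" unfolding op_add_def by blast
  then show "(x, w) \<in> op_add Id (T O T)" by simp
qed

text \<open>For self-adjointness, testing (x, y) against all pairs (C w, w) gives <x, w> = <C y, w>
  for every \<open>w\<close>, hence x = C y.\<close>

lemma positive_op_inverse_C: "positive_op ((op_of C)\<inverse>)"
  unfolding positive_op_def self_adjoint_op_def
proof (intro conjI)
  show "linear_op ((op_of C)\<inverse>)"
    unfolding linear_op_def single_valued_def
  proof (intro conjI allI impI ballI; clarify?)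
    fix x y z assume "(y, x) \<in> op_of C" "(z, x) \<in> op_of C"
    then have "C (y - z) = 0" by (simp add: blinfun.diff_right)
    then show "y = z" using C_injective by fastforce
  qed (auto simp: blinfun.add_right BH_scaleC[OF C_BH])
  have "Domain ((op_of C)\<inverse>) = range C" by (auto simp: op_of_def)
  then show "densely_defined ((op_of C)\<inverse>)" by (simp add: densely_defined_def dense_range_C)
  show "adjoint_op ((op_of C)\<inverse>) = (op_of C)\<inverse>"
  proof (intro set_eqI iffI; clarify)
    fix x y assume "(x, y) \<in> adjoint_op ((op_of C)\<inverse>)"
    then have "cinner x w = cinner y (C w)" for w by (auto simp: adjoint_op_def)
    then have *: "cinner x w = cinner (C y) w" for w by (simp add: selfadjointD(2)[OF C_selfadjoint])
    have "x = C y"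
    proof (rule cinner_ext)
      show "cinner v x = cinner v (C y)" for v using *[of v] by (metis cinner_commute)
    qed
    then show "(y, x) \<in> op_of C" by simp
  next
    fix x y assume "(y, x) \<in> op_of C"
    then show "(x, y) \<in> adjoint_op ((op_of C)\<inverse>)"
      by (auto simp: adjoint_op_def selfadjointD(2)[OF C_selfadjoint])
  qed
  show "\<forall>(x, y)\<in>(op_of C)\<inverse>. 0 \<le> Re (cinner x y)"
    using C_positive by (auto simp: positive_bounded_def selfadjointD(2)[OF C_selfadjoint])
qed

lemma inverse_C_square: "(op_of C)\<inverse> O (op_of C)\<inverse> = (op_of R)\<inverse>"
  by (auto simp: relcomp_unfold CC)

text \<open>This justifies the \<open>THE\<close> in \<open>op_sqrt\<close>. A positive root
  \<open>B\<close> is onto and injective because its square is the inverse of the everywhere defined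
  \<open>R\<close>; its inverse is a bounded positive root of \<open>R\<close>, hence equals
  \<open>C\<close>.\<close>

lemma positive_root_unique:
  assumes B: "positive_op B" and sq: "B O B = (op_of R)\<inverse>"
  shows "B = (op_of C)\<inverse>"
proof -
  interpret B: selfadjoint_operator B
    by standard (use B in \<open>simp add: positive_op_def\<close>)
  have "\<exists>u. (u, w) \<in> B" for w
  proof -
    have "(R w, w) \<in> B O B" by (simp add: sq)
    then show ?thesis by blast
  qed
  then obtain d where d: "\<And>w. (d w, w) \<in> B" by metis
  have d_unique: "u = d w" if "(u, w) \<in> B" for u w
  proof -
    \<comment> \<open>Two preimages differ by a kernel vector of \<open>B\<close>, which is then
      also in the kernel of the square, and there it equals \<open>R 0 = 0\<close>.\<close>
    have "(u - d w, 0) \<in> B" using B.T_diff[OF that d[of w]] by simp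
    then have "(u - d w, 0) \<in> B O B" using B.T_zero by blast
    then show ?thesis by (simp add: sq)
  qed
  have dd: "d (d w) = R w" for w
  proof -
    have "(d (d w), w) \<in> B O B" using d by blast
    then show ?thesis by (simp add: sq)
  qed
  have sym: "cinner (d w) w' = cinner w (d w')" for w w' by (rule B.T_symmetric[OF d d])
  obtain D where D: "D \<in> BH" "blinfun_apply D = d"
  proof (rule BH_of_linear)
    show "d (x + y) = d x + d y" for x y using d_unique[OF B.T_add[OF d d]] by simp
    show "d (c *\<^sub>C x) = c *\<^sub>C d x" for c x using d_unique[OF B.T_scaleC[OF d]] by simp
    show "norm (d w) \<le> sqrt (norm R) * norm w" for w
    proof (rule power2_le_imp_le)
      have "(norm (d w))\<^sup>2 = Re (cinner w (R w))" by (simp add: norm_sq_cinner sym dd)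
      also have "\<dots> \<le> norm R * (norm w)\<^sup>2" using Re_cinner_apply_le[of w R] by linarith
      finally show "(norm (d w))\<^sup>2 \<le> (sqrt (norm R) * norm w)\<^sup>2"
        by (simp add: power_mult_distrib)
    qed simp
  qed
  then have "selfadjoint D" by (simp add: selfadjoint_def sym)
  moreover have "0 \<le> Re (cinner w (d w))" for w
    using B d[of w] Re_cinner_commute[of w "d w"] by (auto simp: positive_op_def)
  ultimately have "positive_bounded D" by (simp add: positive_bounded_def D)
  moreover have "D o\<^sub>L D = R" by (rule blinfun_eqI) (simp add: D dd)
  ultimately have "C = D" using bsqrt_unique[of D] by (simp add: C_def)
  then have "C w = d w" for w by (simp add: D)
  then have "(u, w) \<in> B \<longleftrightarrow> u = C w" for u w using d[of w] d_unique[of u w] by auto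
  then show ?thesis by auto
qed

lemma op_sqrt_one_plus_square: "op_sqrt (op_add Id (T O T)) = (op_of C)\<inverse>"
  unfolding op_sqrt_def one_plus_square_eq
proof (rule the_equality)
  show "positive_op ((op_of C)\<inverse>) \<and> (op_of C)\<inverse> O (op_of C)\<inverse> = (op_of R)\<inverse>"
    by (rule conjI[OF positive_op_inverse_C inverse_C_square])
qed (metis positive_root_unique)

lemma bounded_transform_eq: "bounded_transform T = S"
proof -
  have "(op_sqrt (op_add Id (T O T)))\<inverse> O T = op_of S"
    unfolding op_sqrt_one_plus_square
  proof (intro set_eqI iffI; clarify)
    fix x z y assume "(x, y) \<in> op_of C" "(y, z) \<in> T"
    then have "(C x, z) \<in> T" by simp
    then show "(x, z) \<in> op_of S" using T_unique[OF _ C_S_in_T] by simp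
  next
    fix x z assume "(x, z) \<in> op_of S"
    then show "(x, z) \<in> ((op_of C)\<inverse>)\<inverse> O T"
      using C_S_in_T by (auto intro!: relcompI[of x "C x"])
  qed
  then show ?thesis by (simp add: bounded_transform_def)
qed

text \<open>Commuting with \<open>T\<close> implies commuting with \<open>R\<close>, then with its
  root \<open>C\<close>, then with \<open>S = T C\<close>. Conversely R = I - S^2, so commuting with
  \<open>S\<close> gives \<open>R\<close>, then \<open>C\<close>, and the graph {(C x, S x)} is
  preserved.\<close>

lemma op_commutant_eq: "op_commutant T = {Q \<in> BH. Q o\<^sub>L S = S o\<^sub>L Q}"
proof (intro set_eqI iffI)
  fix Q assume Q: "Q \<in> op_commutant T"
  then have QT: "(x, y) \<in> T \<Longrightarrow> (Q x, Q y) \<in> T" for x y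
    by (auto simp: op_commutant_def commutes_with_def)
  have "Q (R w) = R (Q w)" for w
  proof -
    obtain y where y: "(R w, y) \<in> T" "(y, w - R w) \<in> T" using R_solves by blast
    show ?thesis using R_char[OF QT[OF y(1)]] QT[OF y(2)] by (simp add: blinfun.diff_right)
  qed
  then have "R o\<^sub>L Q = Q o\<^sub>L R" by (intro blinfun_eqI) simp
  from bsqrt_commute[OF R_positive this] have QC: "C (Q x) = Q (C x)" for x
    unfolding C_def by (metis blinfun_apply_blinfun_compose)
  have "Q (S x) = S (Q x)" for x
    using T_unique[OF QT[OF C_S_in_T]] C_S_in_T[of "Q x"] by (simp add: QC)
  then show "Q \<in> {Q \<in> BH. Q o\<^sub>L S = S o\<^sub>L Q}"
    using Q by (auto simp: op_commutant_def intro!: blinfun_eqI)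
next
  fix Q assume "Q \<in> {Q \<in> BH. Q o\<^sub>L S = S o\<^sub>L Q}"
  then have Q: "Q \<in> BH" and "Q o\<^sub>L S = S o\<^sub>L Q" by auto
  then have QS: "Q (S x) = S (Q x)" for x by (metis blinfun_apply_blinfun_compose)
  have "R x = x - S (S x)" for x using SS_plus_CC[of x] by (simp only: CC eq_diff_eq add.commute)
  then have "R o\<^sub>L Q = Q o\<^sub>L R" by (intro blinfun_eqI) (simp add: blinfun.diff_right QS)
  from bsqrt_commute[OF R_positive this] have QC: "C (Q x) = Q (C x)" for x
    unfolding C_def by (metis blinfun_apply_blinfun_compose)
  have "(Q v, Q w) \<in> T" if vw: "(v, w) \<in> T" for v w
  proof -
    obtain x where "v = C x" "w = S x" using T_eq[of v w] vw by blast
    then show ?thesis using C_S_in_T[of "Q x"] by (simp add: QC QS)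
  qed
  then show "Q \<in> op_commutant T" using Q by (auto simp: op_commutant_def commutes_with_def)
qed

end

section \<open>Commutants\<close>

text \<open>Taking commutants reverses inclusions, and a subset of \<open>BH\<close> is contained in
  its double commutant.\<close>

lemma triple_commutant: "A \<subseteq> BH \<Longrightarrow> commutant (commutant (commutant A)) = commutant A"
  unfolding commutant_def by fastforce

lemma cstar_subalgebra_BH: "cstar_subalgebra (BH :: ('h::chilbert_space \<Rightarrow>\<^sub>L 'h) set)"
  by (auto simp: cstar_subalgebra_def BH_add BH_compose BH_adj BH_scale_bop closed_BH)

lemma cstar_generated_subset_BH: "S \<in> BH \<Longrightarrow> cstar_generated S \<subseteq> BH"
  unfolding cstar_generated_def using cstar_subalgebra_BH by (intro Inter_lower) auto

lemma adj_id [simp]: "adj id_blinfun = id_blinfun" and adj_zero [simp]: "adj 0 = 0"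
  by (auto intro!: adj_eqI)

lemma scale_bop_compose:
  "Q \<in> BH \<Longrightarrow> Q o\<^sub>L scale_bop c X = scale_bop c (Q o\<^sub>L X)"
  "scale_bop c X o\<^sub>L Q = scale_bop c (X o\<^sub>L Q)"
  by (auto intro!: blinfun_eqI simp: blinfun_scale_bop BH_scaleC)

text \<open>The clause on \<open>adj X\<close> makes the set closed under adjoints, which
  commutation with a single non-self-adjoint \<open>Q\<close> does not ensure.\<close>

lemma cstar_subalgebra_commuting:
  assumes Q: "Q \<in> BH"
  shows "cstar_subalgebra {X \<in> BH. Q o\<^sub>L X = X o\<^sub>L Q \<and> Q o\<^sub>L adj X = adj X o\<^sub>L Q}" (is "cstar_subalgebra ?A")
  unfolding cstar_subalgebra_def
proof (intro conjI ballI allI)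
  show "closed ?A"
    unfolding closed_sequential_limits
  proof (intro allI impI; elim conjE)
    fix F X assume F: "\<forall>n. F n \<in> ?A" "F \<longlonglongrightarrow> X"
    have FB: "F n \<in> BH" for n using F(1) by blast
    have X: "X \<in> BH" using closed_sequentially[OF closed_BH _ F(2)] FB by blast
    have adjF: "(\<lambda>n. adj (F n)) \<longlonglongrightarrow> adj X" by (rule adj_tendsto[OF F(2) FB X])
    have comm: "Q o\<^sub>L Y = Y o\<^sub>L Q" if "\<And>n. Q o\<^sub>L G n = G n o\<^sub>L Q" "G \<longlonglongrightarrow> Y" for G Y
    proof (rule LIMSEQ_unique)
      show "(\<lambda>n. Q o\<^sub>L G n) \<longlonglongrightarrow> (Q o\<^sub>L Y)" by (rule blinfun_compose_tendsto[OF tendsto_const that(2)])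
      show "(\<lambda>n. Q o\<^sub>L G n) \<longlonglongrightarrow> (Y o\<^sub>L Q)"
        unfolding that(1) by (rule blinfun_compose_tendsto[OF that(2) tendsto_const])
    qed
    have "Q o\<^sub>L X = X o\<^sub>L Q" using F(1) by (intro comm[OF _ F(2)]) blast
    moreover have "Q o\<^sub>L adj X = adj X o\<^sub>L Q" using F(1) by (intro comm[OF _ adjF]) blast
    ultimately show "X \<in> ?A" using X by blast
  qed
next
  fix X Y assume XY: "X \<in> ?A" "Y \<in> ?A"
  then show "X + Y \<in> ?A" by (simp add: BH_add adj_add blinfun_compose_simps)
  have "Q o\<^sub>L (U o\<^sub>L V) = (U o\<^sub>L V) o\<^sub>L Q" if "Q o\<^sub>L U = U o\<^sub>L Q" "Q o\<^sub>L V = V o\<^sub>L Q" for U V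
    using that by (metis blinfun_compose_assoc')
  then show "X o\<^sub>L Y \<in> ?A" using XY by (simp add: BH_compose adj_compose)
next
  fix X assume X: "X \<in> ?A"
  then show "adj X \<in> ?A" by (simp add: BH_adj adj_adj)
  show "scale_bop c X \<in> ?A" for c
    using X Q by (simp add: BH_scale_bop adj_scale_bop scale_bop_compose)
qed (auto intro!: blinfun_eqI)

lemma commutant_cstar_generated:
  assumes S: "selfadjoint S"
  shows "commutant (cstar_generated S) = {Q \<in> BH. Q o\<^sub>L S = S o\<^sub>L Q}"
proof (intro set_eqI iffI)
  fix Q assume "Q \<in> commutant (cstar_generated S)"
  moreover have "S \<in> cstar_generated S" by (auto simp: cstar_generated_def)
  ultimately show "Q \<in> {Q \<in> BH. Q o\<^sub>L S = S o\<^sub>L Q}" by (auto simp: commutant_def)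
next
  fix Q assume "Q \<in> {Q \<in> BH. Q o\<^sub>L S = S o\<^sub>L Q}"
  then have Q: "Q \<in> BH" "Q o\<^sub>L S = S o\<^sub>L Q" by auto
  let ?A = "{X \<in> BH. Q o\<^sub>L X = X o\<^sub>L Q \<and> Q o\<^sub>L adj X = adj X o\<^sub>L Q}"
  have "id_blinfun \<in> ?A" by (simp add: blinfun_compose_simps)
  moreover have "S \<in> ?A" using S Q by (simp add: selfadjointD)
  ultimately have "cstar_generated S \<subseteq> ?A"
    unfolding cstar_generated_def using cstar_subalgebra_commuting[OF Q(1)] by (intro Inter_lower) simp
  then show "Q \<in> commutant (cstar_generated S)" using Q(1) by (auto simp: commutant_def)
qed

section \<open>Spectra\<close>

lemma self_adjoint_op_op_of:
  assumes S: "selfadjoint S"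
  shows "self_adjoint_op (op_of S)"
  unfolding self_adjoint_op_def
proof (intro conjI)
  show "linear_op (op_of S)"
    by (auto simp: linear_op_def single_valued_def blinfun.add_right BH_scaleC[OF selfadjointD(1)[OF S]])
  have "Domain (op_of S) = UNIV" by (auto simp: op_of_def)
  then show "densely_defined (op_of S)" by (simp add: densely_defined_def)
  show "adjoint_op (op_of S) = op_of S"
  proof (intro set_eqI iffI; clarify)
    fix x y assume "(x, y) \<in> adjoint_op (op_of S)"
    then have *: "cinner (S x) v = cinner y v" for v
      by (auto simp: adjoint_op_def selfadjointD(2)[OF S])
    have "y = S x" by (rule cinner_ext) (metis * cinner_commute)
    then show "(x, y) \<in> op_of S" by simp
  qed (auto simp: adjoint_op_def selfadjointD(2)[OF S])
qed

lemma resolvent_bound: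
  assumes R: "op_of R = {(x, y - z *\<^sub>C x) | x y. (x, y) \<in> X}\<inverse>" and xy: "(x, y) \<in> X"
  shows "norm x \<le> norm R * norm (y - z *\<^sub>C x)"
proof -
  have "(y - z *\<^sub>C x, x) \<in> op_of R" unfolding R using xy by blast
  then have "x = R (y - z *\<^sub>C x)" by simp
  then show ?thesis by (metis norm_blinfun)
qed

text \<open>For self-adjoint operators the real spectrum is the approximate point spectrum. A
  resolvent gives the lower bound; conversely a lower bound at real \<open>t\<close> also excludes
  eigenvectors, so \<open>resolvent_exists\<close> applies.\<close>

lemma real_spectrum_bounded_iff:
  assumes S: "selfadjoint S"
  shows "t \<notin> real_spectrum (op_of S) \<longleftrightarrow> (\<exists>e>0. \<forall>x. e * norm x \<le> norm (S x - t *\<^sub>R x))"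
proof
  assume "t \<notin> real_spectrum (op_of S)"
  then obtain R where R: "op_of R = {(x, y - complex_of_real t *\<^sub>C x) | x y. (x, y) \<in> op_of S}\<inverse>"
    by (auto simp: real_spectrum_def spectrum_def)
  have pos: "norm R + 1 > 0" by (simp add: add_nonneg_pos)
  have "norm x \<le> (norm R + 1) * norm (S x - t *\<^sub>R x)" for x
    using resolvent_bound[OF R, of x "S x"] by (simp add: scaleR_scaleC distrib_right add_increasing2)
  then have "1 / (norm R + 1) * norm x \<le> norm (S x - t *\<^sub>R x)" for x
    using pos by (simp add: pos_divide_le_eq mult.commute)
  then show "\<exists>e>0. \<forall>x. e * norm x \<le> norm (S x - t *\<^sub>R x)"
    using pos by (intro exI[of _ "1 / (norm R + 1)"]) simp
next
  assume "\<exists>e>0. \<forall>x. e * norm x \<le> norm (S x - t *\<^sub>R x)"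
  then obtain e where e: "e > 0" "\<And>x. e * norm x \<le> norm (S x - t *\<^sub>R x)" by blast
  interpret S: selfadjoint_operator "op_of S" by standard (rule self_adjoint_op_op_of[OF S])
  have "\<exists>R\<in>BH. op_of R = {(x, y - complex_of_real t *\<^sub>C x) | x y. (x, y) \<in> op_of S}\<inverse>"
  proof (rule S.resolvent_exists[OF e(1)])
    show "e * norm x \<le> norm (y - complex_of_real t *\<^sub>C x)" if "(x, y) \<in> op_of S" for x y
      using e(2)[of x] that by (simp add: scaleR_scaleC)
    show "x = 0" if "(x, cnj (complex_of_real t) *\<^sub>C x) \<in> op_of S" for x
    proof -
      have "S x = t *\<^sub>R x" using that by (simp add: scaleR_scaleC)
      then show ?thesis using e(1) e(2)[of x] by (simp add: mult_le_0_iff)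
    qed
  qed
  then show "t \<notin> real_spectrum (op_of S)" by (simp add: real_spectrum_def spectrum_def)
qed

text \<open>A lower bound \<open>e\<close> at \<open>t\<close> leaves \<open>e / 2\<close> at every
  point closer than \<open>e / 2\<close>. Closedness makes the cut-off to the spectrum Borel
  measurable.\<close>

lemma closed_real_spectrum:
  assumes S: "selfadjoint S"
  shows "closed (real_spectrum (op_of S))"
  unfolding closed_def open_dist
proof
  fix t assume "t \<in> - real_spectrum (op_of S)"
  then obtain e where e: "e > 0" "\<And>x. e * norm x \<le> norm (S x - t *\<^sub>R x)"
    using real_spectrum_bounded_iff[OF S, of t] by auto
  have "u \<in> - real_spectrum (op_of S)" if u: "dist u t < e / 2" for u
  proof -
    have "e / 2 * norm x \<le> norm (S x - u *\<^sub>R x)" for x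
    proof -
      have eq: "S x - t *\<^sub>R x = (S x - u *\<^sub>R x) + (u - t) *\<^sub>R x" by (simp add: algebra_simps)
      have "norm (S x - t *\<^sub>R x) \<le> norm (S x - u *\<^sub>R x) + \<bar>u - t\<bar> * norm x"
        using norm_triangle_ineq[of "S x - u *\<^sub>R x" "(u - t) *\<^sub>R x"]
        unfolding eq norm_scaleR .
      moreover have "\<bar>u - t\<bar> * norm x \<le> e / 2 * norm x"
        using u by (intro mult_right_mono) (auto simp: dist_real_def)
      ultimately show ?thesis using e(2)[of x] by simp
    qed
    then have "\<exists>e>0. \<forall>x. e * norm x \<le> norm (S x - u *\<^sub>R x)" using e(1) by (intro exI[of _ "e / 2"]) simp
    then show ?thesis using real_spectrum_bounded_iff[OF S, of u] by simp
  qed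
  then show "\<exists>e>0. \<forall>u. dist u t < e \<longrightarrow> u \<in> - real_spectrum (op_of S)"
    using e(1) by (intro exI[of _ "e / 2"]) auto
qed

context selfadjoint_operator
begin

text \<open>With \<open>C = \<surd>(I - S\<^sup>2)\<close> and \<open>c = \<surd>(1 - s\<^sup>2)\<close>, writing \<open>S\<close>, \<open>C\<close>, \<open>s\<close>, \<open>c\<close> as sines and cosines leads to the
  identity \<open>(1 + cC + sS)(S - s) = c (C + c)(S - (s / c) C)\<close>. Here \<open>C + c \<ge> c\<close>, and
  \<open>S - (s / c) C = (T - s / c) C\<close> is bounded below when \<open>s / c\<close> is not in the spectrum of \<open>T\<close>.\<close>

lemma spectrum_bounded_transform:
  assumes s: "s \<in> real_spectrum (op_of S)" "\<bar>s\<bar> < 1"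
  shows "s / sqrt (1 - s\<^sup>2) \<in> real_spectrum T"
proof (rule ccontr)
  define c where "c = sqrt (1 - s\<^sup>2)"
  define u where "u = s / c"
  assume "s / sqrt (1 - s\<^sup>2) \<notin> real_spectrum T"
  then obtain Q where Q: "op_of Q = {(x, y - complex_of_real u *\<^sub>C x) | x y. (x, y) \<in> T}\<inverse>"
    by (auto simp: real_spectrum_def spectrum_def u_def c_def)
  have "s\<^sup>2 < 1" using s(2) by (simp add: abs_square_less_1)
  then have c: "c > 0" "c\<^sup>2 = 1 - s\<^sup>2" by (simp_all add: c_def)
  have cu: "c * u = s" using c by (simp add: u_def)
  \<comment> \<open>This is \<open>(T - u) C\<close>, so the assumed inverse of \<open>T - u\<close>
    bounds \<open>C x\<close> by a multiple of \<open>D x\<close>; the constant \<open>K\<close>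
    adds the resulting bounds for \<open>C x\<close> and \<open>S x\<close>.\<close>
  define D where "D x = S x - u *\<^sub>R C x" for x
  define K where "K = 1 + \<bar>u\<bar> * norm Q + norm Q"
  have K: "K > 0" by (simp add: K_def add_pos_nonneg)
  have D_low: "norm x \<le> K * norm (D x)" for x
  proof -
    have C_le: "norm (C x) \<le> norm Q * norm (D x)"
      using resolvent_bound[OF Q C_S_in_T, of x] by (simp add: D_def scaleR_scaleC)
    have "norm (S x) \<le> norm (D x) + \<bar>u\<bar> * norm (C x)"
      using norm_triangle_ineq[of "D x" "u *\<^sub>R C x"] by (simp add: D_def)
    also have "\<dots> \<le> norm (D x) + \<bar>u\<bar> * (norm Q * norm (D x))"
      by (intro add_left_mono mult_left_mono C_le) simp
    finally have "norm (S x) + norm (C x) \<le> K * norm (D x)"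
      using C_le by (simp add: K_def algebra_simps)
    moreover have "norm x \<le> norm (S x) + norm (C x)"
    proof (rule power2_le_imp_le)
      show "(norm x)\<^sup>2 \<le> (norm (S x) + norm (C x))\<^sup>2"
        unfolding norm_S_C[of x, symmetric] by (simp add: power2_sum)
    qed simp
    ultimately show ?thesis by linarith
  qed
  define M where "M = id_blinfun + c *\<^sub>R C + s *\<^sub>R S"
  have identity: "M (S x - s *\<^sub>R x) = c *\<^sub>R (C (D x) + c *\<^sub>R D x)" for x
  proof -
    have CC': "C (C x) = x - S (S x)" using SS_plus_CC[of x] by (simp only: eq_diff_eq add.commute)
    have "M (S x - s *\<^sub>R x)
        = (1 - s\<^sup>2) *\<^sub>R S x - s *\<^sub>R x + c *\<^sub>R C (S x) - (c * s) *\<^sub>R C x + s *\<^sub>R S (S x)"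
      by (simp add: M_def blinfun.bilinear_simps algebra_simps power2_eq_square)
    also have "\<dots> = c\<^sup>2 *\<^sub>R S x - (c * u) *\<^sub>R (x - S (S x)) + c *\<^sub>R C (S x) - (c * (c * u)) *\<^sub>R C x"
      by (simp only: cu c(2)) (simp add: algebra_simps)
    also have "\<dots> = c *\<^sub>R (C (D x) + c *\<^sub>R D x)"
      unfolding CC'[symmetric]
      by (simp add: D_def blinfun.bilinear_simps algebra_simps power2_eq_square)
    finally show ?thesis .
  qed
  have low: "c * norm y \<le> norm (C y + c *\<^sub>R y)" for y
  proof (cases "y = 0")
    case False
    have "c * (norm y)\<^sup>2 \<le> Re (cinner y (C y + c *\<^sub>R y))"
      using C_positive by (simp add: cinner_simps positive_bounded_def norm_sq_cinner)
    also have "\<dots> \<le> norm y * norm (C y + c *\<^sub>R y)"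
      using Re_cinner_le[of y "C y + c *\<^sub>R y"] by linarith
    finally show ?thesis using False by (simp add: power2_eq_square mult.left_commute)
  qed simp
  \<comment> \<open>The identity and the bound by \<open>c\<close> give c^2 ||x|| <= K ||M (S x - s
    x)||; dividing by K (||M|| + 1) yields this constant.\<close>
  define e where "e = c * c / (K * (norm M + 1))"
  have M1: "norm M + 1 > 0" by (simp add: add_nonneg_pos)
  have e: "e > 0" using c K M1 by (simp add: e_def)
  have "e * norm x \<le> norm (S x - s *\<^sub>R x)" for x
  proof -
    have "c * c * norm x \<le> c * c * (K * norm (D x))" using c by (intro mult_left_mono D_low) auto
    also have "\<dots> = K * (c * (c * norm (D x)))" by simp
    also have "\<dots> \<le> K * (c * norm (C (D x) + c *\<^sub>R D x))"
      using K c by (intro mult_left_mono low) auto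
    also have "\<dots> = K * norm (M (S x - s *\<^sub>R x))" using c by (simp add: identity)
    also have "\<dots> \<le> K * ((norm M + 1) * norm (S x - s *\<^sub>R x))"
    proof (intro mult_left_mono)
      have "norm (M (S x - s *\<^sub>R x)) \<le> norm M * norm (S x - s *\<^sub>R x)" by (rule norm_blinfun)
      also have "\<dots> \<le> (norm M + 1) * norm (S x - s *\<^sub>R x)" by (intro mult_right_mono) auto
      finally show "norm (M (S x - s *\<^sub>R x)) \<le> (norm M + 1) * norm (S x - s *\<^sub>R x)" .
    qed (use K in simp)
    finally have "c * c * norm x \<le> (K * (norm M + 1)) * norm (S x - s *\<^sub>R x)" by (simp add: mult.assoc)
    then show ?thesis
      using K M1 by (simp add: e_def pos_divide_le_eq mult.commute mult.left_commute)
  qed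
  then have "s \<notin> real_spectrum (op_of S)"
    using e real_spectrum_bounded_iff[OF S_selfadjoint, of s] by blast
  then show False using s(1) by simp
qed

section \<open>The functional calculus\<close>

lemma op_commutant_eq_commutant: "op_commutant T = commutant (cstar_generated S)"
  by (simp add: op_commutant_eq commutant_cstar_generated[OF S_selfadjoint])

lemma wstar_eq: "wstar T = wstar_bounded S"
  by (simp add: wstar_def wstar_bounded_def op_commutant_eq_commutant)

text \<open>The commutant of \<open>T\<close> is itself a commutant of a set of bounded operators,
  so the triple commutant collapses. It identifies the operators against which affiliation is
  tested.\<close>

lemma commutant_wstar: "commutant (wstar T) = op_commutant T"
  unfolding wstar_def op_commutant_eq_commutant
  by (rule triple_commutant[OF cstar_generated_subset_BH[OF S_BH]])

sublocale spectral_resolution "spectral_measure S" S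
  using spectral_theorem[OF S_selfadjoint] S_selfadjoint by unfold_locales

text \<open>Merges the cut-off to the spectrum of \<open>S\<close> made by
  \<open>borel_calculus\<close> with the cut-off to (-1, 1) made by \<open>fun_calculus\<close>, so
  that the calculus becomes a single spectral integral.\<close>

definition pullback :: "(real \<Rightarrow> complex) \<Rightarrow> real \<Rightarrow> complex" where
  "pullback f t = (if t \<in> real_spectrum (op_of S) \<inter> {-1<..<1} then f (t / sqrt (1 - t\<^sup>2)) else 0)"

lemma fun_calculus_eq: "fun_calculus T f = SP (pullback f)"
  unfolding fun_calculus_def borel_calculus_def bounded_transform_eq pullback_def
  by (intro arg_cong[where f=SP]) auto

text \<open>\<open>f\<close> is Borel only relative to the spectrum of \<open>T\<close>, so the
  inner map must send the cut-off set into that spectrum, as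
  \<open>spectrum_bounded_transform\<close> guarantees.\<close>

lemma pullback_measurable:
  assumes f: "f \<in> borel_funs (real_spectrum T)"
  shows "pullback f \<in> borel_measurable borel"
proof -
  let ?K = "real_spectrum (op_of S) \<inter> {-1<..<1}"
  have K: "?K \<in> sets borel"
    using borel_closed[OF closed_real_spectrum[OF S_selfadjoint]] by simp
  have "(\<lambda>t::real. t / sqrt (1 - t\<^sup>2)) \<in> borel_measurable borel" by measurable
  then have "(\<lambda>t. t / sqrt (1 - t\<^sup>2)) \<in> restrict_space borel ?K \<rightarrow>\<^sub>M restrict_space borel (real_spectrum T)"
    by (intro measurable_restrict_space2 measurable_restrict_space1)
      (auto simp: space_restrict_space intro!: spectrum_bounded_transform)
  then have "(\<lambda>t. f (t / sqrt (1 - t\<^sup>2))) \<in> borel_measurable (restrict_space borel ?K)"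
    using f unfolding borel_funs_def by (rule measurable_compose)
  then show ?thesis
    unfolding pullback_def using K
    by (subst measurable_If_restrict_space_iff) (simp_all del: Int_iff)
qed

text \<open>Each value of the pullback is either 0 or a value of \<open>f\<close> on the spectrum of
  \<open>T\<close>; the inserted 0 in \<open>sup_norm\<close> covers the first case.\<close>

lemma pullback_bounded:
  assumes f: "f \<in> bounded_borel_funs (real_spectrum T)"
  shows "cmod (pullback f t) \<le> sup_norm (real_spectrum T) f"
proof -
  let ?V = "insert 0 ((\<lambda>t. cmod (f t)) ` real_spectrum T)"
  obtain B where "\<And>t. t \<in> real_spectrum T \<Longrightarrow> cmod (f t) \<le> B"
    using f by (auto simp: bounded_borel_funs_def bounded_iff)
  then have bdd: "bdd_above ?V" by (intro bdd_aboveI[of _ "max 0 B"]) fastforce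
  have "cmod (pullback f t) \<in> ?V"
    using spectrum_bounded_transform[of t] by (auto simp: pullback_def)
  then show ?thesis unfolding sup_norm_def using bdd by (rule cSup_upper)
qed

definition \<Phi> :: "(real \<Rightarrow> complex) \<Rightarrow> ('h \<Rightarrow>\<^sub>L 'h)" where "\<Phi> f = as_bounded (fun_calculus T f)"

text \<open>A spectral integral is single-valued, so an everywhere defined operator whose graph it
  contains is all of it. Each homomorphism identity is verified in this form.\<close>

lemma \<Phi>_eqI:
  fixes G :: "'h \<Rightarrow>\<^sub>L 'h"
  assumes "pullback h \<in> borel_measurable borel" "\<And>x. (x, G x) \<in> SP (pullback h)"
  shows "\<Phi> h = G"
proof -
  have "(x, y) \<in> SP (pullback h) \<longleftrightarrow> y = G x" for x y
    using SP_unique[OF assms(1)] assms(2) by blast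
  then have "SP (pullback h) = op_of G" by auto
  then show ?thesis by (simp add: \<Phi>_def fun_calculus_eq)
qed

lemma \<Phi>:
  assumes f: "f \<in> bounded_borel_funs (real_spectrum T)"
  shows \<Phi>_BH: "\<Phi> f \<in> BH" and op_of_\<Phi>: "op_of (\<Phi> f) = SP (pullback f)"
    and norm_\<Phi>_le: "norm (\<Phi> f) \<le> sup_norm (real_spectrum T) f"
    and \<Phi>_mem: "(x, \<Phi> f x) \<in> SP (pullback f)"
    and pullback_borel: "pullback f \<in> borel_measurable borel"
proof -
  show m: "pullback f \<in> borel_measurable borel"
    using f by (intro pullback_measurable) (simp add: bounded_borel_funs_def)
  obtain G where G: "G \<in> BH" "op_of G = SP (pullback f)" "norm G \<le> sup_norm (real_spectrum T) f"
    using SP_bounded[OF m pullback_bounded[OF f]] by blast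
  have "\<Phi> f = G" by (simp add: \<Phi>_def fun_calculus_eq flip: G(2))
  then show "\<Phi> f \<in> BH" "op_of (\<Phi> f) = SP (pullback f)" "norm (\<Phi> f) \<le> sup_norm (real_spectrum T) f"
    using G by simp_all
  from this(2)[symmetric] show "(x, \<Phi> f x) \<in> SP (pullback f)" by simp
qed

lemma op_commutant_SP:
  assumes "Q \<in> op_commutant T" "g \<in> borel_measurable borel" "(x, y) \<in> SP g"
  shows "(Q x, Q y) \<in> SP g"
  using assms(1) E_commutes_with_commutant[of Q]
  by (intro SP_commute[OF assms(2,3)]) (auto simp: op_commutant_eq)

lemma star_homomorphism_\<Phi>: "star_homomorphism (bounded_borel_funs (real_spectrum T)) (wstar T) \<Phi>"
  unfolding star_homomorphism_def
proof (intro conjI ballI allI)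
  fix f assume f: "f \<in> bounded_borel_funs (real_spectrum T)"
  note [measurable] = pullback_borel[OF f]
  show "\<Phi> f \<in> wstar T"
    unfolding wstar_def commutant_def
  proof (intro CollectI conjI ballI blinfun_eqI)
    fix Q x assume "Q \<in> op_commutant T"
    from op_commutant_SP[OF this pullback_borel[OF f] \<Phi>_mem[OF f]]
    show "(\<Phi> f o\<^sub>L Q) x = (Q o\<^sub>L \<Phi> f) x" by (simp flip: op_of_\<Phi>[OF f])
  qed (rule \<Phi>_BH[OF f])
  show "\<Phi> (\<lambda>t. cnj (f t)) = adj (\<Phi> f)"
  proof (rule \<Phi>_eqI)
    have eq: "pullback (\<lambda>t. cnj (f t)) = (\<lambda>t. cnj (pullback f t))" by (auto simp: pullback_def)
    show m: "pullback (\<lambda>t. cnj (f t)) \<in> borel_measurable borel"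
      unfolding eq by (rule borel_measurable_cnj) measurable
    have "cmod (cnj (pullback f t)) \<le> sup_norm (real_spectrum T) f" for t
      using pullback_bounded[OF f, of t] by simp
    \<comment> \<open>The conjugate function also has a bounded integral; \<open>SP_adjoint\<close>
      identifies it with the adjoint.\<close>
    then obtain G where G: "op_of G = SP (\<lambda>t. cnj (pullback f t))"
      using SP_bounded[OF m[unfolded eq]] by metis
    have "(x, G x) \<in> SP (\<lambda>t. cnj (pullback f t))" for x by (simp flip: G)
    from SP_adjoint[OF pullback_borel[OF f] \<Phi>_mem[OF f] this]
    have "adj (\<Phi> f) = G" by (intro adj_eqI) simp
    then show "(x, adj (\<Phi> f) x) \<in> SP (pullback (\<lambda>t. cnj (f t)))" for x by (simp add: eq flip: G)
  qed
  show "\<Phi> (\<lambda>t. c * f t) = scale_bop c (\<Phi> f)" for c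
  proof (rule \<Phi>_eqI)
    have eq: "pullback (\<lambda>t. c * f t) = (\<lambda>t. c * pullback f t)" by (auto simp: pullback_def)
    show "pullback (\<lambda>t. c * f t) \<in> borel_measurable borel" unfolding eq by measurable
    show "(x, scale_bop c (\<Phi> f) x) \<in> SP (pullback (\<lambda>t. c * f t))" for x
      unfolding eq blinfun_scale_bop by (intro SP_cmult \<Phi>_mem[OF f]) measurable
  qed
next
  fix f g assume f: "f \<in> bounded_borel_funs (real_spectrum T)" and g: "g \<in> bounded_borel_funs (real_spectrum T)"
  note [measurable] = pullback_borel[OF f] pullback_borel[OF g]
  show "\<Phi> (\<lambda>t. f t + g t) = \<Phi> f + \<Phi> g"
  proof (rule \<Phi>_eqI)
    have eq: "pullback (\<lambda>t. f t + g t) = (\<lambda>t. pullback f t + pullback g t)" by (auto simp: pullback_def)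
    show "pullback (\<lambda>t. f t + g t) \<in> borel_measurable borel" unfolding eq by measurable
    show "(x, (\<Phi> f + \<Phi> g) x) \<in> SP (pullback (\<lambda>t. f t + g t))" for x
      unfolding eq blinfun.add_left by (intro SP_add \<Phi>_mem f g) measurable
  qed
  show "\<Phi> (\<lambda>t. f t * g t) = \<Phi> f o\<^sub>L \<Phi> g"
  proof (rule \<Phi>_eqI)
    have eq: "pullback (\<lambda>t. f t * g t) = (\<lambda>t. pullback f t * pullback g t)" by (auto simp: pullback_def)
    show "pullback (\<lambda>t. f t * g t) \<in> borel_measurable borel" unfolding eq by measurable
    show "(x, (\<Phi> f o\<^sub>L \<Phi> g) x) \<in> SP (pullback (\<lambda>t. f t * g t))" for x
      unfolding eq
      using SP_mult[OF pullback_borel[OF g] pullback_borel[OF f] pullback_bounded[OF f] \<Phi>_mem[OF g] \<Phi>_mem[OF f]]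
      by simp
  qed
qed

text \<open>By \<open>commutant_wstar\<close> the operators to test are those commuting with
  \<open>T\<close>; they commute with the spectral projections of \<open>S\<close> and therefore
  preserve the graph of every integral.\<close>

lemma affiliated_fun_calculus:
  assumes "f \<in> borel_funs (real_spectrum T)"
  shows "affiliated (fun_calculus T f) (wstar T)"
  unfolding affiliated_def fun_calculus_eq commutant_wstar commutes_with_def
  using closed_op_SP[OF pullback_measurable[OF assms]] op_commutant_SP[OF _ pullback_measurable[OF assms]]
  by blast

end

theorem theorem4:
  fixes T :: "'h::chilbert_space op"
  assumes "self_adjoint_op T"
  shows "wstar T = wstar_bounded (bounded_transform T)
    \<and> (\<exists>\<Phi>. (\<forall>f \<in> bounded_borel_funs (real_spectrum T). op_of (\<Phi> f) = fun_calculus T f)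
          \<and> star_homomorphism (bounded_borel_funs (real_spectrum T)) (wstar T) \<Phi>
          \<and> (\<forall>f \<in> bounded_borel_funs (real_spectrum T).
               norm (\<Phi> f) \<le> sup_norm (real_spectrum T) f))
    \<and> (\<forall>f \<in> borel_funs (real_spectrum T). affiliated (fun_calculus T f) (wstar T))"
proof -
  interpret selfadjoint_operator T by standard fact
  show ?thesis
  proof (intro conjI exI[of _ \<Phi>] ballI)
    show "wstar T = wstar_bounded (bounded_transform T)" by (simp add: bounded_transform_eq wstar_eq)
    show "op_of (\<Phi> f) = fun_calculus T f" if "f \<in> bounded_borel_funs (real_spectrum T)" for f
      by (simp add: op_of_\<Phi>[OF that] fun_calculus_eq)
  qed (fact star_homomorphism_\<Phi> norm_\<Phi>_le affiliated_fun_calculus)+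
qed

end
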